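(* Let $(A,B,C,D)\in\mathbf{C}^4$ and let $m$ be a point of $S_{(A,B,C,D)}$ whose $\Gamma_2^*$-orbit is bounded and has length $>4$ (possibly infinite). Then the parameters $A,B,C,D$ are real numbers and the orbit is contained in the real part $S_{(A,B,C,D)}(\mathbf{R})$ of the surface. If the orbit of $m$ is finite, then both the surface and the orbit are defined over a real number field (i.e. $A,B,C,D$ and the coordinates of the points of the orbit lie in a real number field). If the orbit of $m$ is infinite, then it corresponds to an $\mathrm{SU}(2)$-representation for a convenient choice of parameters $(a,b,c,d)$ (i.e. there are $(a,b,c,d)$ with $\Pi(a,b,c,d)=(A,B,C,D)$ and a representation $\rho:\pi_1(\mathbb{S}^2_4)\to\mathrm{SU}(2)$ with $\chi(\rho)=(a,b,c,d,m)$), and the orbit is contained and dense in the unique bounded connected component of the smooth part of $S_{(A,B,C,D)}(\mathbf{R})$.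
   Context: For $(A,B,C,D)\in\mathbf{C}^4$, $S_{(A,B,C,D)}\subset\mathbf{C}^3$ is the affine cubic surface $x^2+y^2+z^2+xyz=Ax+By+Cz+D$; when the parameters are real, $S_{(A,B,C,D)}(\mathbf{R})$ is its set of real points and its smooth part is $S_{(A,B,C,D)}(\mathbf{R})$ minus the singular points of $S_{(A,B,C,D)}$. $\Gamma_2^*=\{M\in \mathrm{PGL}(2,\mathbf{Z}) : M\equiv \mathrm{Id} \bmod 2\}$ is the free product of three groups of order two, generated by $s_x=\begin{pmatrix}-1&2\\0&1\end{pmatrix}$, $s_y=\begin{pmatrix}1&0\\2&-1\end{pmatrix}$, $s_z=\begin{pmatrix}1&0\\0&-1\end{pmatrix}$, and acts on $S_{(A,B,C,D)}$ by letting $s_x,s_y,s_z$ act respectively by $(x,y,z)\mapsto(A-x-yz,y,z)$, $(x,y,z)\mapsto(x,B-y-xz,z)$, $(x,y,z)\mapsto(x,y,C-z-xy)$. The length of an orbit is its cardinality. Let $\mathbb{S}^2_4$ be the four punctured sphere, $\pi_1(\mathbb{S}^2_4)=\langle\alpha,\beta,\gamma,\delta\mid\alpha\beta\gamma\delta=1\rangle$. For a representation $\rho$ of $\pi_1(\mathbb{S}^2_4)$ into $\mathrm{SL}(2,\mathbf{C})$ set $\chi(\rho)=(a,b,c,d,x,y,z)$ with $a=\mathrm{tr}\rho(\alpha)$, $b=\mathrm{tr}\rho(\beta)$, $c=\mathrm{tr}\rho(\gamma)$, $d=\mathrm{tr}\rho(\delta)$, $x=\mathrm{tr}\rho(\alpha\beta)$,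 $y=\mathrm{tr}\rho(\beta\gamma)$, $z=\mathrm{tr}\rho(\gamma\alpha)$. Then $(x,y,z)\in S_{(A,B,C,D)}$ with $(A,B,C,D)=\Pi(a,b,c,d)$, where $\Pi(a,b,c,d)=(ab+cd,\ bc+ad,\ ac+bd,\ 4-a^2-b^2-c^2-d^2-abcd)$. *)

theory Defs
  imports
    "HOL-Analysis.Analysis"
    "HOL-Algebra.Group_Action"
    "HOL-Algebra.Algebraic_Closure_Type"
begin

section \<open>The cubic surfaces\<close>

definition surface :: "complex \<Rightarrow> complex \<Rightarrow> complex \<Rightarrow> complex \<Rightarrow> (complex \<times> complex \<times> complex) set"
  where "surface A B C D =
    {(x, y, z). x\<^sup>2 + y\<^sup>2 + z\<^sup>2 + x * y * z = A * x + B * y + C * z + D}"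

definition real_surface :: "complex \<Rightarrow> complex \<Rightarrow> complex \<Rightarrow> complex \<Rightarrow> (complex \<times> complex \<times> complex) set"
  where "real_surface A B C D = surface A B C D \<inter> (\<real> \<times> \<real> \<times> \<real>)"

text \<open>Jacobian criterion: the defining polynomial has vanishing differential.\<close>

definition singular_points :: "complex \<Rightarrow> complex \<Rightarrow> complex \<Rightarrow> complex \<Rightarrow> (complex \<times> complex \<times> complex) set"
  where "singular_points A B C D =
    {p \<in> surface A B C D.
      ((\<lambda>(x, y, z). x\<^sup>2 + y\<^sup>2 + z\<^sup>2 + x * y * z - A * x - B * y - C * z - D)
        has_derivative (\<lambda>_. 0)) (at p)}"

text \<open>The real points are kept inside complex 3-space; the subspace topology on them is the
  usual topology of real 3-space.\<close>

definition smooth_real_surface :: "complex \<Rightarrow> complex \<Rightarrow> complex \<Rightarrow> complex \<Rightarrow> (complex \<times> complex \<times> complex) set"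
  where "smooth_real_surface A B C D = real_surface A B C D - singular_points A B C D"


section \<open>The congruence subgroup\<close>

definition mat2 :: "'a \<Rightarrow> 'a \<Rightarrow> 'a \<Rightarrow> 'a \<Rightarrow> 'a::zero ^ 2 ^ 2"
  where "mat2 p q r s = vector [vector [p, q], vector [r, s]]"

definition GL2Z :: "(int ^ 2 ^ 2) monoid"
  where "GL2Z = \<lparr>carrier = {M. invertible M}, monoid.mult = (**), one = mat 1\<rparr>"

definition PGL2Z :: "(int ^ 2 ^ 2) set monoid"
  where "PGL2Z = GL2Z Mod {mat 1, mat (-1)}"

definition proj_class :: "int ^ 2 ^ 2 \<Rightarrow> (int ^ 2 ^ 2) set"
  where "proj_class M = {mat 1, mat (-1)} #>\<^bsub>GL2Z\<^esub> M"

definition Gamma2_star :: "(int ^ 2 ^ 2) set monoid"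
  where "Gamma2_star = PGL2Z
    \<lparr>carrier := {K \<in> carrier PGL2Z. \<exists>M\<in>K. \<forall>i j. M $ i $ j mod 2 = mat 1 $ i $ j mod 2}\<rparr>"

definition s_x :: "(int ^ 2 ^ 2) set" where "s_x = proj_class (mat2 (-1) 2 0 1)"
definition s_y :: "(int ^ 2 ^ 2) set" where "s_y = proj_class (mat2 1 0 2 (-1))"
definition s_z :: "(int ^ 2 ^ 2) set" where "s_z = proj_class (mat2 1 0 0 (-1))"


section \<open>The action on the surface\<close>

definition is_surface_action ::
  "complex \<Rightarrow> complex \<Rightarrow> complex \<Rightarrow> complex \<Rightarrow>
    ((int ^ 2 ^ 2) set \<Rightarrow> complex \<times> complex \<times> complex \<Rightarrow> complex \<times> complex \<times> complex) \<Rightarrow> bool"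
  where "is_surface_action A B C D \<phi> \<longleftrightarrow>
    group_action Gamma2_star (surface A B C D) \<phi> \<and>
    (\<forall>(x, y, z) \<in> surface A B C D.
      \<phi> s_x (x, y, z) = (A - x - y * z, y, z) \<and>
      \<phi> s_y (x, y, z) = (x, B - y - x * z, z) \<and>
      \<phi> s_z (x, y, z) = (x, y, C - z - x * y))"

text \<open>Such an action exists and its values on the group are uniquely determined: see
  \<open>surface_action\<close> and \<open>surface_action_unique\<close> below.\<close>

definition surface_action ::
  "complex \<Rightarrow> complex \<Rightarrow> complex \<Rightarrow> complex \<Rightarrow>
    (int ^ 2 ^ 2) set \<Rightarrow> complex \<times> complex \<times> complex \<Rightarrow> complex \<times> complex \<times> complex"
  where "surface_action A B C D = (SOME \<phi>. is_surface_action A B C D \<phi>)"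

definition surface_orbit ::
  "complex \<Rightarrow> complex \<Rightarrow> complex \<Rightarrow> complex \<Rightarrow> complex \<times> complex \<times> complex \<Rightarrow> (complex \<times> complex \<times> complex) set"
  where "surface_orbit A B C D m = orbit Gamma2_star (surface_action A B C D) m"


section \<open>Number fields\<close>

definition real_number_field :: "complex set \<Rightarrow> bool"
  where "real_number_field K \<longleftrightarrow>
    subfield K (ring_of_type_algebra :: complex ring) \<and>
    ring.finite_dimension (ring_of_type_algebra :: complex ring) \<rat> K \<and>
    K \<subseteq> \<real>"


section \<open>The fundamental group of the four punctured sphere\<close>

datatype loop = loop_alpha | loop_beta | loop_gamma | loop_delta

text \<open>Words in the generators; the flag \<open>True\<close> marks an inverse.\<close>

type_synonym loop_word = "(loop \<times> bool) list"

inductive loop_step :: "loop_word \<Rightarrow> loop_word \<Rightarrow> bool" where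
  cancel: "loop_step (u @ [(g, e), (g, \<not> e)] @ v) (u @ v)"
| relator: "loop_step (u @ [(loop_alpha, False), (loop_beta, False), (loop_gamma, False), (loop_delta, False)] @ v) (u @ v)"

definition loop_class :: "loop_word \<Rightarrow> loop_word set"
  where "loop_class w = {v. equivclp loop_step w v}"

definition pi1 :: "loop_word set monoid"
  where "pi1 =
    \<lparr>carrier = range loop_class,
     monoid.mult = (\<lambda>K L. \<Union>u\<in>K. \<Union>v\<in>L. loop_class (u @ v)),
     one = loop_class []\<rparr>"

definition loop_gen :: "loop \<Rightarrow> loop_word set"
  where "loop_gen g = loop_class [(g, False)]"


section \<open>Representations and their invariants\<close>

definition SU2 :: "(complex ^ 2 ^ 2) monoid"
  where "SU2 =
    \<lparr>carrier = {M. M ** transpose (map_matrix cnj M) = mat 1 \<and> det M = 1},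
     monoid.mult = (**), one = mat 1\<rparr>"

definition chi ::
  "(loop_word set \<Rightarrow> complex ^ 2 ^ 2) \<Rightarrow>
    complex \<times> complex \<times> complex \<times> complex \<times> complex \<times> complex \<times> complex"
  where "chi \<rho> =
    (trace (\<rho> (loop_gen loop_alpha)), trace (\<rho> (loop_gen loop_beta)),
     trace (\<rho> (loop_gen loop_gamma)), trace (\<rho> (loop_gen loop_delta)),
     trace (\<rho> (loop_gen loop_alpha \<otimes>\<^bsub>pi1\<^esub> loop_gen loop_beta)),
     trace (\<rho> (loop_gen loop_beta \<otimes>\<^bsub>pi1\<^esub> loop_gen loop_gamma)),
     trace (\<rho> (loop_gen loop_gamma \<otimes>\<^bsub>pi1\<^esub> loop_gen loop_alpha)))"

definition Pi_map ::
  "complex \<times> complex \<times> complex \<times> complex \<Rightarrow> complex \<times> complex \<times> complex \<times> complex"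
  where "Pi_map = (\<lambda>(a, b, c, d).
    (a * b + c * d, b * c + a * d, a * c + b * d,
     4 - a\<^sup>2 - b\<^sup>2 - c\<^sup>2 - d\<^sup>2 - a * b * c * d))"


section \<open>Existence and uniqueness of the action\<close>

datatype reflection = RX | RY | RZ

fun refl_mat :: "reflection \<Rightarrow> int ^ 2 ^ 2" where
  "refl_mat RX = mat2 (-1) 2 0 1"
| "refl_mat RY = mat2 1 0 2 (-1)"
| "refl_mat RZ = mat2 1 0 0 (-1)"

fun refl_act ::
  "complex \<Rightarrow> complex \<Rightarrow> complex \<Rightarrow> reflection \<Rightarrow> complex \<times> complex \<times> complex \<Rightarrow> complex \<times> complex \<times> complex"
where
  "refl_act A B C RX (x, y, z) = (A - x - y * z, y, z)"
| "refl_act A B C RY (x, y, z) = (x, B - y - x * z, z)"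
| "refl_act A B C RZ (x, y, z) = (x, y, C - z - x * y)"

fun word_mat :: "reflection list \<Rightarrow> int ^ 2 ^ 2" where
  "word_mat [] = mat 1"
| "word_mat (g # w) = refl_mat g ** word_mat w"

fun word_act ::
  "complex \<Rightarrow> complex \<Rightarrow> complex \<Rightarrow> reflection list \<Rightarrow> complex \<times> complex \<times> complex \<Rightarrow> complex \<times> complex \<times> complex"
where
  "word_act A B C [] p = p"
| "word_act A B C (g # w) p = refl_act A B C g (word_act A B C w p)"

lemma mat2_nth [simp]:
  "mat2 p q r s $ 1 $ 1 = p" "mat2 p q r s $ 1 $ 2 = q"
  "mat2 p q r s $ 2 $ 1 = r" "mat2 p q r s $ 2 $ 2 = s"
  by (simp_all add: mat2_def)

lemma mat2_eq_iff: "mat2 p q r s = mat2 p' q' r' s' \<longleftrightarrow> p = p' \<and> q = q' \<and> r = r' \<and> s = s'"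
  by (auto simp: vec_eq_iff forall_2)

lemma mat2_exhaust: obtains p q r s where "M = mat2 p q r s"
proof
  show "M = mat2 (M $ 1 $ 1) (M $ 1 $ 2) (M $ 2 $ 1) (M $ 2 $ 2)"
    by (simp add: vec_eq_iff forall_2)
qed

lemma mat2_mult:
  "mat2 p q r s ** mat2 p' q' r' s' =
    mat2 (p * p' + q * r') (p * q' + q * s') (r * p' + s * r') (r * q' + s * (s' :: 'a :: semiring_1))"
  by (simp add: vec_eq_iff forall_2 matrix_matrix_mult_def sum_2)

lemma mat_eq_mat2: "mat k = mat2 k 0 0 k"
  by (simp add: vec_eq_iff forall_2 mat_def)

lemma mat2_uminus: "- mat2 p q r s = mat2 (- p) (- q) (- r) (- s :: int)"
  by (simp add: vec_eq_iff forall_2)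

lemma uminus_mult_left: "(- M) ** N = - (M ** (N :: int ^ 2 ^ 2))"
  by (simp add: vec_eq_iff forall_2 matrix_matrix_mult_def sum_2)

lemma uminus_mult_right: "M ** (- N) = - (M ** (N :: int ^ 2 ^ 2))"
  by (simp add: vec_eq_iff forall_2 matrix_matrix_mult_def sum_2)

lemma proj_class_eq: "proj_class M = {M, - M}"
proof -
  have "mat (-1) ** M = - M"
    by (cases M rule: mat2_exhaust) (simp add: mat_eq_mat2 mat2_mult mat2_uminus)
  thus ?thesis
    by (auto simp: proj_class_def r_coset_def GL2Z_def)
qed

lemma proj_class_eq_iff: "proj_class M = proj_class N \<longleftrightarrow> M = N \<or> M = - N"
  by (auto simp: proj_class_eq doubleton_eq_iff)

lemma proj_class_mult: "proj_class M <#>\<^bsub>GL2Z\<^esub> proj_class N = proj_class (M ** N)"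
  by (auto simp: proj_class_eq set_mult_def GL2Z_def uminus_mult_left uminus_mult_right)

lemma refl_mat_square: "refl_mat g ** refl_mat g = mat 1"
  by (cases g) (simp_all add: mat_eq_mat2 mat2_mult)

lemma word_mat_append: "word_mat (u @ v) = word_mat u ** word_mat v"
  by (induction u) (simp_all add: matrix_mul_assoc)

lemma word_mat_rev: "word_mat (rev w) ** word_mat w = mat 1"
proof (induction w)
  case (Cons g w)
  have "word_mat (rev (g # w)) ** word_mat (g # w) =
      word_mat (rev w) ** (refl_mat g ** refl_mat g) ** word_mat w"
    by (simp add: word_mat_append matrix_mul_assoc)
  with Cons show ?case by (simp add: refl_mat_square)
qed simp

lemma refl_act_involution: "refl_act A B C g (refl_act A B C g p) = p"
  by (cases g; cases p) (simp_all add: algebra_simps)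

lemma refl_act_surface: "p \<in> surface A B C D \<Longrightarrow> refl_act A B C g p \<in> surface A B C D"
  by (cases g; cases p) (auto simp: surface_def power2_eq_square algebra_simps)

lemma word_act_append: "word_act A B C (u @ v) p = word_act A B C u (word_act A B C v p)"
  by (induction u) simp_all

lemma word_act_rev: "word_act A B C (rev w) (word_act A B C w p) = p"
  by (induction w) (simp_all add: word_act_append refl_act_involution)

lemma word_act_surface: "p \<in> surface A B C D \<Longrightarrow> word_act A B C w p \<in> surface A B C D"
  by (induction w) (simp_all add: refl_act_surface)


text \<open>Ping-pong on the three arcs of the real projective line cut out by 0, 1 and infinity.\<close>

fun proj_arc :: "reflection \<Rightarrow> int \<times> int \<Rightarrow> bool" where
  "proj_arc RX (p, q) \<longleftrightarrow> (p - q) * q > 0"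
| "proj_arc RY (p, q) \<longleftrightarrow> p * (q - p) > 0"
| "proj_arc RZ (p, q) \<longleftrightarrow> p * q < 0"

definition appl :: "int ^ 2 ^ 2 \<Rightarrow> int \<times> int \<Rightarrow> int \<times> int"
  where "appl M = (\<lambda>(p, q). (M $ 1 $ 1 * p + M $ 1 $ 2 * q, M $ 2 $ 1 * p + M $ 2 $ 2 * q))"

lemma appl_mult: "appl (M ** N) v = appl M (appl N v)"
  by (cases v) (simp add: appl_def matrix_matrix_mult_def sum_2 algebra_simps)

lemma arc_disjoint: "proj_arc g v \<Longrightarrow> proj_arc h v \<Longrightarrow> g = h"
  by (cases g; cases h; cases v)
    (auto simp: zero_less_mult_iff mult_less_0_iff)

lemma arc_refl: "proj_arc h v \<Longrightarrow> h \<noteq> g \<Longrightarrow> proj_arc g (appl (refl_mat g) v)"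
  by (cases g; cases h; cases v)
    (auto simp: appl_def zero_less_mult_iff mult_less_0_iff)

lemma arc_word:
  "distinct_adj (g # w) \<Longrightarrow> proj_arc h v \<Longrightarrow> h \<noteq> last (g # w) \<Longrightarrow> proj_arc g (appl (word_mat (g # w)) v)"
proof (induction w arbitrary: g)
  case Nil
  thus ?case by (simp add: arc_refl)
next
  case (Cons k w)
  have "proj_arc k (appl (word_mat (k # w)) v)"
    using Cons.prems by (intro Cons.IH) auto
  moreover have "k \<noteq> g" using Cons.prems by auto
  ultimately show ?case
    using arc_refl by (subst word_mat.simps) (simp only: appl_mult)
qed

lemma word_mat_reduced:
  assumes "distinct_adj w" "word_mat w = mat 1 \<or> word_mat w = - mat 1"
  shows "w = []"
proof (rule ccontr)
  assume "w \<noteq> []"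
  then obtain g u where w: "w = g # u" by (cases w) auto
  obtain h where h: "h \<noteq> g" "h \<noteq> last w"
    by (metis reflection.distinct)
  obtain v where v: "proj_arc h v"
  proof (cases h)
    case RX thus ?thesis using that[of "(2, 1)"] by simp
  next
    case RY thus ?thesis using that[of "(1, 2)"] by simp
  next
    case RZ thus ?thesis using that[of "(1, -1)"] by simp
  qed
  have "proj_arc g (appl (word_mat w) v)"
    using arc_word[of g u h v] assms(1) v h w by simp
  moreover have "proj_arc h (appl (word_mat w) v)"
    using assms(2) v by (cases h; cases v) (auto simp: appl_def mat_eq_mat2 mat2_uminus algebra_simps)
  ultimately show False using arc_disjoint h by blast
qed

lemma not_distinct_adj_split:
  "\<not> distinct_adj w \<Longrightarrow> \<exists>u g v. w = u @ [g, g] @ v"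
proof (induction w)
  case (Cons g w)
  then obtain k w' where w: "w = k # w'" by (cases w) auto
  show ?case
  proof (cases "g = k")
    case True
    thus ?thesis using w by (metis append_Cons append_Nil)
  next
    case False
    thus ?thesis using Cons w by (metis append_Cons distinct_adj_Cons list.sel(1))
  qed
qed simp

lemma word_act_trivial:
  "word_mat w = mat 1 \<or> word_mat w = - mat 1 \<Longrightarrow> word_act A B C w p = p"
proof (induction w rule: length_induct)
  case (1 w)
  show ?case
  proof (cases "distinct_adj w")
    case True
    thus ?thesis using 1 word_mat_reduced by force
  next
    case False
    then obtain u g v where w: "w = u @ [g, g] @ v"
      using not_distinct_adj_split by blast
    have "word_mat w = word_mat u ** (refl_mat g ** refl_mat g) ** word_mat v"
      by (simp add: w word_mat_append matrix_mul_assoc)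
    hence "word_mat w = word_mat (u @ v)"
      by (simp add: refl_mat_square word_mat_append)
    moreover have "word_act A B C w p = word_act A B C (u @ v) p"
      by (simp add: w word_act_append refl_act_involution)
    moreover have "length (u @ v) < length w" by (simp add: w)
    ultimately show ?thesis using 1 by metis
  qed
qed

lemma word_act_cong:
  assumes "proj_class (word_mat u) = proj_class (word_mat v)"
  shows "word_act A B C u p = word_act A B C v p"
proof -
  have "word_mat (rev v @ u) = mat 1 \<or> word_mat (rev v @ u) = - mat 1"
    using assms by (auto simp: proj_class_eq_iff word_mat_append word_mat_rev uminus_mult_right)
  hence "word_act A B C (rev v @ u) p = p" by (rule word_act_trivial)
  thus ?thesis using word_act_rev[of A B C "rev v"] by (metis word_act_append rev_rev_ident)
qed


text \<open>The three involutions generate, by the Euclidean algorithm on the first column.\<close>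

definition generated :: "int ^ 2 ^ 2 \<Rightarrow> bool"
  where "generated M \<longleftrightarrow> (\<exists>w. proj_class (word_mat w) = proj_class M)"

lemma generated_refl: "generated (refl_mat g ** M) \<Longrightarrow> generated M"
proof -
  assume "generated (refl_mat g ** M)"
  then obtain w where "word_mat w = refl_mat g ** M \<or> word_mat w = - (refl_mat g ** M)"
    by (auto simp: generated_def proj_class_eq_iff)
  hence "word_mat (g # w) = refl_mat g ** refl_mat g ** M \<or>
      word_mat (g # w) = - (refl_mat g ** refl_mat g ** M)"
    by (auto simp: matrix_mul_assoc uminus_mult_right)
  thus ?thesis
    unfolding generated_def proj_class_eq_iff by (metis refl_mat_square matrix_mul_lid)
qed

lemma generated_upper:
  assumes "even q" "s = 1 \<or> s = -1"
  shows "generated (mat2 1 q 0 s)"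
  using assms
proof (induction "nat \<bar>q\<bar>" arbitrary: q s rule: less_induct)
  case less
  have flip: "generated (mat2 1 q 0 (- s)) \<Longrightarrow> generated (mat2 1 q 0 s)" for q s
    using generated_refl[of RZ "mat2 1 q 0 s"] by (simp add: mat2_mult)
  have shift: "generated (mat2 1 (q - 2 * s) 0 (- s)) \<Longrightarrow> generated (mat2 1 q 0 s)" for q s
  proof -
    assume "generated (mat2 1 (q - 2 * s) 0 (- s))"
    hence "generated (refl_mat RX ** mat2 1 q 0 s)"
      unfolding generated_def proj_class_eq_iff
      by (auto simp: mat2_mult mat2_uminus algebra_simps)
    thus ?thesis by (rule generated_refl)
  qed
  show ?case
  proof (cases "q = 0")
    case True
    have "generated (mat2 1 0 0 1)"
      unfolding generated_def by (rule exI[of _ "[]"]) (simp add: mat_eq_mat2)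
    with less.prems True flip[of 0 s] show ?thesis by auto
  next
    case False
    define t :: int where "t = sgn q"
    have t: "t = 1 \<or> t = -1" "nat \<bar>q - 2 * t\<bar> < nat \<bar>q\<bar>"
      using False less.prems(1) by (auto simp: t_def sgn_if)
    have "generated (mat2 1 (q - 2 * t) 0 (- t))"
      using t less.prems by (intro less.hyps) auto
    hence "generated (mat2 1 q 0 t)" by (rule shift)
    with less.prems t flip[of q s] show ?thesis by auto
  qed
qed

lemma generated_all:
  assumes "odd p" "even q" "even r" "odd s" "p * s - q * r = 1 \<or> p * s - q * r = -1"
  shows "generated (mat2 p q r s)"
  using assms
proof (induction "nat (\<bar>p\<bar> + \<bar>r\<bar>)" arbitrary: p q r s rule: less_induct)
  case less
  have core: "generated (mat2 p q r s)"
    if "odd p" "even q" "even r" "odd s" "p * s - q * r = 1 \<or> p * s - q * r = -1"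
      "p * r > 0" "nat (\<bar>p\<bar> + \<bar>r\<bar>) = n"
      and IH: "\<And>p' q' r' s'. nat (\<bar>p'\<bar> + \<bar>r'\<bar>) < n \<Longrightarrow> odd p' \<Longrightarrow> even q' \<Longrightarrow> even r' \<Longrightarrow> odd s' \<Longrightarrow>
        p' * s' - q' * r' = 1 \<or> p' * s' - q' * r' = -1 \<Longrightarrow> generated (mat2 p' q' r' s')"
    for p q r s n
  proof (cases "\<bar>p\<bar> > \<bar>r\<bar>")
    case True
    have "generated (mat2 (- p + 2 * r) (- q + 2 * s) r s)"
    proof (rule IH)
      show "nat (\<bar>- p + 2 * r\<bar> + \<bar>r\<bar>) < n"
        using that True by (auto simp: zero_less_mult_iff)
      show "(- p + 2 * r) * s - (- q + 2 * s) * r = 1 \<or> (- p + 2 * r) * s - (- q + 2 * s) * r = -1"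
        using that(5) by (auto simp: algebra_simps)
    qed (use that in auto)
    thus ?thesis using generated_refl[of RX "mat2 p q r s"] by (simp add: mat2_mult)
  next
    case False
    have "p \<noteq> r" "p \<noteq> - r" using that(1,3) by auto
    have "generated (mat2 p q (2 * p - r) (2 * q - s))"
    proof (rule IH)
      show "nat (\<bar>p\<bar> + \<bar>2 * p - r\<bar>) < n"
        using that False \<open>p \<noteq> r\<close> \<open>p \<noteq> - r\<close> by (auto simp: zero_less_mult_iff)
      show "p * (2 * q - s) - q * (2 * p - r) = 1 \<or> p * (2 * q - s) - q * (2 * p - r) = -1"
        using that(5) by (auto simp: algebra_simps)
    qed (use that in auto)
    thus ?thesis using generated_refl[of RY "mat2 p q r s"] by (simp add: mat2_mult)
  qed
  have "p \<noteq> 0" using less.prems(1) by auto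
  consider "r = 0" | "p * r > 0" | "p * r < 0"
    using \<open>p \<noteq> 0\<close> by (metis linorder_neqE_linordered_idom mult_eq_0_iff)
  thus ?case
  proof cases
    case 1
    hence "p * s = 1 \<or> p * s = -1" using less.prems(5) by simp
    hence ps: "(p = 1 \<or> p = -1) \<and> (s = 1 \<or> s = -1)"
      by (metis minus_equation_iff minus_mult_right pos_zmult_eq_1_iff_lemma zmult_eq_1_iff)
    have "generated (mat2 1 (p * q) 0 (p * s))"
      using ps less.prems by (intro generated_upper) auto
    hence "generated (mat2 p q 0 s)"
      using ps unfolding generated_def proj_class_eq_iff by (auto simp: mat2_uminus)
    thus ?thesis using 1 by simp
  next
    case 2
    show ?thesis
      by (rule core[OF less.prems 2 refl]) (rule less.hyps)
  next
    case 3
    have "generated (mat2 p q (- r) (- s))"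
    proof (rule core)
      show "nat (\<bar>p\<bar> + \<bar>- r\<bar>) = nat (\<bar>p\<bar> + \<bar>r\<bar>)" by simp
    qed (use less 3 in auto)
    thus ?thesis using generated_refl[of RZ "mat2 p q r s"] by (simp add: mat2_mult)
  qed
qed

lemma even_word_mat: "\<forall>i j. word_mat w $ i $ j mod 2 = mat 1 $ i $ j mod 2"
proof (induction w)
  case (Cons g w)
  thus ?case
    by (cases g; cases "word_mat w" rule: mat2_exhaust)
      (auto simp: forall_2 mat2_mult mat_eq_mat2, presburger+)
qed simp

lemma invertible_word_mat: "invertible (word_mat w)"
  unfolding invertible_def
  by (metis word_mat_rev rev_rev_ident)

lemma carrier_PGL2Z: "carrier PGL2Z = proj_class ` {M. invertible M}"
  by (auto simp: PGL2Z_def FactGroup_def RCOSETS_def proj_class_def GL2Z_def)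

lemma carrier_Gamma2_star: "carrier Gamma2_star = range (\<lambda>w. proj_class (word_mat w))"
proof (intro equalityI subsetI)
  fix K assume "K \<in> carrier Gamma2_star"
  then obtain N M where N: "invertible N" "K = proj_class N" and M: "M \<in> K"
    and ev: "\<forall>i j. M $ i $ j mod 2 = mat 1 $ i $ j mod 2"
    by (auto simp: Gamma2_star_def carrier_PGL2Z)
  have KM: "K = proj_class M" using N M by (auto simp: proj_class_eq)
  have "invertible M"
    using N M by (auto simp: proj_class_eq invertible_def uminus_mult_left uminus_mult_right
        intro: exI[of _ "- L" for L])
  then obtain M' where M': "M ** M' = mat 1" by (auto simp: invertible_def)
  hence "det M * det M' = 1" by (metis det_I det_mul)
  hence det: "det M = 1 \<or> det M = -1" by (auto simp: zmult_eq_1_iff)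
  obtain p q r s where Meq: "M = mat2 p q r s" by (rule mat2_exhaust)
  have "generated M"
    unfolding Meq
  proof (rule generated_all)
    show "p * s - q * r = 1 \<or> p * s - q * r = -1"
      using det by (simp add: det_2 Meq)
  qed (use ev in \<open>auto simp: Meq forall_2 mat_eq_mat2 odd_iff_mod_2_eq_one even_iff_mod_2_eq_zero\<close>)
  thus "K \<in> range (\<lambda>w. proj_class (word_mat w))"
    by (auto simp: generated_def KM)
next
  fix K assume "K \<in> range (\<lambda>w. proj_class (word_mat w))"
  then obtain w where K: "K = proj_class (word_mat w)" by auto
  have "word_mat w \<in> K" by (simp add: K proj_class_eq)
  thus "K \<in> carrier Gamma2_star"
    using even_word_mat[of w] invertible_word_mat[of w]
    by (auto simp: Gamma2_star_def carrier_PGL2Z K)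
qed

lemma mult_Gamma2_star:
  "proj_class M \<otimes>\<^bsub>Gamma2_star\<^esub> proj_class N = proj_class (M ** N)"
  by (simp add: Gamma2_star_def PGL2Z_def proj_class_mult)

lemma one_Gamma2_star: "\<one>\<^bsub>Gamma2_star\<^esub> = proj_class (mat 1)"
  by (auto simp: Gamma2_star_def PGL2Z_def proj_class_eq mat_eq_mat2 mat2_uminus)

lemma group_Gamma2_star: "group Gamma2_star"
proof (rule groupI)
  fix K assume "K \<in> carrier Gamma2_star"
  then obtain w where "K = proj_class (word_mat w)" by (auto simp: carrier_Gamma2_star)
  thus "\<exists>L\<in>carrier Gamma2_star. L \<otimes>\<^bsub>Gamma2_star\<^esub> K = \<one>\<^bsub>Gamma2_star\<^esub>"
    by (intro bexI[of _ "proj_class (word_mat (rev w))"])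
      (auto simp: mult_Gamma2_star one_Gamma2_star word_mat_rev carrier_Gamma2_star)
next
  fix K L assume "K \<in> carrier Gamma2_star" "L \<in> carrier Gamma2_star"
  then obtain u v where "K = proj_class (word_mat u)" "L = proj_class (word_mat v)"
    by (auto simp: carrier_Gamma2_star)
  hence "K \<otimes>\<^bsub>Gamma2_star\<^esub> L = proj_class (word_mat (u @ v))"
    by (simp add: mult_Gamma2_star word_mat_append)
  thus "K \<otimes>\<^bsub>Gamma2_star\<^esub> L \<in> carrier Gamma2_star"
    by (auto simp: carrier_Gamma2_star)
next
  show "\<one>\<^bsub>Gamma2_star\<^esub> \<in> carrier Gamma2_star"
    unfolding one_Gamma2_star carrier_Gamma2_star by (rule range_eqI[of _ _ "[]"]) simp
qed (auto simp: carrier_Gamma2_star mult_Gamma2_star one_Gamma2_star matrix_mul_assoc)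

lemma s_eqs:
  "s_x = proj_class (word_mat [RX])" "s_y = proj_class (word_mat [RY])"
  "s_z = proj_class (word_mat [RZ])"
  by (simp_all add: s_x_def s_y_def s_z_def)

lemma is_surface_action_exists: "\<exists>\<phi>. is_surface_action A B C D \<phi>"
proof
  let ?S = "surface A B C D"
  define \<phi> where "\<phi> K = (\<lambda>p\<in>?S. word_act A B C (SOME w. proj_class (word_mat w) = K) p)" for K
  have \<phi>: "\<phi> (proj_class (word_mat w)) = (\<lambda>p\<in>?S. word_act A B C w p)" for w
  proof -
    have "proj_class (word_mat (SOME v. proj_class (word_mat v) = proj_class (word_mat w))) =
        proj_class (word_mat w)"
      by (rule someI) (rule refl)
    thus ?thesis unfolding \<phi>_def by (intro restrict_ext word_act_cong)
  qed
  have Bij: "(\<lambda>p\<in>?S. word_act A B C w p) \<in> Bij ?S" for w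
  proof -
    have "bij_betw (word_act A B C w) ?S ?S"
      using word_act_rev[of A B C w] word_act_rev[of A B C "rev w"] word_act_surface
      by (intro bij_betw_byWitness[where f' = "word_act A B C (rev w)"]) auto
    thus ?thesis
      by (auto simp: Bij_def cong: bij_betw_cong)
  qed
  have "group_action Gamma2_star ?S \<phi>"
    unfolding group_action_def group_hom_def group_hom_axioms_def
  proof (intro conjI group_Gamma2_star group_BijGroup homI)
    fix K assume "K \<in> carrier Gamma2_star"
    thus "\<phi> K \<in> carrier (BijGroup ?S)"
      using Bij by (auto simp: carrier_Gamma2_star \<phi> BijGroup_def)
  next
    fix K L assume "K \<in> carrier Gamma2_star" "L \<in> carrier Gamma2_star"
    then obtain u v where K: "K = proj_class (word_mat u)" and L: "L = proj_class (word_mat v)"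
      by (auto simp: carrier_Gamma2_star)
    have "K \<otimes>\<^bsub>Gamma2_star\<^esub> L = proj_class (word_mat (u @ v))"
      by (simp add: K L mult_Gamma2_star word_mat_append)
    thus "\<phi> (K \<otimes>\<^bsub>Gamma2_star\<^esub> L) = \<phi> K \<otimes>\<^bsub>BijGroup ?S\<^esub> \<phi> L"
      using Bij[of u] Bij[of v]
      by (auto simp: K L \<phi> BijGroup_def compose_def word_act_append word_act_surface fun_eq_iff)
  qed
  thus "is_surface_action A B C D \<phi>"
    by (auto simp: is_surface_action_def s_eqs \<phi> simp del: word_mat.simps)
qed

theorem surface_action: "is_surface_action A B C D (surface_action A B C D)"
  unfolding surface_action_def using is_surface_action_exists by (rule someI_ex)

lemma is_surface_action_word:
  assumes "is_surface_action A B C D \<phi>" "p \<in> surface A B C D"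
  shows "\<phi> (proj_class (word_mat w)) p = word_act A B C w p"
proof (induction w)
  interpret group_action Gamma2_star "surface A B C D" \<phi>
    using assms(1) by (simp add: is_surface_action_def)
  {
    case Nil
    show ?case using assms(2) id_eq_one by (metis one_Gamma2_star restrict_apply' word_act.simps(1) word_mat.simps(1))
  next
    case (Cons g w)
    have g: "\<phi> (proj_class (refl_mat g)) p' = refl_act A B C g p'" if "p' \<in> surface A B C D" for p'
      using assms(1) that
      by (cases g; cases p') (auto simp: is_surface_action_def s_x_def s_y_def s_z_def)
    have "proj_class (refl_mat g) \<in> carrier Gamma2_star" "proj_class (word_mat w) \<in> carrier Gamma2_star"
      unfolding carrier_Gamma2_star by (auto intro: range_eqI[of _ _ "[g]"])
    hence "\<phi> (proj_class (refl_mat g) \<otimes>\<^bsub>Gamma2_star\<^esub> proj_class (word_mat w)) p =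
        \<phi> (proj_class (refl_mat g)) (\<phi> (proj_class (word_mat w)) p)"
      using assms(2) by (intro composition_rule)
    thus ?case
      using Cons g word_act_surface assms(2) by (simp add: mult_Gamma2_star)
  }
qed

theorem surface_action_unique:
  assumes "is_surface_action A B C D \<phi>" "is_surface_action A B C D \<psi>"
    and "g \<in> carrier Gamma2_star" "p \<in> surface A B C D"
  shows "\<phi> g p = \<psi> g p"
proof -
  from assms(3) obtain w where "g = proj_class (word_mat w)"
    by (auto simp: carrier_Gamma2_star)
  thus ?thesis
    using is_surface_action_word[OF assms(1,4)] is_surface_action_word[OF assms(2,4)] by simp
qed

theorem surface_orbit_words:
  assumes "m \<in> surface A B C D"
  shows "surface_orbit A B C D m = range (\<lambda>w. word_act A B C w m)"
proof -
  have "surface_orbit A B C D m =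
      range (\<lambda>w. surface_action A B C D (proj_class (word_mat w)) m)"
    unfolding surface_orbit_def orbit_def carrier_Gamma2_star by blast
  thus ?thesis
    using is_surface_action_word[OF surface_action assms] by simp
qed


section \<open>The presented group\<close>

lemma loop_step_context: "loop_step u v \<Longrightarrow> loop_step (a @ u @ b) (a @ v @ b)"
proof (induction rule: loop_step.induct)
  case (cancel u g e v)
  thus ?case using loop_step.cancel[of "a @ u" g e "v @ b"] by simp
next
  case (relator u v)
  thus ?case using loop_step.relator[of "a @ u" "v @ b"] by simp
qed

lemma equivclp_loop_step_context:
  "equivclp loop_step u v \<Longrightarrow> equivclp loop_step (a @ u @ b) (a @ v @ b)"
proof (induction rule: equivclp_induct)
  case base
  show ?case by (rule equivclp_refl)
next
  case (step y z)
  have "equivclp loop_step (a @ y @ b) (a @ z @ b)"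
    using step.hyps(2)
  proof
    assume "loop_step y z"
    thus ?thesis by (intro r_into_equivclp loop_step_context)
  next
    assume "loop_step z y"
    thus ?thesis by (intro converse_r_into_equivclp loop_step_context)
  qed
  with step.IH show ?case by (rule equivclp_trans)
qed

lemma loop_class_eq_iff: "loop_class u = loop_class v \<longleftrightarrow> equivclp loop_step u v"
proof
  assume "loop_class u = loop_class v"
  moreover have "v \<in> loop_class v" by (simp add: loop_class_def)
  ultimately have "v \<in> loop_class u" by (simp only:)
  thus "equivclp loop_step u v" by (simp only: loop_class_def mem_Collect_eq)
next
  assume uv: "equivclp loop_step u v"
  have "equivclp loop_step u w \<longleftrightarrow> equivclp loop_step v w" for w
    using equivclp_trans[OF uv, of w] equivclp_trans[OF equivclp_sym[OF uv], of w] by (rule iffI[rotated])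
  thus "loop_class u = loop_class v" by (simp only: loop_class_def)
qed

lemma loop_class_mult:
  "loop_class u \<otimes>\<^bsub>pi1\<^esub> loop_class v = loop_class (u @ v)"
proof -
  have "loop_class (u' @ v') = loop_class (u @ v)"
    if "u' \<in> loop_class u" "v' \<in> loop_class v" for u' v'
  proof -
    have "equivclp loop_step (u @ v) (u' @ v)" "equivclp loop_step (u' @ v) (u' @ v')"
      using that equivclp_loop_step_context[of u u' "[]" v] equivclp_loop_step_context[of v v' u' "[]"]
      by (simp_all add: loop_class_def)
    from equivclp_sym[OF equivclp_trans[OF this]] show ?thesis
      by (simp only: loop_class_eq_iff)
  qed
  moreover have "u \<in> loop_class u" "v \<in> loop_class v" by (simp_all add: loop_class_def)
  ultimately have "(\<Union>u'\<in>loop_class u. \<Union>v'\<in>loop_class v. loop_class (u' @ v')) = loop_class (u @ v)"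
    by blast
  thus ?thesis by (simp add: pi1_def)
qed

lemma loop_word_inverse:
  "equivclp loop_step (map (\<lambda>(g, e). (g, \<not> e)) (rev w) @ w) []"
proof (induction w)
  case (Cons l w)
  obtain g e where l: "l = (g, e)" by (cases l)
  let ?i = "map (\<lambda>(g, e). (g, \<not> e)) (rev w)"
  have "loop_step (?i @ [(g, \<not> e), (g, \<not> \<not> e)] @ w) (?i @ w)"
    by (rule loop_step.cancel)
  hence "equivclp loop_step (map (\<lambda>(g, e). (g, \<not> e)) (rev (l # w)) @ l # w) (?i @ w)"
    by (simp add: l r_into_equivclp)
  from equivclp_trans[OF this Cons.IH] show ?case .
qed simp

lemma carrier_pi1: "carrier pi1 = range loop_class"
  by (simp add: pi1_def)

lemma one_pi1: "\<one>\<^bsub>pi1\<^esub> = loop_class []"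
  by (simp add: pi1_def)

theorem group_pi1: "group pi1"
proof (rule groupI)
  fix K assume "K \<in> carrier pi1"
  then obtain w where K: "K = loop_class w" by (auto simp: carrier_pi1)
  define L where "L = loop_class (map (\<lambda>(g, e). (g, \<not> e)) (rev w))"
  have "L \<otimes>\<^bsub>pi1\<^esub> K = \<one>\<^bsub>pi1\<^esub>"
    using loop_word_inverse[of w] by (simp only: K L_def loop_class_mult one_pi1 loop_class_eq_iff)
  thus "\<exists>L\<in>carrier pi1. L \<otimes>\<^bsub>pi1\<^esub> K = \<one>\<^bsub>pi1\<^esub>"
    by (rule bexI) (simp only: L_def carrier_pi1 rangeI)
next
  fix K L assume "K \<in> carrier pi1" "L \<in> carrier pi1"
  then obtain u v where "K = loop_class u" "L = loop_class v" by (auto simp: carrier_pi1)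
  thus "K \<otimes>\<^bsub>pi1\<^esub> L \<in> carrier pi1" by (simp only: loop_class_mult carrier_pi1 rangeI)
next
  fix K L J assume "K \<in> carrier pi1" "L \<in> carrier pi1" "J \<in> carrier pi1"
  then obtain u v w where "K = loop_class u" "L = loop_class v" "J = loop_class w"
    by (auto simp: carrier_pi1)
  thus "K \<otimes>\<^bsub>pi1\<^esub> L \<otimes>\<^bsub>pi1\<^esub> J = K \<otimes>\<^bsub>pi1\<^esub> (L \<otimes>\<^bsub>pi1\<^esub> J)"
    by (simp only: loop_class_mult append_assoc)
next
  fix K assume "K \<in> carrier pi1"
  then obtain w where "K = loop_class w" by (auto simp: carrier_pi1)
  thus "\<one>\<^bsub>pi1\<^esub> \<otimes>\<^bsub>pi1\<^esub> K = K" by (simp only: loop_class_mult one_pi1 append_Nil)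
next
  show "\<one>\<^bsub>pi1\<^esub> \<in> carrier pi1" by (simp only: one_pi1 carrier_pi1 rangeI)
qed

theorem pi1_relation:
  "loop_gen loop_alpha \<otimes>\<^bsub>pi1\<^esub> loop_gen loop_beta \<otimes>\<^bsub>pi1\<^esub> loop_gen loop_gamma \<otimes>\<^bsub>pi1\<^esub> loop_gen loop_delta = \<one>\<^bsub>pi1\<^esub>"
proof -
  have "loop_step [(loop_alpha, False), (loop_beta, False), (loop_gamma, False), (loop_delta, False)] []"
    using loop_step.relator[of "[]" "[]"] by (simp only: append_Nil append_Nil2)
  hence "equivclp loop_step
      [(loop_alpha, False), (loop_beta, False), (loop_gamma, False), (loop_delta, False)] []"
    by (rule r_into_equivclp)
  thus ?thesis
    by (simp only: loop_gen_def loop_class_mult one_pi1 loop_class_eq_iff append_Cons append_Nil)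
qed

end

theory Submission
  imports
    Defs
begin

text \<open>The composite of \<open>s\<^sub>y\<close> and \<open>s\<^sub>z\<close> preserves each plane of constant \<open>x\<close> and acts on it by an affine map
  with eigenvalues \<open>\<mu>\<^sup>2\<close> and \<open>\<mu>\<^sup>-\<^sup>2\<close>, where \<open>x = \<mu> + 1/\<mu>\<close>. On a bounded invariant set the coordinate \<open>x\<close>
  of a point is therefore in \<open>(-2, 2)\<close>, unless the point is a common fixed point of \<open>s\<^sub>y\<close> and \<open>s\<^sub>z\<close>, and
  on a finite one \<open>\<mu>\<close> is then a root of unity. If the orbit has more than four points, a field that
  contains the coordinates of this first kind contains all of them and the parameters; this is
  applied to the real and to the algebraic numbers.

  If all these \<open>\<mu>\<close> were roots of unity along an infinite orbit, its coordinates would lie in one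
  number field, which contains only finitely many numbers \<open>\<mu> + 1/\<mu>\<close> of this kind. Hence one of the
  rotations is irrational and the closure of the orbit contains an ellipse. Rotating the points of
  that ellipse about another axis produces interior points of the closure relative to the surface,
  and the set of interior points is open and closed in the smooth part.

  The fibre over \<open>\<bar>x\<bar> < 2\<close> is an ellipse \<open>u\<^sup>2 + v\<^sup>2 + x u v = P(x) / (4 - x\<^sup>2)\<close> with a monic quartic \<open>P\<close>
  that is nonnegative at \<open>2\<close> and \<open>-2\<close>. A component can only be bounded if all roots of \<open>P\<close>
  lie in \<open>[-2, 2]\<close> and the component lies over the interval between the two middle roots, which gives
  uniqueness. The outer pair and the inner pair of roots determine \<open>(a, b)\<close> and \<open>(c, d)\<close>, and the
  representation is glued from two pairs in \<open>SU(2)\<close>, the angle on the ellipse being the gluing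
  parameter.\<close>

section \<open>Invariant sets and rotations\<close>

text \<open>At a common fixed point of two involutions the rotation gives no information about the
  remaining coordinate. This obstacle is the origin of the bound 4: if such a coordinate
  \<open>x\<close> of a point \<open>p\<close> could not be recovered from neighbouring points, the
  orbit would be contained in the set of \<open>p\<close>, \<open>s_x p\<close>, and the images of
  \<open>s_x p\<close> under \<open>s_y\<close> and \<open>s_z\<close>. The recovery uses only sums,
  differences and quotients, so it works alike in the real and in the algebraic numbers. The passage
  to one number field is then short: the parameters and a single point of the orbit generate it, and
  the cube of a field containing the parameters is invariant. Finiteness within it is Kronecker's
  argument: every conjugate of \<open>\<mu> + 1/\<mu>\<close> has modulus at most 2, so a bound on
  the degree bounds the coefficients of an integral minimal polynomial. That the orbit stays in one
  component rests on uniqueness: an involution carries a bounded component to a bounded component,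
  and there is only one.\<close>

definition invariant_under :: "'a::comm_ring_1 \<Rightarrow> 'a \<Rightarrow> 'a \<Rightarrow> ('a \<times> 'a \<times> 'a) set \<Rightarrow> bool"
  where "invariant_under a b c V \<longleftrightarrow> (\<forall>x y z. (x, y, z) \<in> V \<longrightarrow>
    (a - x - y * z, y, z) \<in> V \<and> (x, b - y - x * z, z) \<in> V \<and> (x, y, c - z - x * y) \<in> V)"

text \<open>For real parameters and \<open>\<bar>x\<bar> < 2\<close> these are the centres of the conics in which the planes
  of constant \<open>x\<close> cut the surface; in general they are the common fixed points of \<open>s\<^sub>y\<close> and \<open>s\<^sub>z\<close>.\<close>

definition centre :: "'a::comm_ring_1 \<Rightarrow> 'a \<Rightarrow> 'a \<times> 'a \<times> 'a \<Rightarrow> bool"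
  where "centre b c = (\<lambda>(x, y, z). 2 * y + x * z = b \<and> 2 * z + x * y = c)"

text \<open>The three coordinates enter symmetrically up to renaming the parameters:
  \<open>cyc\<close> transfers statements about the first coordinate to the other two, and
  \<open>swap_yz\<close> exchanges the two involutions that are composed in the rotation.\<close>

definition cyc :: "'a \<times> 'a \<times> 'a \<Rightarrow> 'a \<times> 'a \<times> 'a"
  where "cyc = (\<lambda>(x, y, z). (y, z, x))"

definition swap_yz :: "'a \<times> 'a \<times> 'a \<Rightarrow> 'a \<times> 'a \<times> 'a"
  where "swap_yz = (\<lambda>(x, y, z). (x, z, y))"

lemma centre_simp [simp]: "centre b c (x, y, z) \<longleftrightarrow> 2 * y + x * z = b \<and> 2 * z + x * y = c"
  by (simp add: centre_def)

lemma cyc_simp [simp]: "cyc (x, y, z) = (y, z, x)"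
  by (simp add: cyc_def)

lemma swap_yz_simp [simp]: "swap_yz (x, y, z) = (x, z, y)"
  by (simp add: swap_yz_def)

lemma inj_cyc: "inj cyc"
  by (auto simp: inj_def cyc_def)

lemma in_cyc_image [simp]: "(x, y, z) \<in> cyc ` V \<longleftrightarrow> (z, x, y) \<in> V"
  by (force simp: cyc_def)

lemma in_swap_yz_image [simp]: "(x, y, z) \<in> swap_yz ` V \<longleftrightarrow> (x, z, y) \<in> V"
  by (force simp: swap_yz_def)

lemma invariant_under_cyc: "invariant_under a b c V \<Longrightarrow> invariant_under b c a (cyc ` V)"
  unfolding invariant_under_def in_cyc_image by (metis mult.commute)

lemma invariant_under_swap: "invariant_under a b c V \<Longrightarrow> invariant_under a c b (swap_yz ` V)"
  unfolding invariant_under_def in_swap_yz_image by (metis mult.commute)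

lemma bounded_cyc: "bounded V \<Longrightarrow> bounded (cyc ` V)" for V :: "('a::real_normed_vector \<times> 'a \<times> 'a) set"
proof -
  assume "bounded V"
  then obtain M where M: "\<And>p. p \<in> V \<Longrightarrow> norm p \<le> M" by (auto simp: bounded_iff)
  have "norm (cyc p) = norm p" for p :: "'a \<times> 'a \<times> 'a"
    by (cases p) (simp add: norm_Pair)
  with M show ?thesis unfolding bounded_iff by (intro exI[of _ M] ballI) (metis imageE)
qed

lemma bounded_swap_yz: "bounded V \<Longrightarrow> bounded (swap_yz ` V)" for V :: "('a::real_normed_vector \<times> 'a \<times> 'a) set"
proof -
  assume "bounded V"
  then obtain M where M: "\<And>p. p \<in> V \<Longrightarrow> norm p \<le> M" by (auto simp: bounded_iff)
  have "norm (swap_yz p) = norm p" for p :: "'a \<times> 'a \<times> 'a"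
    by (cases p) (simp add: norm_Pair)
  with M show ?thesis unfolding bounded_iff by (intro exI[of _ M] ballI) (metis imageE)
qed

text \<open>The composite \<open>s\<^sub>y s\<^sub>z\<close>. It is affine on the planes of constant \<open>x\<close>, with linear part of
  trace \<open>x\<^sup>2 - 2\<close>.\<close>

definition rot_yz :: "'a::comm_ring_1 \<Rightarrow> 'a \<Rightarrow> 'a \<times> 'a \<times> 'a \<Rightarrow> 'a \<times> 'a \<times> 'a"
  where "rot_yz b c = (\<lambda>(x, y, z). (x, b - y - x * (c - z - x * y), c - z - x * y))"

lemma rot_yz_simp [simp]:
  "rot_yz b c (x, y, z) = (x, b - y - x * (c - z - x * y), c - z - x * y)"
  by (simp add: rot_yz_def)

lemma inj_rot_yz: "inj (rot_yz b c)"
proof (rule injI)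
  fix p q assume eq: "rot_yz b c p = rot_yz b c q"
  obtain x y z x' y' z' where p: "p = (x, y, z)" "q = (x', y', z')" by (metis prod.exhaust)
  from eq have x: "x' = x" and z: "c - z - x * y = c - z' - x * y'"
    and "b - y - x * (c - z - x * y) = b - y' - x * (c - z' - x * y')" by (auto simp: p)
  hence "y' = y" unfolding z by simp
  with x z show "p = q" by (simp add: p)
qed

lemma fst_rot_yz_funpow [simp]: "fst ((rot_yz b c ^^ n) p) = fst p"
  by (induction n) (auto simp: rot_yz_def split: prod.splits)

lemma rot_yz_invariant: "invariant_under a b c V \<Longrightarrow> p \<in> V \<Longrightarrow> (rot_yz b c ^^ n) p \<in> V"
  by (induction n) (auto simp: rot_yz_def invariant_under_def split: prod.splits)

text \<open>A left eigenvector of the linear part of \<open>rot_yz\<close>, applied to the pair of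
  affine forms that vanish exactly at a centre. Written this way it makes sense for
  \<open>x = 2\<close> and \<open>x = -2\<close> as well, where a centre may fail to exist.\<close>

definition eigenform :: "'a::comm_ring_1 \<Rightarrow> 'a \<Rightarrow> 'a \<Rightarrow> 'a \<times> 'a \<times> 'a \<Rightarrow> 'a"
  where "eigenform b c \<mu> = (\<lambda>(x, y, z). (b - 2 * y - x * z) - \<mu> * (c - 2 * z - x * y))"

lemma eigenform_rot_yz:
  assumes "\<mu> * \<nu> = 1" "fst p = \<mu> + \<nu>"
  shows "eigenform b c \<mu> (rot_yz b c p) = \<mu>\<^sup>2 * eigenform b c \<mu> p"
proof -
  obtain y z where p: "p = (\<mu> + \<nu>, y, z)" using assms(2) by (cases p) auto
  define x u v where "x = \<mu> + \<nu>" and "u = b - 2 * y - x * z" and "v = c - 2 * z - x * y"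
  have 1: "\<mu> * x = \<mu>\<^sup>2 + 1" using assms(1) by (simp add: x_def power2_eq_square distrib_left)
  have "\<mu>\<^sup>2 * x = \<mu> * (\<mu> * x)" by (simp add: power2_eq_square mult.assoc)
  hence 2: "\<mu>\<^sup>2 * x = \<mu>\<^sup>2 * \<mu> + \<mu>" by (simp add: 1 distrib_left mult.commute)
  have "eigenform b c \<mu> (rot_yz b c p) = (\<mu> * x - 1) * u + (x - (\<mu> * x) * x + \<mu>) * v"
    unfolding p eigenform_def rot_yz_simp prod.case x_def[symmetric] u_def v_def
    by (simp add: algebra_simps)
  also have "\<dots> = \<mu>\<^sup>2 * u + (\<mu> - \<mu>\<^sup>2 * x) * v" unfolding 1 by (simp add: algebra_simps)
  also have "\<dots> = \<mu>\<^sup>2 * (u - \<mu> * v)" unfolding 2 by (simp add: algebra_simps)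
  also have "u - \<mu> * v = eigenform b c \<mu> p" by (simp add: p eigenform_def u_def v_def x_def)
  finally show ?thesis .
qed

lemma eigenform_rot_yz_funpow:
  assumes "\<mu> * \<nu> = 1" "fst p = \<mu> + \<nu>"
  shows "eigenform b c \<mu> ((rot_yz b c ^^ n) p) = \<mu> ^ (2 * n) * eigenform b c \<mu> p"
proof (induction n)
  case (Suc n)
  have "eigenform b c \<mu> (rot_yz b c ((rot_yz b c ^^ n) p)) = \<mu>\<^sup>2 * eigenform b c \<mu> ((rot_yz b c ^^ n) p)"
    using assms by (intro eigenform_rot_yz) auto
  with Suc show ?case by (simp add: power2_eq_square mult.assoc)
qed simp

section \<open>Iterates of the rotation on bounded and on finite sets\<close>

lemma sum_with_inverse_ex:
  fixes x :: complex
  obtains \<mu> where "\<mu> \<noteq> 0" "x = \<mu> + inverse \<mu>"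
proof -
  define q where "q = csqrt (x\<^sup>2 - 4)"
  define \<mu> where "\<mu> = (x + q) / 2"
  define e where "e = \<mu>\<^sup>2 - x * \<mu> + 1"
  have "q\<^sup>2 = x\<^sup>2 - 4" by (simp add: q_def)
  moreover have "4 * e = q\<^sup>2 - x\<^sup>2 + 4"
    by (simp add: e_def \<mu>_def power_divide) (simp add: power2_eq_square algebra_simps)
  ultimately have "\<mu>\<^sup>2 - x * \<mu> + 1 = 0" unfolding e_def[symmetric] by simp
  moreover from this have "\<mu> \<noteq> 0" by auto
  ultimately have "x = \<mu> + inverse \<mu>" by (simp add: field_simps power2_eq_square)
  with \<open>\<mu> \<noteq> 0\<close> that show thesis by blast
qed

lemma bounded_geometric_trivial:
  fixes \<mu> e :: complex
  assumes "norm \<mu> > 1" "\<And>n. norm (\<mu> ^ (2 * n) * e) \<le> M"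
  shows "e = 0"
proof (rule ccontr)
  assume "e \<noteq> 0"
  have "norm (\<mu>\<^sup>2) > 1" using assms(1) by (simp add: norm_power)
  then obtain n where "M / norm e < norm (\<mu>\<^sup>2) ^ n" using real_arch_pow by blast
  hence "M < norm (\<mu>\<^sup>2) ^ n * norm e"
    using \<open>e \<noteq> 0\<close> by (simp add: pos_divide_less_eq)
  also have "\<dots> = norm (\<mu> ^ (2 * n) * e)" by (simp add: norm_mult norm_power power_mult)
  finally have "M < norm (\<mu> ^ (2 * n) * e)" .
  with assms(2)[of n] show False by simp
qed

lemma bounded_arithmetic_trivial:
  fixes u v :: complex
  assumes "\<And>n. norm (u + of_nat n * v) \<le> M"
  shows "v = 0"
proof (rule ccontr)
  assume "v \<noteq> 0"
  obtain n where "(M + norm u) / norm v < real n" using reals_Archimedean2 by blast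
  hence "M + norm u < norm (of_nat n * v)"
    using \<open>v \<noteq> 0\<close> by (simp add: norm_mult field_simps)
  also have "\<dots> \<le> norm (u + of_nat n * v) + norm u"
    by (metis add.commute add_diff_cancel_left' norm_triangle_ineq4)
  finally show False using assms[of n] by simp
qed

lemma norm_affine_form:
  fixes b x y z :: complex
  shows "norm (b - 2 * y - x * z) \<le> norm b + 2 * norm y + norm x * norm z"
proof -
  have "norm (b - 2 * y - x * z) \<le> norm (b - 2 * y) + norm (x * z)" by (rule norm_triangle_ineq4)
  moreover have "norm (b - 2 * y) \<le> norm b + norm (2 * y)" by (rule norm_triangle_ineq4)
  ultimately show ?thesis by (simp add: norm_mult)
qed

text \<open>Each rotation multiplies the form by \<open>\<mu>^2\<close> and keeps the point in
  \<open>V\<close> with the same \<open>x\<close>, while on that slice of \<open>V\<close> the form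
  is bounded; a nonzero value would grow geometrically.\<close>

lemma eigenform_vanishes:
  fixes x :: complex
  assumes "bounded V" "invariant_under a b c V" "(x, y, z) \<in> V"
    and "\<mu> \<noteq> 0" "x = \<mu> + inverse \<mu>" "norm \<mu> > 1"
  shows "eigenform b c \<mu> (x, y, z) = 0"
proof -
  obtain M where M: "\<And>p. p \<in> V \<Longrightarrow> norm p \<le> M" using assms(1) by (auto simp: bounded_iff)
  let ?B = "(norm b + 2 * M + norm x * M) + norm \<mu> * (norm c + 2 * M + norm x * M)"
  have bd: "norm (eigenform b c \<mu> p) \<le> ?B" if p: "p \<in> V" and px: "fst p = x" for p
  proof -
    obtain y z where p': "p = (x, y, z)" using px by (metis fst_conv prod.exhaust)
    have y: "norm y \<le> M" and z: "norm z \<le> M"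
      using M[OF p(1)] norm_fst_le[of y z] norm_snd_le[of y z] norm_snd_le[of "(y, z)" x]
      unfolding p' by (metis fst_conv norm_fst_le norm_snd_le order_trans snd_conv)+
    have "norm (b - 2 * y - x * z) \<le> norm b + 2 * norm y + norm x * norm z"
      by (rule norm_affine_form)
    moreover have "norm (c - 2 * z - x * y) \<le> norm c + 2 * norm z + norm x * norm y"
      by (rule norm_affine_form)
    moreover have "norm x * norm z \<le> norm x * M" "norm x * norm y \<le> norm x * M"
      using y z by (auto intro: mult_left_mono)
    ultimately have 1: "norm (b - 2 * y - x * z) \<le> norm b + 2 * M + norm x * M"
      and 2: "norm (c - 2 * z - x * y) \<le> norm c + 2 * M + norm x * M" using y z by linarith+
    have "norm (eigenform b c \<mu> p) \<le> norm (b - 2 * y - x * z) + norm \<mu> * norm (c - 2 * z - x * y)"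
      unfolding p' eigenform_def by (simp add: norm_triangle_ineq4 flip: norm_mult)
    also have "\<dots> \<le> ?B" using 1 2 by (intro add_mono mult_left_mono) auto
    finally show ?thesis .
  qed
  have "norm (\<mu> ^ (2 * n) * eigenform b c \<mu> (x, y, z)) \<le> ?B" for n
    using bd[of "(rot_yz b c ^^ n) (x, y, z)"] rot_yz_invariant[OF assms(2,3), of n]
      eigenform_rot_yz_funpow[of \<mu> "inverse \<mu>" "(x, y, z)" b c n] assms(4,5) by simp
  thus ?thesis using assms(6) bounded_geometric_trivial by blast
qed

text \<open>Here \<open>\<mu> = s\<close> is 1 or -1 and the linear part of the rotation is
  unipotent, so iterates grow polynomially. The form \<open>L\<close> is constant and makes
  \<open>e\<close> grow linearly, hence \<open>L = 0\<close>; then \<open>e\<close> is constant and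
  makes \<open>y\<close> grow linearly, hence \<open>e = 0\<close>.\<close>

lemma parabolic_bounded_centre:
  fixes x s :: complex
  assumes "bounded V" "invariant_under a b c V" "(x, y, z) \<in> V" "x = 2 * s" "s\<^sup>2 = 1"
  shows "centre b c (x, y, z)"
proof -
  obtain M where M: "\<And>p. p \<in> V \<Longrightarrow> norm p \<le> M" using assms(1) by (auto simp: bounded_iff)
  define L where "L = eigenform b c s (x, y, z)"
  define e where "e = c - 2 * z - x * y"
  define Y Z where "Y n = fst (snd ((rot_yz b c ^^ n) (x, y, z)))"
    and "Z n = snd (snd ((rot_yz b c ^^ n) (x, y, z)))" for n
  have YZ: "(rot_yz b c ^^ n) (x, y, z) = (x, Y n, Z n)" for n
    unfolding Y_def Z_def using fst_rot_yz_funpow[of n b c "(x, y, z)"] by (metis fst_conv prod.collapse)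
  have MY: "norm (Y n) \<le> M" "norm (Z n) \<le> M" for n
  proof -
    have "norm (x, Y n, Z n) \<le> M" using M rot_yz_invariant[OF assms(2,3), of n] YZ by metis
    thus "norm (Y n) \<le> M" "norm (Z n) \<le> M"
      using norm_snd_le[of "(Y n, Z n)" x] norm_fst_le[of "Y n" "Z n"] norm_snd_le[of "Z n" "Y n"]
      by linarith+
  qed
  have st: "Y (Suc n) = b - Y n - x * (c - Z n - x * Y n)" "Z (Suc n) = c - Z n - x * Y n" for n
    using YZ[of n] YZ[of "Suc n"] by (auto simp: rot_yz_def)
  have ss: "s * (s * w) = w" for w using assms(5) by (simp add: power2_eq_square flip: mult.assoc)
  have 0: "Y 0 = y" "Z 0 = z" by (simp_all add: Y_def Z_def)
  have Ln: "(b - 2 * Y n - x * Z n) - s * (c - 2 * Z n - x * Y n) = L" for n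
    using eigenform_rot_yz_funpow[of s s "(x, y, z)" b c n] assms(4,5) YZ[of n]
    by (simp add: L_def eigenform_def power2_eq_square power_mult)
  have ZL: "c - 2 * Z n - x * Y n = e - 2 * s * of_nat n * L" for n
  proof (induction n)
    case (Suc n)
    have "c - 2 * Z (Suc n) - x * Y (Suc n) = (c - 2 * Z n - x * Y n) - 2 * s * L"
      unfolding st Ln[of n, symmetric] assms(4) by (simp add: algebra_simps ss)
    thus ?case using Suc by (simp add: algebra_simps)
  qed (simp add: e_def 0)
  have "norm (e + of_nat n * (- 2 * s * L)) \<le> norm c + 2 * M + norm x * M" for n
  proof -
    have "e + of_nat n * (- 2 * s * L) = c - 2 * Z n - x * Y n" by (simp add: ZL)
    also have "norm \<dots> \<le> norm c + 2 * norm (Z n) + norm x * norm (Y n)"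
      by (rule norm_affine_form)
    also have "\<dots> \<le> norm c + 2 * M + norm x * M"
      using MY[of n] by (intro add_mono mult_left_mono) auto
    finally show ?thesis .
  qed
  from bounded_arithmetic_trivial[OF this] have L: "L = 0" using assms(5) by auto
  have "Y n = y + of_nat n * (- s * e)" for n
  proof (induction n)
    case (Suc n)
    have "Y (Suc n) = Y n + L - s * e"
    proof -
      have "Y (Suc n) - Y n = (b - 2 * Y n - x * Z n) - x * (c - 2 * Z n - x * Y n)"
        by (simp add: st algebra_simps)
      also have "b - 2 * Y n - x * Z n = L + s * (c - 2 * Z n - x * Y n)" using Ln[of n] by (simp add: algebra_simps)
      also have "c - 2 * Z n - x * Y n = e" using ZL[of n] L by simp
      finally show ?thesis using assms(4) by (simp add: algebra_simps)
    qed
    thus ?case using Suc L by (simp add: algebra_simps)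
  qed (simp add: 0)
  hence "norm (y + of_nat n * (- s * e)) \<le> M" for n using MY(1)[of n] by simp
  from bounded_arithmetic_trivial[OF this] have "e = 0" using assms(5) by auto
  with L have "c - 2 * z - x * y = 0" "b - 2 * y - x * z = 0"
    unfolding L_def e_def eigenform_def by auto
  thus ?thesis by (simp add: algebra_simps)
qed

theorem bounded_invariant_coordinate:
  fixes x :: complex
  assumes "bounded V" "invariant_under a b c V" "(x, y, z) \<in> V" "\<not> centre b c (x, y, z)"
  shows "x \<in> \<real> \<and> \<bar>Re x\<bar> < 2"
proof -
  obtain \<mu> where \<mu>: "\<mu> \<noteq> 0" "x = \<mu> + inverse \<mu>" using sum_with_inverse_ex by blast
  have *: False if \<nu>: "\<nu> \<noteq> 0" "x = \<nu> + inverse \<nu>" "norm \<nu> > 1" for \<nu>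
  proof -
    have 1: "eigenform b c \<nu> (x, y, z) = 0" using eigenform_vanishes assms(1-3) \<nu> by blast
    \<comment> \<open>Exchanging \<open>y\<close> and \<open>z\<close> inverts the rotation, so the
      form contracted by forward iteration is now expanded and vanishes too.\<close>
    have 2: "eigenform c b \<nu> (x, z, y) = 0"
      using eigenform_vanishes[of "swap_yz ` V" a c b x z y \<nu>] \<nu> assms(1-3)
      by (simp add: invariant_under_swap bounded_swap_yz)
    define u v where "u = b - 2 * y - x * z" and "v = c - 2 * z - x * y"
    have uv: "u = \<nu> * v" "v = \<nu> * u"
      using 1 2 unfolding eigenform_def prod.case u_def v_def by simp_all
    hence "(\<nu>\<^sup>2 - 1) * u = 0" by (simp add: power2_eq_square left_diff_distrib)
    moreover have "\<nu>\<^sup>2 \<noteq> 1" using \<nu>(3) by (auto simp: power2_eq_1_iff)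
    ultimately have "u = 0" by simp
    with uv have "u = 0" "v = 0" by simp_all
    thus False using assms(4) by (simp add: u_def v_def algebra_simps)
  qed
  have n1: "norm \<mu> = 1"
  proof (rule ccontr)
    assume "norm \<mu> \<noteq> 1"
    then consider "norm \<mu> > 1" | "norm (inverse \<mu>) > 1"
      using \<mu>(1) by (metis inverse_1 less_imp_inverse_less linorder_neqE_linordered_idom norm_inverse zero_less_norm_iff)
    thus False
    proof cases
      case 1 thus ?thesis using *[of \<mu>] \<mu> by blast
    next
      case 2 thus ?thesis using *[of "inverse \<mu>"] \<mu> by (simp add: add.commute)
    qed
  qed
  have "inverse \<mu> = cnj \<mu>"
  proof -
    have "\<mu> * cnj \<mu> = 1" using n1 by (simp add: complex_norm_square[symmetric])
    thus ?thesis by (rule inverse_unique)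
  qed
  hence x: "x = of_real (2 * Re \<mu>)" using \<mu>(2) by (simp add: complex_add_cnj)
  have "\<bar>Re \<mu>\<bar> \<le> 1" using abs_Re_le_cmod[of \<mu>] n1 by simp
  moreover have "\<bar>Re \<mu>\<bar> \<noteq> 1"
  proof
    assume "\<bar>Re \<mu>\<bar> = 1"
    hence "(of_real (Re \<mu>) :: complex)\<^sup>2 = 1" by (metis of_real_1 of_real_power one_power2 power2_abs)
    moreover have "x = 2 * of_real (Re \<mu>)" using x by simp
    ultimately show False using parabolic_bounded_centre[OF assms(1-3)] assms(4) by blast
  qed
  ultimately show ?thesis using x by simp
qed

text \<open>These are the numbers \<open>2 cos (r pi)\<close> with \<open>r\<close> rational; on an
  elliptic fibre over such a number the rotation turns by twice that angle and has finite
  order.\<close>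

definition cyclotomic :: "complex \<Rightarrow> bool"
  where "cyclotomic x \<longleftrightarrow> (\<exists>\<mu> n. n > 0 \<and> \<mu> ^ n = 1 \<and> x = \<mu> + inverse \<mu>)"

text \<open>Injectivity of the rotation makes the point periodic, so each of the two eigenforms
  either vanishes or has a root of unity as eigenvalue. If both vanish at a noncentral point, then
  \<open>\<mu>^2 = 1\<close>, again a root of unity.\<close>

theorem finite_invariant_coordinate:
  assumes "finite V" "invariant_under a b c V" "(x, y, z) \<in> V" "\<not> centre b c (x, y, z)"
  shows "cyclotomic x"
proof -
  obtain \<mu> where \<mu>: "\<mu> \<noteq> 0" "x = \<mu> + inverse \<mu>" using sum_with_inverse_ex by blast
  let ?f = "\<lambda>n. (rot_yz b c ^^ n) (x, y, z)"
  have "\<not> inj ?f"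
  proof
    assume "inj ?f"
    moreover have "finite (range ?f)"
      using rot_yz_invariant[OF assms(2,3)] assms(1) by (meson finite_subset image_subsetI)
    ultimately show False using finite_imageD infinite_UNIV_nat by blast
  qed
  then obtain i j where ij: "i < j" "?f i = ?f j"
    unfolding inj_def by (metis linorder_neqE_nat)
  define n where "n = j - i"
  have "?f j = (rot_yz b c ^^ i) (?f n)"
    using ij(1) funpow_add[of i n "rot_yz b c"] by (simp add: n_def)
  hence "(rot_yz b c ^^ i) (?f n) = (rot_yz b c ^^ i) (x, y, z)" using ij(2) by (simp only:)
  hence n: "n > 0" "?f n = (x, y, z)"
    using ij(1) injD[OF inj_fn[OF inj_rot_yz[of b c]]] by (simp add: n_def, blast)
  have E: "\<nu> ^ (2 * n) = 1 \<or> eigenform b c \<nu> (x, y, z) = 0"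
    if "\<nu> \<noteq> 0" "x = \<nu> + inverse \<nu>" for \<nu>
    using eigenform_rot_yz_funpow[of \<nu> "inverse \<nu>" "(x, y, z)" b c n] n(2) that by auto
  show ?thesis
  proof (cases "\<mu> ^ (2 * n) = 1")
    case True
    thus ?thesis unfolding cyclotomic_def using n(1) \<mu>(2) by (intro exI[of _ \<mu>] exI[of _ "2 * n"]) auto
  next
    case False
    hence "inverse \<mu> ^ (2 * n) \<noteq> 1" by (metis inverse_inverse_eq inverse_1 power_inverse)
    hence 1: "eigenform b c (inverse \<mu>) (x, y, z) = 0" using E[of "inverse \<mu>"] \<mu> by (simp add: add.commute)
    have 2: "eigenform b c \<mu> (x, y, z) = 0" using E[of \<mu>] \<mu> False by simp
    define u v where "u = b - 2 * y - x * z" and "v = c - 2 * z - x * y"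
    have uv: "u = \<mu> * v" "u = inverse \<mu> * v"
      using 1 2 unfolding eigenform_def prod.case u_def v_def by simp_all
    have "v \<noteq> 0"
    proof
      assume "v = 0"
      with uv have "u = 0" "v = 0" by simp_all
      thus False using assms(4) by (simp add: u_def v_def algebra_simps)
    qed
    with uv have "\<mu> = inverse \<mu>" by (metis mult_right_cancel)
    hence "\<mu>\<^sup>2 = 1" using \<mu>(1) by (metis power2_eq_square right_inverse)
    with False show ?thesis by (simp add: power_mult)
  qed
qed

text \<open>Minimality among invariant sets expresses that \<open>Ob\<close> is a single orbit
  without mentioning the group, in a form that passes through \<open>cyc\<close> and between real
  and complex points.\<close>

definition transitive_orbit :: "'a::comm_ring_1 \<Rightarrow> 'a \<Rightarrow> 'a \<Rightarrow> ('a \<times> 'a \<times> 'a) set \<Rightarrow> bool"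
  where "transitive_orbit a b c Ob \<longleftrightarrow> invariant_under a b c Ob \<and>
    (\<forall>V. invariant_under a b c V \<longrightarrow> V \<inter> Ob \<noteq> {} \<longrightarrow> Ob \<subseteq> V)"

text \<open>The exact form in which the rotations deliver information: about each axis, either the
  coordinate is known to lie in \<open>F\<close> or the point is fixed by the rotation.\<close>

definition noncentral_coordinates_in :: "'a::comm_ring_1 set \<Rightarrow> 'a \<Rightarrow> 'a \<Rightarrow> 'a \<Rightarrow> ('a \<times> 'a \<times> 'a) set \<Rightarrow> bool"
  where "noncentral_coordinates_in F a b c Ob \<longleftrightarrow> (\<forall>x y z. (x, y, z) \<in> Ob \<longrightarrow>
    (x \<in> F \<or> centre b c (x, y, z)) \<and> (y \<in> F \<or> centre c a (y, z, x)) \<and> (z \<in> F \<or> centre a b (z, x, y)))"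

lemma cyc_cyc_cyc: "cyc ` cyc ` cyc ` V = V"
  by (auto simp: set_eq_iff)

lemma transitive_orbit_cyc:
  assumes "transitive_orbit a b c Ob"
  shows "transitive_orbit b c a (cyc ` Ob)"
  unfolding transitive_orbit_def
proof (intro conjI allI impI)
  show "invariant_under b c a (cyc ` Ob)" using assms invariant_under_cyc unfolding transitive_orbit_def by blast
next
  fix V assume V: "invariant_under b c a V" "V \<inter> cyc ` Ob \<noteq> {}"
  have "invariant_under a b c (cyc ` cyc ` V)" by (intro invariant_under_cyc V(1))
  moreover have "cyc ` cyc ` V \<inter> Ob \<noteq> {}"
  proof -
    obtain x y z where "(x, y, z) \<in> V" "(x, y, z) \<in> cyc ` Ob" using V(2) by auto
    hence "(z, x, y) \<in> cyc ` cyc ` V \<inter> Ob" by simp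
    thus ?thesis by blast
  qed
  ultimately have "Ob \<subseteq> cyc ` cyc ` V" using assms unfolding transitive_orbit_def by blast
  hence "cyc ` Ob \<subseteq> cyc ` cyc ` cyc ` V" by (rule image_mono)
  thus "cyc ` Ob \<subseteq> V" unfolding cyc_cyc_cyc .
qed

lemma noncentral_coordinates_in_cyc:
  "noncentral_coordinates_in F a b c Ob \<Longrightarrow> noncentral_coordinates_in F b c a (cyc ` Ob)"
  unfolding noncentral_coordinates_in_def by (simp only: in_cyc_image) blast

lemma orbit_size_cyc:
  "infinite Ob \<or> card Ob > 4 \<Longrightarrow> infinite (cyc ` Ob) \<or> card (cyc ` Ob) > 4"
  by (simp add: finite_image_iff card_image inj_on_subset[OF inj_cyc])

text \<open>A coordinate outside \<open>N\<close> forces its point, and then the neighbours of that point, to be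
  fixed by two involutions; unless one of the last two memberships holds, the orbit closes up
  after at most four points.\<close>

lemma neighbours_of_exceptional_point:
  fixes N :: "'a::field set"
  assumes Ob: "transitive_orbit a b c Ob" "infinite Ob \<or> card Ob > 4" "noncentral_coordinates_in N a b c Ob"
    and p: "(x, y, z) \<in> Ob" "x \<notin> N"
  obtains x' where "x' \<in> N" "y \<in> N" "z \<in> N" "a = x + x' + y * z"
    "z \<noteq> 0 \<and> y + (x - x') * z \<in> N \<or> y \<noteq> 0 \<and> z + (x - x') * y \<in> N"
proof -
  have inv: "invariant_under a b c Ob"
    and orbit: "\<And>V. invariant_under a b c V \<Longrightarrow> V \<inter> Ob \<noteq> {} \<Longrightarrow> Ob \<subseteq> V"
    using Ob(1) unfolding transitive_orbit_def by blast+
  have coord: "x \<in> N \<or> (2 * y + x * z = b \<and> 2 * z + x * y = c)"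
    "y \<in> N \<or> (2 * z + y * x = c \<and> 2 * x + y * z = a)" "z \<in> N \<or> (2 * x + z * y = a \<and> 2 * y + z * x = b)"
    if "(x, y, z) \<in> Ob" for x y z
    using Ob(3) that unfolding noncentral_coordinates_in_def centre_simp by blast+
  have small: False if "invariant_under a b c {p1, p2, p3, p4}" "(x, y, z) \<in> {p1, p2, p3, p4}" for p1 p2 p3 p4
  proof -
    have sub: "Ob \<subseteq> {p1, p2, p3, p4}" using orbit[OF that(1)] that(2) p(1) by blast
    hence "card Ob \<le> card {p1, p2, p3, p4}" by (intro card_mono) auto
    also have "\<dots> \<le> 4" by (rule card_insert_le_m1 | simp)+
    finally show False using Ob(2) finite_subset[OF sub] by auto
  qed
  have b: "b = 2 * y + x * z" and c: "c = 2 * z + x * y" using coord(1)[OF p(1)] p(2) by auto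
  define x' where "x' = a - x - y * z"
  have a: "a = x + x' + y * z" by (simp add: x'_def)
  have nx: "x' \<noteq> x"
  proof
    assume "x' = x"
    hence "invariant_under a b c {(x, y, z), (x, y, z), (x, y, z), (x, y, z)}"
      unfolding invariant_under_def a b c by (simp add: algebra_simps)
    thus False using small by blast
  qed
  \<comment> \<open>A second coordinate outside \<open>N\<close> would make the point fixed by
    \<open>s_x\<close> as well, contradicting \<open>x' \<noteq> x\<close>.\<close>
  have yz: "y \<in> N" "z \<in> N" using coord(2,3)[OF p(1)] nx unfolding a by (auto simp: algebra_simps)
  have p': "(x', y, z) \<in> Ob" using inv p(1) unfolding invariant_under_def x'_def by blast
  have "\<not> (2 * y + x' * z = b \<and> 2 * z + x' * y = c)"
  proof
    assume "2 * y + x' * z = b \<and> 2 * z + x' * y = c"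
    hence "invariant_under a b c {(x, y, z), (x', y, z), (x, y, z), (x, y, z)}"
      unfolding invariant_under_def by (auto simp: a b c algebra_simps)
    thus False using small by blast
  qed
  hence x': "x' \<in> N" using coord(1)[OF p'] by blast
  define y' z' where "y' = b - y - x' * z" and "z' = c - z - x' * y"
  have y': "(x', y', z) \<in> Ob" and z': "(x', y, z') \<in> Ob"
    using inv p' unfolding invariant_under_def y'_def z'_def by blast+
  have y'_eq: "y' = y + (x - x') * z" and z'_eq: "z' = z + (x - x') * y"
    by (simp_all add: y'_def z'_def b c algebra_simps)
  \<comment> \<open>Otherwise the image of \<open>(x', y, z)\<close> under \<open>s_y\<close> either
    equals that point (when \<open>z = 0\<close>) or has its new coordinate outside \<open>N\<close>
    and is fixed by \<open>s_x\<close> and \<open>s_z\<close>; the image under \<open>s_z\<close>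
    behaves likewise. The four points then form an invariant set.\<close>
  have "z \<noteq> 0 \<and> y' \<in> N \<or> y \<noteq> 0 \<and> z' \<in> N"
  proof (rule ccontr)
    assume no: "\<not> (z \<noteq> 0 \<and> y' \<in> N \<or> y \<noteq> 0 \<and> z' \<in> N)"
    have fix_p: "(b - y - x * z) = y" "(c - z - x * y) = z" "a - x - y * z = x'"
      by (simp_all add: b c x'_def)
    have fix_p': "b - y - x' * z = y'" "c - z - x' * y = z'" "a - x' - y * z = x"
      by (simp_all add: y'_def z'_def a)
    have fix_y: "b - y' - x' * z = y" by (simp add: y'_def)
    have fix_z: "c - z' - x' * y = z" by (simp add: z'_def)
    have fy: "(a - x' - y' * z, y', z) \<in> {(x, y, z), (x', y', z)} \<and> (x', y', c - z - x' * y') \<in> {(x', y', z), (x', y, z')}"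
    proof (cases "z = 0")
      case True
      hence "y' = y" by (simp add: y'_eq)
      thus ?thesis using fix_p' by simp
    next
      case False
      with no coord(2)[OF y'] have "a - x' - y' * z = x'" "c - z - x' * y' = z" by (simp_all add: algebra_simps)
      thus ?thesis by simp
    qed
    have fz: "(a - x' - y * z', y, z') \<in> {(x, y, z), (x', y, z')} \<and> (x', b - y - x' * z', z') \<in> {(x', y, z'), (x', y', z)}"
    proof (cases "y = 0")
      case True
      hence "z' = z" by (simp add: z'_eq)
      thus ?thesis using fix_p' by simp
    next
      case False
      with no coord(3)[OF z'] have "a - x' - y * z' = x'" "b - y - x' * z' = y" by (simp_all add: algebra_simps)
      thus ?thesis by simp
    qed
    have "invariant_under a b c {(x, y, z), (x', y, z), (x', y', z), (x', y, z')}"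
      unfolding invariant_under_def
    proof (intro allI impI)
      fix u v w assume "(u, v, w) \<in> {(x, y, z), (x', y, z), (x', y', z), (x', y, z')}"
      then consider "(u, v, w) = (x, y, z)" | "(u, v, w) = (x', y, z)" | "(u, v, w) = (x', y', z)" | "(u, v, w) = (x', y, z')"
        by blast
      thus "(a - u - v * w, v, w) \<in> {(x, y, z), (x', y, z), (x', y', z), (x', y, z')} \<and>
        (u, b - v - u * w, w) \<in> {(x, y, z), (x', y, z), (x', y', z), (x', y, z')} \<and>
        (u, v, c - w - u * v) \<in> {(x, y, z), (x', y, z), (x', y', z), (x', y, z')}"
      proof cases
        case 1 thus ?thesis using fix_p by simp
      next
        case 2 thus ?thesis using fix_p' by simp
      next
        case 3 thus ?thesis using fy fix_y by auto
      next
        case 4 thus ?thesis using fz fix_z by auto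
      qed
    qed
    thus False using small by blast
  qed
  thus thesis using x' yz a unfolding y'_eq z'_eq by (intro that)
qed

section \<open>Sums of a root of unity and its inverse in number fields\<close>

abbreviation cpoly :: "int poly \<Rightarrow> complex poly"
  where "cpoly \<equiv> map_poly of_int"

lemma cpoly_mult: "cpoly (f * g) = cpoly f * cpoly g"
  by (rule poly_eqI) (simp add: coeff_map_poly coeff_mult)

lemma cpoly_add: "cpoly (f + g) = cpoly f + cpoly g"
  by (rule poly_eqI) (simp add: coeff_map_poly)

lemma cpoly_diff: "cpoly (f - g) = cpoly f - cpoly g"
  by (rule poly_eqI) (simp add: coeff_map_poly)

lemma cpoly_smult: "cpoly (Polynomial.smult k f) = Polynomial.smult (of_int k) (cpoly f)"
  by (rule poly_eqI) (simp add: coeff_map_poly)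

lemma degree_cpoly [simp]: "Polynomial.degree (cpoly f) = Polynomial.degree f"
  by (rule degree_map_poly) auto

lemma cpoly_eq_0_iff [simp]: "cpoly f = 0 \<longleftrightarrow> f = 0"
  by (auto simp: poly_eq_iff coeff_map_poly)

text \<open>The factor is the primitive minimal polynomial of \<open>x\<close>: pseudo-division shows that it divides a
  constant multiple of \<open>f\<close>, and Gauss' lemma removes the constant.\<close>

lemma low_degree_factor:
  fixes f h :: "int poly"
  assumes f: "Polynomial.lead_coeff f = 1" "poly (cpoly f) x = 0"
    and h: "h \<noteq> 0" "Polynomial.degree h \<le> d" "poly (cpoly h) x = 0"
  obtains g where "g dvd f" "g \<noteq> 0" "Polynomial.degree g \<le> d" "poly (cpoly g) x = 0"
    "\<bar>Polynomial.lead_coeff g\<bar> = 1"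
proof -
  define P where "P h \<longleftrightarrow> h \<noteq> 0 \<and> poly (cpoly h) x = 0" for h
  obtain h' where h': "P h'" "\<And>k. P k \<Longrightarrow> Polynomial.degree h' \<le> Polynomial.degree k"
    using ex_has_least_nat[of P h Polynomial.degree] h by (auto simp: P_def)
  define g where "g = primitive_part h'"
  have h'_eq: "h' = Polynomial.smult (content h') g" by (simp add: g_def)
  have g0: "g \<noteq> 0" and "content h' \<noteq> 0" using h'(1) by (auto simp: P_def g_def)
  have gx: "poly (cpoly g) x = 0"
    using h'(1) \<open>content h' \<noteq> 0\<close> unfolding P_def
    by (subst (asm) (2) h'_eq) (auto simp add: cpoly_smult)
  have degg: "Polynomial.degree g = Polynomial.degree h'" by (simp add: g_def)
  have cg: "content g = 1" using h'(1) by (simp add: g_def P_def)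
  \<comment> \<open>The power of the leading coefficient by which pseudo-division scales
    \<open>f\<close> so that quotient and remainder stay integral.\<close>
  define k where "k = Polynomial.coeff g (Polynomial.degree g) ^ (Suc (Polynomial.degree f) - Polynomial.degree g)"
  have "k \<noteq> 0" using g0 by (simp add: k_def)
  obtain q r where qr: "pseudo_divmod f g = (q, r)" by (cases "pseudo_divmod f g")
  have eq: "Polynomial.smult k f = g * q + r" and r: "r = 0 \<or> Polynomial.degree r < Polynomial.degree g"
    using pseudo_divmod[OF g0 qr] by (simp_all add: k_def)
  have "poly (cpoly (g * q + r)) x = 0" using f(2) by (simp add: eq[symmetric] cpoly_smult)
  hence "poly (cpoly r) x = 0" using gx by (simp add: cpoly_add cpoly_mult)
  hence "r = 0" using r h'(2)[of r] degg unfolding P_def by linarith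
  hence eq: "Polynomial.smult k f = g * q" using eq by simp
  have "content f dvd 1" using f(1) content_dvd_coeff[of f "Polynomial.degree f"] by simp
  hence "content f = 1" by (metis is_unit_normalize normalize_content)
  hence "content q = \<bar>k\<bar>" using arg_cong[OF eq, of content] cg by (simp add: content_mult)
  hence "Polynomial.smult k f = Polynomial.smult \<bar>k\<bar> (g * primitive_part q)"
    using eq content_times_primitive_part[of q] by (metis mult_smult_right)
  hence "Polynomial.smult k (f - Polynomial.smult (sgn k) (g * primitive_part q)) = 0"
    by (simp add: smult_diff_right abs_sgn mult.commute)
  hence eq: "f = g * Polynomial.smult (sgn k) (primitive_part q)" using \<open>k \<noteq> 0\<close> by simp
  hence "Polynomial.lead_coeff g * Polynomial.lead_coeff (Polynomial.smult (sgn k) (primitive_part q)) = 1"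
    using f(1) lead_coeff_mult by metis
  hence "\<bar>Polynomial.lead_coeff g\<bar> = 1" using zmult_eq_1_iff by fastforce
  moreover have "g dvd f" using eq by (rule dvdI)
  moreover have "Polynomial.degree g \<le> d"
    using h'(2)[of h] h degg by (simp add: P_def)
  ultimately show thesis using that g0 gx by blast
qed

text \<open>A factor \<open>[:- w, 1:]\<close> multiplies a common bound on the coefficients by at
  most \<open>1 + norm w\<close>, hence the base 3.\<close>

lemma coeff_prod_mset_bound:
  fixes A :: "complex multiset"
  assumes "\<And>w. w \<in># A \<Longrightarrow> norm w \<le> 2"
  shows "norm (Polynomial.coeff (\<Prod>w\<in>#A. [:- w, 1:]) i) \<le> 3 ^ size A"
  using assms
proof (induction A arbitrary: i)
  case empty
  show ?case by (cases i) auto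
next
  case (add w A)
  let ?p = "\<Prod>w\<in>#A. [:- w, 1:]"
  have IH: "norm (Polynomial.coeff ?p j) \<le> 3 ^ size A" for j using add by auto
  have "norm (w * Polynomial.coeff ?p i) \<le> 2 * 3 ^ size A"
    unfolding norm_mult using add.prems[of w] IH by (intro mult_mono) auto
  moreover have "norm (case i of 0 \<Rightarrow> 0 | Suc j \<Rightarrow> Polynomial.coeff ?p j) \<le> 3 ^ size A"
    using IH by (cases i) auto
  ultimately have "norm (- (w * Polynomial.coeff ?p i) + (case i of 0 \<Rightarrow> 0 | Suc j \<Rightarrow> Polynomial.coeff ?p j)) \<le> 3 * 3 ^ size A"
    by (intro norm_triangle_le) simp
  thus ?case by (simp add: coeff_pCons)
qed

lemma finite_int_polys: "finite {g :: int poly. Polynomial.degree g \<le> d \<and> (\<forall>i. \<bar>Polynomial.coeff g i\<bar> \<le> N)}"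
proof (rule finite_surj)
  show "finite {l. set l \<subseteq> {- N..N} \<and> length l \<le> Suc d}" by (rule finite_lists_length_le) simp
  show "{g. Polynomial.degree g \<le> d \<and> (\<forall>i. \<bar>Polynomial.coeff g i\<bar> \<le> N)} \<subseteq>
      Poly ` {l. set l \<subseteq> {- N..N} \<and> length l \<le> Suc d}"
  proof
    fix g :: "int poly" assume g: "g \<in> {g. Polynomial.degree g \<le> d \<and> (\<forall>i. \<bar>Polynomial.coeff g i\<bar> \<le> N)}"
    have "length (coeffs g) \<le> Suc d" using g by (cases "g = 0") (auto simp: length_coeffs_degree)
    moreover have "c \<in> {- N..N}" if c: "c \<in> set (coeffs g)" for c
    proof -
      from c obtain i where "c = Polynomial.coeff g i" unfolding in_set_conv_nth
        by (metis coeffs_nth length_coeffs_degree list.size(3) coeffs_eq_Nil less_Suc_eq_le less_nat_zero_code)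
      thus ?thesis using g by (simp add: abs_le_iff) (metis abs_le_iff minus_le_iff)
    qed
    ultimately show "g \<in> Poly ` {l. set l \<subseteq> {- N..N} \<and> length l \<le> Suc d}"
      by (intro image_eqI[of _ _ "coeffs g"]) auto
  qed
qed

text \<open>The Chebyshev polynomials of the first kind in the normalisation
  \<open>2 T_n(t / 2)\<close>, which has integer coefficients and is monic from index 1 on. They
  express \<open>\<mu>^n + \<mu>^-n\<close> in terms of \<open>\<mu> + 1/\<mu>\<close>.\<close>

fun chebyshev :: "nat \<Rightarrow> int poly" where
  "chebyshev 0 = [:2:]"
| "chebyshev (Suc 0) = [:0, 1:]"
| "chebyshev (Suc (Suc n)) = [:0, 1:] * chebyshev (Suc n) - chebyshev n"

lemma poly_chebyshev:
  assumes "\<mu> \<noteq> 0"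
  shows "poly (cpoly (chebyshev n)) (\<mu> + inverse \<mu>) = \<mu> ^ n + inverse \<mu> ^ n"
proof (induction n rule: chebyshev.induct)
  case (3 n)
  have "cpoly [:0, 1:] = [:0, 1:]" by (simp add: map_poly_pCons)
  hence "poly (cpoly (chebyshev (Suc (Suc n)))) (\<mu> + inverse \<mu>) =
      (\<mu> + inverse \<mu>) * (\<mu> ^ Suc n + inverse \<mu> ^ Suc n) - (\<mu> ^ n + inverse \<mu> ^ n)"
    unfolding chebyshev.simps cpoly_diff cpoly_mult poly_diff poly_mult "3.IH" by simp
  also have "\<dots> = \<mu> ^ Suc (Suc n) + inverse \<mu> ^ Suc (Suc n) +
      (\<mu> * inverse \<mu> - 1) * (\<mu> ^ n + inverse \<mu> ^ n)"
    unfolding power_Suc by (simp add: algebra_simps del: right_inverse)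
  finally show ?case using assms by simp
qed (simp_all add: map_poly_pCons)

text \<open>Stated from index 1 on because \<open>chebyshev 0\<close> has leading coefficient
  2.\<close>

lemma degree_chebyshev: "Polynomial.degree (chebyshev (Suc n)) = Suc n \<and> Polynomial.coeff (chebyshev (Suc n)) (Suc n) = 1"
proof (induction n rule: less_induct)
  case (less n)
  have *: "chebyshev (Suc (Suc k)) = pCons 0 (chebyshev (Suc k)) - chebyshev k" for k by simp
  show ?case
  proof (cases n)
    case 0
    thus ?thesis by simp
  next
    case (Suc k)
    have IH: "Polynomial.degree (chebyshev (Suc k)) = Suc k" "Polynomial.coeff (chebyshev (Suc k)) (Suc k) = 1"
      using less.IH[of k] Suc by auto
    have "Polynomial.degree (chebyshev k) \<le> k" using less.IH[of "k - 1"] Suc by (cases k) auto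
    hence "Polynomial.degree (chebyshev k) < Suc (Suc k)" by simp
    moreover have "chebyshev (Suc k) \<noteq> 0" using IH(2) by auto
    hence "Polynomial.degree (pCons 0 (chebyshev (Suc k))) = Suc (Suc k)" using IH by simp
    ultimately have "Polynomial.degree (chebyshev (Suc (Suc k))) = Suc (Suc k)"
      unfolding * diff_conv_add_uminus by (subst degree_add_eq_left) auto
    moreover have "Polynomial.coeff (chebyshev k) (Suc (Suc k)) = 0"
      using \<open>Polynomial.degree (chebyshev k) < Suc (Suc k)\<close> by (rule coeff_eq_0)
    ultimately show ?thesis unfolding Suc * using IH by simp
  qed
qed

text \<open>Not the classical cyclotomic polynomial: its roots are the numbers
  \<open>\<mu> + 1/\<mu>\<close> for all \<open>\<mu>\<close> with \<open>\<mu>^n = 1\<close>,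
  primitive or not. Being monic for positive \<open>n\<close>, it shows that they are algebraic
  integers.\<close>

definition cyclotomic_poly :: "nat \<Rightarrow> int poly"
  where "cyclotomic_poly n = chebyshev n - [:2:]"

lemma lead_coeff_cyclotomic_poly:
  assumes "n > 0"
  shows "Polynomial.lead_coeff (cyclotomic_poly n) = 1"
proof -
  obtain m where n: "n = Suc m" using assms by (cases n) auto
  have d: "Polynomial.degree (chebyshev n) = n" "Polynomial.coeff (chebyshev n) n = 1"
    using degree_chebyshev[of m] n by auto
  have "Polynomial.degree (cyclotomic_poly n) = n"
    using assms d(1) unfolding cyclotomic_poly_def diff_conv_add_uminus
    by (subst degree_add_eq_left) auto
  thus ?thesis using d(2) n by (simp add: cyclotomic_poly_def)
qed

lemma poly_cyclotomic_poly:
  assumes "\<mu> \<noteq> 0"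
  shows "poly (cpoly (cyclotomic_poly n)) (\<mu> + inverse \<mu>) = 0 \<longleftrightarrow> \<mu> ^ n = 1"
proof -
  have "poly (cpoly (cyclotomic_poly n)) (\<mu> + inverse \<mu>) = \<mu> ^ n + inverse \<mu> ^ n - 2"
    using assms by (simp add: cyclotomic_poly_def cpoly_diff poly_chebyshev map_poly_pCons)
  also have "\<dots> = (\<mu> ^ n - 1)\<^sup>2 / \<mu> ^ n"
  proof -
    define w where "w = \<mu> ^ n"
    have "w \<noteq> 0" using assms by (simp add: w_def)
    have "(w + inverse w - 2) * w = w * w + inverse w * w - 2 * w"
      by (simp only: distrib_right left_diff_distrib)
    also have "\<dots> = (w - 1)\<^sup>2"
      using \<open>w \<noteq> 0\<close> by (simp add: power2_eq_square left_diff_distrib right_diff_distrib)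
    finally have "w + inverse w - 2 = (w - 1)\<^sup>2 / w"
      using \<open>w \<noteq> 0\<close> by (metis nonzero_eq_divide_eq)
    thus ?thesis by (simp add: w_def power_inverse)
  qed
  finally show ?thesis using assms by simp
qed

lemma norm_root_cyclotomic_poly:
  assumes "n > 0" "poly (cpoly (cyclotomic_poly n)) w = 0"
  shows "norm w \<le> 2"
proof -
  obtain \<mu> where \<mu>: "\<mu> \<noteq> 0" "w = \<mu> + inverse \<mu>" using sum_with_inverse_ex by blast
  hence "\<mu> ^ n = 1" using poly_cyclotomic_poly assms by blast
  hence "norm \<mu> = 1" using power_eq_1_iff assms(1) by (metis gr_implies_not0)
  thus ?thesis using norm_triangle_ineq[of \<mu> "inverse \<mu>"] \<mu> by (simp add: norm_inverse)
qed

text \<open>The low degree factor \<open>g\<close> of \<open>cyclotomic_poly n\<close> has leading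
  coefficient 1 or -1, and its complex roots are roots of \<open>cyclotomic_poly n\<close>, hence of
  norm at most 2. This bounds the coefficients of \<open>g\<close> in terms of \<open>d\<close>
  alone, independently of \<open>n\<close>.\<close>

theorem finite_cyclotomic_bounded_degree:
  "finite {x. cyclotomic x \<and> (\<exists>h. h \<noteq> 0 \<and> Polynomial.degree h \<le> d \<and> poly (cpoly h) x = 0)}"
proof (rule finite_subset)
  let ?G = "{g :: int poly. Polynomial.degree g \<le> d \<and> (\<forall>i. \<bar>Polynomial.coeff g i\<bar> \<le> 3 ^ d)} - {0}"
  show "finite (\<Union>g\<in>?G. {x. poly (cpoly g) x = 0})"
    using finite_int_polys[of d "3 ^ d"] by (intro finite_UN_I finite_Diff poly_roots_finite) auto
  show "{x. cyclotomic x \<and> (\<exists>h. h \<noteq> 0 \<and> Polynomial.degree h \<le> d \<and> poly (cpoly h) x = 0)} \<subseteq>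
      (\<Union>g\<in>?G. {x. poly (cpoly g) x = 0})"
  proof
    fix x assume "x \<in> {x. cyclotomic x \<and> (\<exists>h. h \<noteq> 0 \<and> Polynomial.degree h \<le> d \<and> poly (cpoly h) x = 0)}"
    then obtain \<mu> n h where n: "n > 0" "\<mu> ^ n = 1" "x = \<mu> + inverse \<mu>"
      and h: "h \<noteq> 0" "Polynomial.degree h \<le> d" "poly (cpoly h) x = 0" by (auto simp: cyclotomic_def)
    have "\<mu> \<noteq> 0" using n by (auto simp: power_0_left)
    hence x: "poly (cpoly (cyclotomic_poly n)) x = 0" using n poly_cyclotomic_poly by simp
    from low_degree_factor[OF lead_coeff_cyclotomic_poly[OF n(1)] x h]
    obtain g where g: "g dvd cyclotomic_poly n" "g \<noteq> 0" "Polynomial.degree g \<le> d" "poly (cpoly g) x = 0"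
      "\<bar>Polynomial.lead_coeff g\<bar> = 1" by blast
    obtain A where A: "size A = Polynomial.degree (cpoly g)"
      "cpoly g = Polynomial.smult (Polynomial.lead_coeff (cpoly g)) (\<Prod>w\<in>#A. [:- w, 1:])"
      using alg_closed_imp_factorization[of "cpoly g"] g(2) by auto
    have A2: "norm w \<le> 2" if "w \<in># A" for w
    proof -
      have "poly (\<Prod>w\<in>#A. [:- w, 1:]) w = 0" using that
        by (induction A) auto
      hence "poly (cpoly g) w = 0" by (subst A(2)) simp
      hence "poly (cpoly (cyclotomic_poly n)) w = 0"
        using g(1) by (auto simp: dvd_def cpoly_mult)
      thus ?thesis using norm_root_cyclotomic_poly n(1) by blast
    qed
    have B: "norm (Polynomial.coeff (\<Prod>w\<in>#A. [:- w, 1:]) i) \<le> 3 ^ d" for i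
    proof (rule order_trans)
      show "norm (Polynomial.coeff (\<Prod>w\<in>#A. [:- w, 1:]) i) \<le> 3 ^ size A"
        using A2 by (rule coeff_prod_mset_bound)
      show "(3::real) ^ size A \<le> 3 ^ d" using A(1) g(3) by (intro power_increasing) auto
    qed
    have "\<bar>Polynomial.coeff g i\<bar> \<le> 3 ^ d" for i
    proof -
      have "of_int (Polynomial.coeff g i) = Polynomial.coeff (cpoly g) i" by (simp add: coeff_map_poly)
      also have "norm \<dots> = norm (Polynomial.lead_coeff (cpoly g)) * norm (Polynomial.coeff (\<Prod>w\<in>#A. [:- w, 1:]) i)"
        by (subst A(2)) (simp add: norm_mult)
      also have "norm (Polynomial.lead_coeff (cpoly g)) = 1"
        using g(5) by (simp add: coeff_map_poly)
      finally have "norm (of_int (Polynomial.coeff g i) :: complex) \<le> 3 ^ d" using B[of i] by simp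
      thus ?thesis by (simp) (metis of_int_abs of_int_le_iff of_int_numeral of_int_power)
    qed
    with g show "x \<in> (\<Union>g\<in>?G. {x. poly (cpoly g) x = 0})" by auto
  qed
qed

section \<open>Number fields and algebraic numbers inside the complex numbers\<close>

interpretation CC: domain "ring_of_type_algebra :: complex ring"
  using field_from_type_algebra by (rule field.axioms)

lemma CC_ops [simp]:
  "carrier (ring_of_type_algebra :: complex ring) = UNIV"
  "x \<otimes>\<^bsub>ring_of_type_algebra\<^esub> y = x * (y :: complex)"
  "x \<oplus>\<^bsub>ring_of_type_algebra\<^esub> y = x + (y :: complex)"
  "\<one>\<^bsub>ring_of_type_algebra\<^esub> = (1 :: complex)"
  "\<zero>\<^bsub>ring_of_type_algebra\<^esub> = (0 :: complex)"
  by (simp_all add: ring_of_type_algebra_def)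

lemma CC_uminus [simp]: "\<ominus>\<^bsub>ring_of_type_algebra\<^esub> x = - (x :: complex)"
  by (rule CC.minus_equality) simp_all

lemma CC_inverse: "x \<noteq> 0 \<Longrightarrow> inv\<^bsub>ring_of_type_algebra\<^esub> x = inverse (x :: complex)"
  by (rule CC.comm_inv_char) simp_all

lemma CC_power [simp]: "x [^]\<^bsub>ring_of_type_algebra\<^esub> (n :: nat) = (x :: complex) ^ n"
  by (induction n) (simp_all add: mult.commute)

lemma subring_CC_I:
  assumes "1 \<in> F" "\<And>u. u \<in> F \<Longrightarrow> - u \<in> F" "\<And>u v. u \<in> F \<Longrightarrow> v \<in> F \<Longrightarrow> u * v \<in> F"
    "\<And>u v. u \<in> F \<Longrightarrow> v \<in> F \<Longrightarrow> u + v \<in> F"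
  shows "subring F (ring_of_type_algebra :: complex ring)"
  using assms by (intro CC.subringI) auto

lemma subfield_Rats: "subfield \<rat> (ring_of_type_algebra :: complex ring)"
  by (rule field.subfieldI'[OF field_from_type_algebra]) (auto intro: subring_CC_I simp: CC_inverse)

text \<open>This is \<open>real_number_field\<close> without the reality condition, since roots of
  unity have to be adjoined on the way.\<close>

definition number_field :: "complex set \<Rightarrow> bool"
  where "number_field F \<longleftrightarrow> subfield F (ring_of_type_algebra :: complex ring) \<and>
    CC.finite_dimension \<rat> F"

lemma number_field_closed:
  assumes "number_field F" "u \<in> F" "v \<in> F"
  shows "u + v \<in> F" "u - v \<in> F" "u / v \<in> F"
proof -
  have F: "subring F (ring_of_type_algebra :: complex ring)" and F': "subfield F (ring_of_type_algebra :: complex ring)"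
    using assms(1) subfieldE(1) by (auto simp: number_field_def)
  show "u + v \<in> F" using subringE(7)[OF F] assms by simp
  have "- v \<in> F" using subringE(5)[OF F] assms by simp
  thus "u - v \<in> F" using subringE(7)[OF F, of u "- v"] assms by simp
  have "inverse v \<in> F"
  proof (cases "v = 0")
    case True thus ?thesis using assms by simp
  next
    case False
    thus ?thesis using CC.subfield_m_inv(1)[OF F', of v] assms by (simp add: CC_inverse)
  qed
  thus "u / v \<in> F" using subringE(6)[OF F, of u "inverse v"] assms by (simp add: divide_inverse)
qed

lemma number_field_algebraic:
  assumes "number_field F" "x \<in> F"
  shows "(CC.algebraic over \<rat>) x"
  using CC.finite_dimension_imp_algebraic[OF subfield_Rats, of F x] assms subfieldE(1)
  by (auto simp: number_field_def)

lemma number_field_of_algebraic_numbers: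
  assumes "finite S" "\<And>x. x \<in> S \<Longrightarrow> (CC.algebraic over \<rat>) x"
  obtains F where "number_field F" "S \<subseteq> F" "S \<subseteq> \<real> \<Longrightarrow> F \<subseteq> \<real>"
proof -
  obtain xs where xs: "set xs = S" using assms(1) finite_list by blast
  let ?F = "CC.finite_extension \<rat> xs"
  have 1: "number_field ?F"
    using CC.finite_extension_is_subfield[OF subfield_Rats, of xs]
      CC.finite_extension_finite_dimension(1)[OF subfield_Rats, of xs] assms(2) xs
    by (auto simp: number_field_def)
  have 2: "S \<subseteq> ?F" using CC.finite_extension_mem[of \<rat> xs] subfieldE(1)[OF subfield_Rats] xs by simp
  have 3: "?F \<subseteq> \<real>" if "S \<subseteq> \<real>"
  proof (rule CC.finite_extension_subring_incl)
    show "subring \<real> (ring_of_type_algebra :: complex ring)" by (rule subring_CC_I) auto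
    show "\<rat> \<subseteq> (\<real> :: complex set)" by (metis Rats_cases' Reals_divide Reals_of_int subsetI)
    show "set xs \<subseteq> \<real>" using that xs by simp
  qed
  from 1 2 3 show thesis by (rule that)
qed

lemma algebraic_closed:
  assumes "(CC.algebraic over \<rat>) u" "(CC.algebraic over \<rat>) v"
  shows "(CC.algebraic over \<rat>) (u + v)" "(CC.algebraic over \<rat>) (u - v)" "(CC.algebraic over \<rat>) (u / v)"
proof -
  obtain F where F: "number_field F" "{u, v} \<subseteq> F"
    using number_field_of_algebraic_numbers[of "{u, v}"] assms by auto
  thus "(CC.algebraic over \<rat>) (u + v)" "(CC.algebraic over \<rat>) (u - v)" "(CC.algebraic over \<rat>) (u / v)"
    by (auto intro!: number_field_algebraic[OF F(1)] number_field_closed)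
qed

text \<open>Transcendence would make evaluation at \<open>\<mu>\<close> injective on polynomials,
  but the monomials of exponents \<open>n\<close> and 0 both take the value 1.\<close>

lemma algebraic_root_of_unity:
  assumes "n > 0" "\<mu> ^ n = 1"
  shows "(CC.algebraic over \<rat>) \<mu>"
proof (rule ccontr)
  assume "\<not> (CC.algebraic over \<rat>) \<mu>"
  hence inj: "inj_on (\<lambda>p. CC.eval p \<mu>) (carrier (\<rat> [X]\<^bsub>ring_of_type_algebra\<^esub>))"
    by (simp add: over_def CC.transcendental_def)
  have mem: "CC.monom 1 k \<in> carrier (\<rat> [X]\<^bsub>ring_of_type_algebra\<^esub>)" for k
    using CC.monom_is_polynomial[OF subfieldE(1)[OF subfield_Rats], of 1 k]
    by (simp add: univ_poly_def)
  have ev: "CC.eval (CC.monom 1 k) \<mu> = \<mu> ^ k" for k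
    using CC.eval_monom[of 1 \<mu> k] by simp
  have "CC.monom 1 n = CC.monom 1 0"
    using inj_onD[OF inj _ mem mem, of n 0] ev assms(2) by simp
  thus False using assms(1) by (auto simp: CC.monom_def)
qed

lemma cyclotomic_algebraic: "cyclotomic x \<Longrightarrow> (CC.algebraic over \<rat>) x"
proof -
  assume "cyclotomic x"
  then obtain \<mu> n where n: "n > 0" "\<mu> ^ n = 1" "x = \<mu> + inverse \<mu>" by (auto simp: cyclotomic_def)
  have "inverse \<mu> ^ n = 1" using n(2) by (simp add: power_inverse)
  show ?thesis unfolding n(3)
    using algebraic_closed(1)[OF algebraic_root_of_unity[OF n(1,2)] algebraic_root_of_unity[OF n(1)]]
      \<open>inverse \<mu> ^ n = 1\<close> by simp
qed

lemma clear_denominators: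
  fixes f :: "'i \<Rightarrow> complex"
  assumes "finite I" "\<And>i. i \<in> I \<Longrightarrow> f i \<in> \<rat>"
  shows "\<exists>N :: int. N > 0 \<and> (\<forall>i\<in>I. of_int N * f i \<in> \<int>)"
  using assms
proof (induction I rule: finite_induct)
  case empty
  show ?case by (intro exI[of _ 1]) simp
next
  case (insert i I)
  then obtain N :: int where N: "N > 0" "\<forall>j\<in>I. of_int N * f j \<in> \<int>" by auto
  obtain p q :: int where pq: "q > 0" "f i = of_int p / of_int q"
    using insert.prems[of i] by (metis Rats_cases' insertI1)
  have "of_int (N * q) * f j \<in> \<int>" if "j \<in> insert i I" for j
  proof (cases "j = i")
    case True
    hence "of_int (N * q) * f j = of_int (N * p)" using pq by simp
    thus ?thesis by (simp only: Ints_of_int)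
  next
    case False
    hence "of_int N * f j \<in> \<int>" using N that by auto
    hence "of_int q * (of_int N * f j) \<in> \<int>" by (rule Ints_mult[OF Ints_of_int])
    moreover have "of_int q * (of_int N * f j) = of_int (N * q) * f j" by simp
    ultimately show ?thesis by (simp only:)
  qed
  thus ?case using N(1) pq(1) by (intro exI[of _ "N * q"]) auto
qed

lemma CC_combine_sum:
  "length Ks = length Us \<Longrightarrow> CC.combine Ks Us = (\<Sum>i<length Us. Ks ! i * Us ! i)"
proof (induction Ks Us rule: list_induct2)
  case (Cons k Ks u Us)
  thus ?case by (simp add: sum.lessThan_Suc_shift del: sum.lessThan_Suc)
qed simp

text \<open>In a field of dimension \<open>d\<close> over the rationals the \<open>d + 1\<close>
  powers \<open>1, x, ..., x^d\<close> are dependent; clearing denominators in a relation gives the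
  integral polynomial.\<close>

lemma number_field_degree_bound:
  assumes "number_field F"
  obtains d where "\<And>x. x \<in> F \<Longrightarrow> \<exists>h. h \<noteq> 0 \<and> Polynomial.degree h \<le> d \<and> poly (cpoly h) x = 0"
proof -
  have F: "subring F (ring_of_type_algebra :: complex ring)"
    using assms subfieldE(1) by (auto simp: number_field_def)
  obtain d where d: "CC.dimension d \<rat> F" using assms by (auto simp: number_field_def CC.finite_dimension_def)
  have "\<exists>h. h \<noteq> 0 \<and> Polynomial.degree h \<le> d \<and> poly (cpoly h) x = 0" if "x \<in> F" for x
  proof -
    let ?Us = "map (\<lambda>i. x ^ i) [0..<Suc d]"
    have "x ^ i \<in> F" for i
      using that subringE(3,6)[OF F] by (induction i) auto
    hence "set ?Us \<subseteq> F" by auto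
    hence "\<not> CC.independent \<rat> ?Us"
      using CC.independent_length_le_dimension[OF subfield_Rats d, of ?Us] by auto
    then obtain Ks where Ks: "length Ks = Suc d" "CC.combine Ks ?Us = 0" "set Ks \<subseteq> \<rat>" "set Ks \<noteq> {0}"
    proof (rule CC.dependent_imp_non_trivial_combine[OF subfield_Rats, rotated])
      fix Ks assume "length Ks = length ?Us" "CC.combine Ks ?Us = \<zero>\<^bsub>ring_of_type_algebra\<^esub>"
        "set Ks \<subseteq> \<rat>" "set Ks \<noteq> {\<zero>\<^bsub>ring_of_type_algebra\<^esub>}"
      thus thesis by (intro that) simp_all
    qed simp
    have rat: "Ks ! i \<in> \<rat>" if "i \<in> {..d}" for i using that Ks by (metis atMost_iff le_imp_less_Suc nth_mem subsetD)
    obtain N :: int where N: "N > 0" "\<forall>i\<in>{..d}. of_int N * Ks ! i \<in> \<int>"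
      using clear_denominators[of "{..d}" "\<lambda>i. Ks ! i"] rat by auto
    hence "\<forall>i\<in>{..d}. \<exists>k. of_int N * Ks ! i = of_int k" by (auto elim: Ints_cases)
    from bchoice[OF this] obtain k where "\<forall>i\<in>{..d}. of_int N * Ks ! i = of_int (k i)" ..
    hence k: "of_int N * Ks ! i = of_int (k i)" if "i \<le> d" for i using that by simp
    define h where "h = (\<Sum>i\<le>d. Polynomial.monom (k i) i)"
    have ch: "Polynomial.coeff h i = (if i \<le> d then k i else 0)" for i
      by (auto simp: h_def coeff_sum if_distrib cong: if_cong)
    have "h \<noteq> 0"
    proof
      assume "h = 0"
      hence "k i = 0" if "i \<le> d" for i using ch[of i] that by simp
      hence "Ks ! i = 0" if "i \<le> d" for i using k[OF that] that N(1) by simp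
      hence "set Ks \<subseteq> {0}" using Ks(1) by (auto simp: in_set_conv_nth less_Suc_eq_le)
      moreover have "set Ks \<noteq> {}" using Ks(1) by auto
      ultimately show False using Ks(4) by (metis subset_singletonD set_empty)
    qed
    moreover have "Polynomial.degree h \<le> d" by (rule degree_le) (simp add: ch)
    moreover have "poly (cpoly h) x = 0"
    proof -
      have "cpoly h = (\<Sum>i\<le>d. Polynomial.monom (of_int (k i)) i)"
        by (rule poly_eqI) (simp add: coeff_map_poly ch coeff_sum if_distrib cong: if_cong)
      hence "poly (cpoly h) x = (\<Sum>i\<le>d. of_int (k i) * x ^ i)"
        by (simp add: poly_sum poly_monom)
      also have "\<dots> = of_int N * (\<Sum>i<Suc d. Ks ! i * x ^ i)"
        unfolding sum_distrib_left lessThan_Suc_atMost using k by (intro sum.cong) (auto simp: mult.assoc[symmetric])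
      also have "(\<Sum>i<Suc d. Ks ! i * x ^ i) = CC.combine Ks ?Us"
        using Ks(1) by (subst CC_combine_sum) (auto intro!: sum.cong simp del: upt_Suc)
      finally show ?thesis using Ks(2) by simp
    qed
    ultimately show ?thesis by blast
  qed
  thus thesis by (rule that)
qed

theorem finite_cyclotomic_number_field:
  assumes "number_field F"
  shows "finite {x \<in> F. cyclotomic x}"
proof -
  obtain d where d: "\<And>x. x \<in> F \<Longrightarrow> \<exists>h. h \<noteq> 0 \<and> Polynomial.degree h \<le> d \<and> poly (cpoly h) x = 0"
    using number_field_degree_bound[OF assms] by blast
  show ?thesis
    by (rule finite_subset[OF _ finite_cyclotomic_bounded_degree[of d]]) (use d in auto)
qed

section \<open>Elliptic fibres of the real surface\<close>

text \<open>A copy of the real points in real 3-space, where the trigonometric parametrisation,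
  balls and components are at hand; \<open>cpoint\<close> carries the results back to complex
  triples.\<close>

definition rsurf :: "real \<Rightarrow> real \<Rightarrow> real \<Rightarrow> real \<Rightarrow> (real \<times> real \<times> real) set"
  where "rsurf a b c d = {(x, y, z). x\<^sup>2 + y\<^sup>2 + z\<^sup>2 + x * y * z = a * x + b * y + c * z + d}"

text \<open>For \<open>\<bar>x\<bar> < 2\<close> the fibre over \<open>x\<close> is the conic
  \<open>u\<^sup>2 + v\<^sup>2 + x u v = fibre_poly x / (4 - x\<^sup>2)\<close>, where \<open>(u, v)\<close> is the displacement from its centre.\<close>

definition fibre_poly :: "real \<Rightarrow> real \<Rightarrow> real \<Rightarrow> real \<Rightarrow> real \<Rightarrow> real"
  where "fibre_poly a b c d x = (x\<^sup>2 - a * x - d) * (x\<^sup>2 - 4) + b\<^sup>2 + c\<^sup>2 - b * c * x"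

text \<open>Cramer's rule for the two linear equations of \<open>centre\<close>; the
  \<open>z\<close>-coordinate of the centre is the same expression with \<open>b\<close> and
  \<open>c\<close> exchanged.\<close>

definition y_centre :: "real \<Rightarrow> real \<Rightarrow> real \<Rightarrow> real"
  where "y_centre b c x = (2 * b - x * c) / (4 - x\<^sup>2)"

definition ellipse_radius :: "real \<Rightarrow> real \<Rightarrow> real \<Rightarrow> real \<Rightarrow> real \<Rightarrow> real"
  where "ellipse_radius a b c d x = 2 * sqrt (fibre_poly a b c d x) / (4 - x\<^sup>2)"

text \<open>With \<open>x = 2 cos \<phi>\<close>, the phase shift
  \<open>\<phi> = arccos (x / 2)\<close> and the minus sign make \<open>u^2 + v^2 + x u v\<close>
  independent of \<open>t\<close>, and turn \<open>rot_yz\<close> into a translation of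
  \<open>t\<close> by \<open>-2 \<phi>\<close>.\<close>

definition ellipse_point :: "real \<Rightarrow> real \<Rightarrow> real \<Rightarrow> real \<Rightarrow> real \<Rightarrow> real \<Rightarrow> real \<times> real \<times> real"
  where "ellipse_point a b c d x t =
    (x, y_centre b c x + ellipse_radius a b c d x * cos t,
        y_centre c b x - ellipse_radius a b c d x * cos (t + arccos (x / 2)))"

lemma in_rsurf [simp]: "(x, y, z) \<in> rsurf a b c d \<longleftrightarrow>
    x\<^sup>2 + y\<^sup>2 + z\<^sup>2 + x * y * z = a * x + b * y + c * z + d"
  by (simp add: rsurf_def)

lemma cyc_rsurf: "cyc ` rsurf a b c d = rsurf b c a d"
  by (auto simp: set_eq_iff algebra_simps)

lemma swap_rsurf: "swap_yz ` rsurf a b c d = rsurf a c b d"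
  by (auto simp: set_eq_iff algebra_simps)

lemma four_minus_square_pos: "\<bar>x\<bar> < 2 \<Longrightarrow> 4 - x\<^sup>2 > (0 :: real)"
  using abs_square_less_1[of "x / 2"] by (simp add: power_divide)

lemma strip_square: "\<bar>x\<bar> < 2 \<Longrightarrow> x\<^sup>2 \<noteq> (4 :: real)"
  using four_minus_square_pos[of x] by simp

lemma y_centre_eqs:
  assumes "x\<^sup>2 \<noteq> 4"
  shows "2 * y_centre b c x + x * y_centre c b x = b"
proof -
  have nz: "4 - x\<^sup>2 \<noteq> 0" using assms by simp
  have "2 * y_centre b c x + x * y_centre c b x = (2 * (2 * b - x * c) + x * (2 * c - x * b)) / (4 - x\<^sup>2)"
    by (simp add: y_centre_def add_divide_distrib)
  also have "2 * (2 * b - x * c) + x * (2 * c - x * b) = (4 - x\<^sup>2) * b"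
    by (simp add: power2_eq_square algebra_simps)
  finally show ?thesis using nz by simp
qed

lemma conic_iff:
  assumes "x\<^sup>2 \<noteq> 4"
  shows "(x, y_centre b c x + u, y_centre c b x + v) \<in> rsurf a b c d \<longleftrightarrow>
    (u\<^sup>2 + v\<^sup>2 + x * u * v) * (4 - x\<^sup>2) = fibre_poly a b c d x"
proof -
  have nz: "4 - x\<^sup>2 \<noteq> 0" using assms by simp
  define Y Z where "Y = y_centre b c x" and "Z = y_centre c b x"
  have b: "2 * Y + x * Z = b" and c: "2 * Z + x * Y = c"
    using y_centre_eqs[OF assms] by (auto simp: Y_def Z_def)
  have "(x, Y + u, Z + v) \<in> rsurf a b c d \<longleftrightarrow>
      u\<^sup>2 + v\<^sup>2 + x * u * v = Y\<^sup>2 + Z\<^sup>2 + x * Y * Z - x\<^sup>2 + a * x + d"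
    unfolding in_rsurf b[symmetric] c[symmetric] by (simp add: power2_eq_square algebra_simps)
  also have "\<dots> \<longleftrightarrow> (u\<^sup>2 + v\<^sup>2 + x * u * v) * (4 - x\<^sup>2) = (Y\<^sup>2 + Z\<^sup>2 + x * Y * Z - x\<^sup>2 + a * x + d) * (4 - x\<^sup>2)"
    using mult_cancel_right[of _ "4 - x\<^sup>2"] nz by metis
  also have "(Y\<^sup>2 + Z\<^sup>2 + x * Y * Z - x\<^sup>2 + a * x + d) * (4 - x\<^sup>2) = fibre_poly a b c d x"
    unfolding fibre_poly_def b[symmetric] c[symmetric] by (simp add: power2_eq_square algebra_simps)
  finally show ?thesis by (simp add: Y_def Z_def)
qed

lemma centre_iff:
  assumes "x\<^sup>2 \<noteq> 4"
  shows "centre b c (x, y_centre b c x + u, y_centre c b x + v) \<longleftrightarrow> u = 0 \<and> v = 0"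
proof -
  have "centre b c (x, y_centre b c x + u, y_centre c b x + v) \<longleftrightarrow> 2 * u + x * v = 0 \<and> 2 * v + x * u = 0"
  proof -
    define Y Z where "Y = y_centre b c x" and "Z = y_centre c b x"
    have b: "2 * Y + x * Z = b" and c: "2 * Z + x * Y = c"
      using y_centre_eqs[OF assms] by (auto simp: Y_def Z_def)
    have "2 * (Y + u) + x * (Z + v) = b + (2 * u + x * v)" "2 * (Z + v) + x * (Y + u) = c + (2 * v + x * u)"
      unfolding b[symmetric] c[symmetric] by (simp_all add: algebra_simps)
    thus ?thesis unfolding centre_simp Y_def[symmetric] Z_def[symmetric] by (simp only: add_cancel_left_right)
  qed
  also have "\<dots> \<longleftrightarrow> u = 0 \<and> v = 0"
  proof
    assume *: "2 * u + x * v = 0 \<and> 2 * v + x * u = 0"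
    have "(4 - x\<^sup>2) * v = 2 * (2 * v + x * u) - x * (2 * u + x * v)"
      "(4 - x\<^sup>2) * u = 2 * (2 * u + x * v) - x * (2 * v + x * u)"
      by (simp_all add: power2_eq_square algebra_simps)
    hence "(4 - x\<^sup>2) * v = 0" "(4 - x\<^sup>2) * u = 0" using * by simp_all
    thus "u = 0 \<and> v = 0" using assms by simp
  qed simp
  finally show ?thesis .
qed

lemma quadratic_form_pos:
  assumes "\<bar>x\<bar> < 2"
  shows "u\<^sup>2 + v\<^sup>2 + x * u * v \<ge> 0" "u\<^sup>2 + v\<^sup>2 + x * u * v = (0 :: real) \<longleftrightarrow> u = 0 \<and> v = 0"
proof -
  have eq: "u\<^sup>2 + v\<^sup>2 + x * u * v = (u + x / 2 * v)\<^sup>2 + (4 - x\<^sup>2) / 4 * v\<^sup>2"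
  proof -
    define h where "h = x / 2"
    have x: "x = 2 * h" by (simp add: h_def)
    show ?thesis unfolding x by (simp add: power2_eq_square algebra_simps)
  qed
  note pos = four_minus_square_pos[OF assms]
  show "u\<^sup>2 + v\<^sup>2 + x * u * v \<ge> 0" unfolding eq using pos by simp
  show "u\<^sup>2 + v\<^sup>2 + x * u * v = 0 \<longleftrightarrow> u = 0 \<and> v = 0"
  proof
    assume "u\<^sup>2 + v\<^sup>2 + x * u * v = 0"
    moreover have "(u + x / 2 * v)\<^sup>2 \<ge> 0" "(4 - x\<^sup>2) / 4 * v\<^sup>2 \<ge> 0" using pos by simp_all
    ultimately have "(u + x / 2 * v)\<^sup>2 = 0" "(4 - x\<^sup>2) / 4 * v\<^sup>2 = 0" unfolding eq by linarith+
    thus "u = 0 \<and> v = 0" using pos by simp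
  qed simp
qed

text \<open>The second part makes centrality a property of the fibre: the points over one
  \<open>x\<close> are all central or all noncentral.\<close>

lemma fibre_poly_nonneg:
  assumes "(x, y, z) \<in> rsurf a b c d" "\<bar>x\<bar> < 2"
  shows "fibre_poly a b c d x \<ge> 0"
    and "fibre_poly a b c d x > 0 \<longleftrightarrow> \<not> centre b c (x, y, z)"
proof -
  define u v where "u = y - y_centre b c x" and "v = z - y_centre c b x"
  have yz: "y = y_centre b c x + u" "z = y_centre c b x + v" by (simp_all add: u_def v_def)
  have eq: "fibre_poly a b c d x = (u\<^sup>2 + v\<^sup>2 + x * u * v) * (4 - x\<^sup>2)"
    using assms(1) conic_iff[OF strip_square[OF assms(2)]] unfolding yz by simp
  note pos = four_minus_square_pos[OF assms(2)] and q = quadratic_form_pos[OF assms(2), of u v]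
  show "fibre_poly a b c d x \<ge> 0" unfolding eq using pos q(1) by simp
  show "fibre_poly a b c d x > 0 \<longleftrightarrow> \<not> centre b c (x, y, z)"
    unfolding eq yz centre_iff[OF strip_square[OF assms(2)]] using pos q by (auto simp: zero_less_mult_iff)
qed

lemma sin_arccos_half: "\<bar>x\<bar> < 2 \<Longrightarrow> sin (arccos (x / 2)) = sqrt (4 - x\<^sup>2) / 2"
proof -
  assume "\<bar>x\<bar> < 2"
  hence "sin (arccos (x / 2)) = sqrt (1 - (x / 2)\<^sup>2)" by (intro sin_arccos) auto
  also have "1 - (x / 2)\<^sup>2 = (4 - x\<^sup>2) / 2\<^sup>2" by (simp add: power_divide)
  finally show ?thesis by (simp only: real_sqrt_divide) simp
qed

lemma sin_squared_arccos_half: "\<bar>x\<bar> < 2 \<Longrightarrow> (sin (arccos (x / 2)))\<^sup>2 = (4 - x\<^sup>2) / 4"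
  using four_minus_square_pos[of x] sin_arccos_half[of x] by (simp only: power_divide) simp

lemma trig_conic_identity:
  "(cos t)\<^sup>2 + (cos (t + \<phi>))\<^sup>2 - 2 * cos \<phi> * cos t * cos (t + \<phi>) = (sin \<phi> :: real)\<^sup>2"
proof -
  have "(cos t)\<^sup>2 + (cos (t + \<phi>))\<^sup>2 - 2 * cos \<phi> * cos t * cos (t + \<phi>) =
      (cos t)\<^sup>2 * (1 - (cos \<phi>)\<^sup>2) + (sin t * sin \<phi>)\<^sup>2"
    unfolding cos_add by (simp add: power2_eq_square algebra_simps)
  also have "\<dots> = (sin \<phi>)\<^sup>2 * ((cos t)\<^sup>2 + (sin t)\<^sup>2)"
    by (simp add: sin_squared_eq power_mult_distrib algebra_simps)
  finally show ?thesis by simp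
qed

lemma ellipse_radius_square:
  assumes "\<bar>x\<bar> < 2" "fibre_poly a b c d x \<ge> 0"
  shows "(ellipse_radius a b c d x)\<^sup>2 * (4 - x\<^sup>2)\<^sup>2 = 4 * fibre_poly a b c d x"
  using four_minus_square_pos[OF assms(1)] assms(2)
  by (simp add: ellipse_radius_def power_divide power_mult_distrib)

lemma ellipse_point_in_rsurf:
  assumes "\<bar>x\<bar> < 2" "fibre_poly a b c d x \<ge> 0"
  shows "ellipse_point a b c d x t \<in> rsurf a b c d"
proof -
  define \<phi> where "\<phi> = arccos (x / 2)"
  define r where "r = ellipse_radius a b c d x"
  have x: "x = 2 * cos \<phi>" using assms(1) by (simp add: \<phi>_def cos_arccos)
  have s: "(sin \<phi>)\<^sup>2 = (4 - x\<^sup>2) / 4"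
    unfolding \<phi>_def by (rule sin_squared_arccos_half[OF assms(1)])
  have "(r * cos t)\<^sup>2 + (- r * cos (t + \<phi>))\<^sup>2 + x * (r * cos t) * (- r * cos (t + \<phi>)) =
      r\<^sup>2 * ((cos t)\<^sup>2 + (cos (t + \<phi>))\<^sup>2 - 2 * cos \<phi> * cos t * cos (t + \<phi>))"
    unfolding x by (simp add: power2_eq_square algebra_simps)
  also have "\<dots> = r\<^sup>2 * ((4 - x\<^sup>2) / 4)" unfolding trig_conic_identity s ..
  finally have "((r * cos t)\<^sup>2 + (- r * cos (t + \<phi>))\<^sup>2 + x * (r * cos t) * (- r * cos (t + \<phi>))) * (4 - x\<^sup>2) =
      r\<^sup>2 * (4 - x\<^sup>2)\<^sup>2 / 4" by (simp add: power2_eq_square)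
  also have "\<dots> = fibre_poly a b c d x"
    using ellipse_radius_square[OF assms] by (simp add: r_def)
  finally have "(x, y_centre b c x + r * cos t, y_centre c b x + (- r * cos (t + \<phi>))) \<in> rsurf a b c d"
    using conic_iff[OF strip_square[OF assms(1)]] by blast
  thus ?thesis by (simp add: ellipse_point_def r_def \<phi>_def del: in_rsurf)
qed

lemma ellipse_point_exists:
  assumes "(x, y, z) \<in> rsurf a b c d" "\<bar>x\<bar> < 2"
  obtains t where "(x, y, z) = ellipse_point a b c d x t"
proof -
  define \<phi> where "\<phi> = arccos (x / 2)"
  define r where "r = ellipse_radius a b c d x"
  define u v where "u = y - y_centre b c x" and "v = z - y_centre c b x"
  have yz: "y = y_centre b c x + u" "z = y_centre c b x + v" by (simp_all add: u_def v_def)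
  have x: "x = 2 * cos \<phi>" using assms(2) by (simp add: \<phi>_def cos_arccos)
  note pos = four_minus_square_pos[OF assms(2)] and P = fibre_poly_nonneg(1)[OF assms]
  have s: "(sin \<phi>)\<^sup>2 = (4 - x\<^sup>2) / 4"
    unfolding \<phi>_def by (rule sin_squared_arccos_half[OF assms(2)])
  have s0: "sin \<phi> > 0" unfolding \<phi>_def sin_arccos_half[OF assms(2)] using pos by simp
  have "(u\<^sup>2 + v\<^sup>2 + x * u * v) * (4 - x\<^sup>2) = fibre_poly a b c d x"
    using assms(1) conic_iff[OF strip_square[OF assms(2)]] unfolding yz by blast
  hence "(u\<^sup>2 + v\<^sup>2 + x * u * v) * (4 - x\<^sup>2) * 4 = r\<^sup>2 * (4 - x\<^sup>2)\<^sup>2"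
    using ellipse_radius_square[OF assms(2) P] by (simp add: r_def)
  hence "(4 - x\<^sup>2) * ((u\<^sup>2 + v\<^sup>2 + x * u * v) * 4 - r\<^sup>2 * (4 - x\<^sup>2)) = 0"
    by (simp add: power2_eq_square algebra_simps)
  hence q: "u\<^sup>2 + v\<^sup>2 + x * u * v = r\<^sup>2 * (sin \<phi>)\<^sup>2" using pos unfolding s by simp
  have "\<exists>t. u = r * cos t \<and> v = - r * cos (t + \<phi>)"
  proof (cases "r = 0")
    case True
    thus ?thesis using q quadratic_form_pos(2)[OF assms(2), of u v] by simp
  next
    case False
    \<comment> \<open>The only candidates for the cosine and sine of the parameter, read off from
      \<open>u\<close> and from the addition formula for \<open>v\<close>; the conic equation puts
      them on the unit circle.\<close>
    define C S where "C = u / r" and "S = (v / r + C * cos \<phi>) / sin \<phi>"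
    have u: "u = r * C" using False by (simp add: C_def)
    have v: "v = r * (S * sin \<phi> - C * cos \<phi>)" using False s0 by (simp add: S_def)
    have "u\<^sup>2 + v\<^sup>2 + x * u * v = r\<^sup>2 * (C\<^sup>2 * (1 - (cos \<phi>)\<^sup>2) + S\<^sup>2 * (sin \<phi>)\<^sup>2)"
      unfolding u v x by (simp add: power2_eq_square algebra_simps)
    hence "r\<^sup>2 * (sin \<phi>)\<^sup>2 * (C\<^sup>2 + S\<^sup>2 - 1) = 0"
      using q by (simp add: sin_squared_eq algebra_simps)
    hence "C\<^sup>2 + S\<^sup>2 = 1" using False s0 by simp
    then obtain t where "C = cos t" "S = sin t" using sincos_total_2pi by metis
    hence "u = r * cos t" "v = - r * cos (t + \<phi>)" unfolding u v by (simp_all add: cos_add algebra_simps)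
    thus ?thesis by blast
  qed
  then obtain t where "u = r * cos t" "v = - r * cos (t + \<phi>)" by blast
  hence "(x, y, z) = ellipse_point a b c d x t"
    unfolding yz by (simp add: ellipse_point_def r_def \<phi>_def)
  thus thesis by (rule that)
qed

text \<open>Since \<open>2 cos \<phi> cos s\<close> is the sum of the cosines at
  \<open>s - \<phi>\<close> and \<open>s + \<phi>\<close>, each involution replaces one neighbour of
  \<open>s\<close> by the other, and the composite shifts the parameter.\<close>

lemma rot_yz_ellipse_point:
  assumes "\<bar>x\<bar> < 2"
  shows "rot_yz b c (ellipse_point a b c d x t) = ellipse_point a b c d x (t - 2 * arccos (x / 2))"
proof -
  define \<phi> where "\<phi> = arccos (x / 2)"
  define r where "r = ellipse_radius a b c d x"
  define Y Z where "Y = y_centre b c x" and "Z = y_centre c b x"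
  have x: "x = 2 * cos \<phi>" using assms by (simp add: \<phi>_def cos_arccos)
  have b: "2 * Y + x * Z = b" and c: "2 * Z + x * Y = c"
    using y_centre_eqs[OF strip_square[OF assms]] by (auto simp: Y_def Z_def)
  have prosthaphaeresis: "2 * cos \<phi> * cos s = cos (s - \<phi>) + cos (s + \<phi>)" for s :: real
    by (simp add: cos_add cos_diff)
  have z': "c - (Z - r * cos (t + \<phi>)) - x * (Y + r * cos t) = Z - r * cos (t - \<phi>)"
  proof -
    have "c - (Z - r * cos (t + \<phi>)) - x * (Y + r * cos t) = Z + r * (cos (t + \<phi>) - 2 * cos \<phi> * cos t)"
      unfolding c[symmetric] by (simp add: x algebra_simps)
    thus ?thesis unfolding prosthaphaeresis by (simp add: algebra_simps)
  qed
  have y': "b - (Y + r * cos t) - x * (Z - r * cos (t - \<phi>)) = Y + r * cos (t - 2 * \<phi>)"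
  proof -
    have "b - (Y + r * cos t) - x * (Z - r * cos (t - \<phi>)) = Y + r * (2 * cos \<phi> * cos (t - \<phi>) - cos t)"
      unfolding b[symmetric] by (simp add: x algebra_simps)
    moreover have "t - \<phi> - \<phi> = t - 2 * \<phi>" "t - \<phi> + \<phi> = t" by simp_all
    ultimately show ?thesis unfolding prosthaphaeresis[of "t - \<phi>"] by (simp add: algebra_simps)
  qed
  have "t - 2 * \<phi> + \<phi> = t - \<phi>" by simp
  thus ?thesis
    unfolding ellipse_point_def \<phi>_def[symmetric] r_def[symmetric] Y_def[symmetric] Z_def[symmetric]
      rot_yz_simp z' y' by simp
qed

lemma rot_yz_funpow_ellipse_point:
  assumes "\<bar>x\<bar> < 2"
  shows "(rot_yz b c ^^ n) (ellipse_point a b c d x t) = ellipse_point a b c d x (t - 2 * real n * arccos (x / 2))"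
  by (induction n) (simp_all add: rot_yz_ellipse_point[OF assms] algebra_simps)

lemma irrational_angle:
  assumes "\<bar>x\<bar> < 2" "\<not> cyclotomic (complex_of_real x)"
  shows "arccos (x / 2) / pi \<notin> \<rat>"
proof
  define \<phi> where "\<phi> = arccos (x / 2)"
  assume "arccos (x / 2) / pi \<in> \<rat>"
  then obtain p q :: int where pq: "q > 0" "\<phi> / pi = of_int p / of_int q"
    using Rats_cases' unfolding \<phi>_def by metis
  hence \<phi>: "of_int q * \<phi> = of_int p * pi" by (simp add: field_simps)
  define n where "n = nat (2 * q)"
  have n: "n > 0" "real n = 2 * of_int q" using pq(1) by (auto simp: n_def)
  have "real n * \<phi> = 2 * (of_int q * \<phi>)" using n(2) by simp
  hence "real n * \<phi> = 2 * pi * of_int p" unfolding \<phi> by simp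
  hence "cis \<phi> ^ n = cis (2 * pi * of_int p)" using Complex.DeMoivre[of \<phi> n] by simp
  also have "\<dots> = 1" by (rule cis_multiple_2pi) simp
  finally have "cis \<phi> ^ n = 1" .
  moreover have "complex_of_real x = cis \<phi> + inverse (cis \<phi>)"
    unfolding cis_inverse using assms(1) by (simp add: complex_eq_iff \<phi>_def cos_arccos)
  ultimately show False using assms(2) n(1) unfolding cyclotomic_def by blast
qed

text \<open>Over a non-cyclotomic \<open>x\<close> the rotation is irrational, so its iterates bring
  one point of the ellipse arbitrarily close to any other; closedness of \<open>G\<close> supplies
  the limit.\<close>

theorem conic_orbit_dense:
  assumes "closed G" "invariant_under a b c G" "(x, y, z) \<in> G"
    and "(x, y, z) \<in> rsurf a b c d" "(x, y', z') \<in> rsurf a b c d"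
    and "\<bar>x\<bar> < 2" "\<not> cyclotomic (complex_of_real x)"
  shows "(x, y', z') \<in> G"
proof -
  define \<phi> where "\<phi> = arccos (x / 2)"
  obtain t where t: "(x, y, z) = ellipse_point a b c d x t" using ellipse_point_exists assms(4,6) by blast
  obtain t' where t': "(x, y', z') = ellipse_point a b c d x t'" using ellipse_point_exists assms(5,6) by blast
  \<comment> \<open>Angles are measured in full turns: \<open>k\<close> rotations subtract
    \<open>k \<phi> / pi\<close> turns, and \<open>\<alpha>\<close> is the amount to be subtracted
    modulo 1.\<close>
  define \<alpha> where "\<alpha> = frac ((t - t') / (2 * pi))"
  have "\<exists>k. \<bar>frac (real k * (\<phi> / pi)) - \<alpha>\<bar> < 1 / (real n + 1)" for n
  proof -
    have "\<phi> / pi \<notin> \<rat>" using irrational_angle[OF assms(6,7)] by (simp add: \<phi>_def)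
    moreover have "0 \<le> \<alpha>" "\<alpha> \<le> 1"
      using frac_ge_0[of "(t - t') / (2 * pi)"] frac_lt_1[of "(t - t') / (2 * pi)"] by (auto simp: \<alpha>_def)
    ultimately show ?thesis by (rule Kronecker_approx_1_explicit[where \<epsilon> = "1 / (real n + 1)"]) auto
  qed
  then obtain k where k: "\<And>n. \<bar>frac (real (k n) * (\<phi> / pi)) - \<alpha>\<bar> < 1 / (real n + 1)" by metis
  define e where "e n = frac (real (k n) * (\<phi> / pi)) - \<alpha>" for n
  have e: "e \<longlonglongrightarrow> 0"
  proof (rule Lim_null_comparison)
    show "\<forall>\<^sub>F n in sequentially. norm (e n) \<le> 1 / (real n + 1)" using k by (auto simp: e_def less_imp_le)
    show "(\<lambda>n. 1 / (real n + 1)) \<longlonglongrightarrow> 0" using LIMSEQ_inverse_real_of_nat by (simp add: inverse_eq_divide add.commute)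
  qed
  have mem: "ellipse_point a b c d x (t' - 2 * pi * e n) \<in> G" for n
  proof -
    define m where "m = \<lfloor>(t - t') / (2 * pi)\<rfloor> - \<lfloor>real (k n) * (\<phi> / pi)\<rfloor>"
    have "e n = real (k n) * (\<phi> / pi) - (t - t') / (2 * pi) + of_int m"
      by (simp add: e_def \<alpha>_def frac_def m_def)
    hence "2 * pi * e n = 2 * pi * (real (k n) * (\<phi> / pi)) - 2 * pi * ((t - t') / (2 * pi)) + 2 * pi * of_int m"
      by (simp only: distrib_left right_diff_distrib)
    hence "2 * pi * e n = 2 * real (k n) * \<phi> - (t - t') + 2 * pi * of_int m" by simp
    hence eq: "t - 2 * real (k n) * \<phi> = (t' - 2 * pi * e n) + 2 * pi * of_int m" by simp
    have per: "cos (s + 2 * pi * of_int m) = cos s" for s :: real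
      unfolding cos_add cos_int_2pin sin_int_2pin by simp
    have "ellipse_point a b c d x (t - 2 * real (k n) * \<phi>) = ellipse_point a b c d x (t' - 2 * pi * e n)"
    proof -
      have "t' - 2 * pi * e n + 2 * pi * of_int m + \<phi> = (t' - 2 * pi * e n + \<phi>) + 2 * pi * of_int m" by simp
      thus ?thesis unfolding eq ellipse_point_def \<phi>_def[symmetric] per by (simp only: per)
    qed
    moreover have "(rot_yz b c ^^ k n) (x, y, z) \<in> G" using rot_yz_invariant assms(2,3) by blast
    ultimately show ?thesis unfolding t rot_yz_funpow_ellipse_point[OF assms(6)] \<phi>_def by simp
  qed
  have "(\<lambda>n. ellipse_point a b c d x (t' - 2 * pi * e n)) \<longlonglongrightarrow> ellipse_point a b c d x (t' - 2 * pi * 0)"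
    unfolding ellipse_point_def by (intro tendsto_intros e)
  from closed_sequentially[OF assms(1) mem this]
  have "ellipse_point a b c d x (t' - 2 * pi * 0) \<in> G" .
  thus ?thesis by (simp add: t')
qed

lemma countable_cyclotomic: "countable {x :: real. cyclotomic (complex_of_real x)}"
proof (rule countable_image_inj_on)
  have "{x. cyclotomic x} = (\<Union>n\<in>{0<..}. (\<lambda>\<mu>. \<mu> + inverse \<mu>) ` {\<mu>. \<mu> ^ n = 1})"
    by (auto simp: cyclotomic_def)
  moreover have "finite {\<mu> :: complex. \<mu> ^ n = 1}" if "n \<in> {0<..}" for n
    using that by (intro finite_roots_unity) auto
  ultimately have "countable {x. cyclotomic x}"
    by (simp only:) (rule countable_UN, simp, rule countable_image, rule countable_finite)
  thus "countable (complex_of_real ` {x. cyclotomic (complex_of_real x)})"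
    by (rule countable_subset[rotated]) auto
qed (auto simp: inj_on_def)

lemma non_cyclotomic_dense:
  fixes x e :: real
  assumes "e > 0"
  obtains x' where "\<bar>x' - x\<bar> < e" "\<not> cyclotomic (complex_of_real x')"
proof -
  have "uncountable {x - e<..<x + e}" using assms by (simp add: uncountable_open_interval)
  hence "\<not> {x - e<..<x + e} \<subseteq> {x. cyclotomic (complex_of_real x)}"
    using countable_cyclotomic countable_subset by blast
  then obtain x' where "x' \<in> {x - e<..<x + e}" "\<not> cyclotomic (complex_of_real x')" by blast
  thus thesis by (intro that[of x']) (auto simp: abs_less_iff)
qed

section \<open>Interior points of closed invariant sets\<close>

lemma dist_le_sum3: "dist (x, y, z) (x', y', z') \<le> \<bar>x - x'\<bar> + \<bar>y - y'\<bar> + \<bar>z - z'\<bar>"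
  for x y z x' y' z' :: real
proof -
  have "dist (x, y, z) (x', y', z') \<le> dist x x' + dist (y, z) (y', z')"
    using sqrt_sum_squares_le_sum[of "dist x x'" "dist (y, z) (y', z')"] by (simp add: dist_Pair_Pair)
  moreover have "dist (y, z) (y', z') \<le> dist y y' + dist z z'"
    using sqrt_sum_squares_le_sum[of "dist y y'" "dist z z'"] by (simp add: dist_Pair_Pair)
  ultimately show ?thesis by (simp add: dist_real_def)
qed

lemma abs_coordinate_le_dist:
  fixes x y z :: real
  shows "\<bar>x - x'\<bar> \<le> dist (x, y, z) (x', y', z')" "\<bar>y - y'\<bar> \<le> dist (x, y, z) (x', y', z')"
    "\<bar>z - z'\<bar> \<le> dist (x, y, z) (x', y', z')"
  using dist_fst_le[of "(x, y, z)" "(x', y', z')"] dist_snd_le[of "(x, y, z)" "(x', y', z')"]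
    dist_fst_le[of "(y, z)" "(y', z')"] dist_snd_le[of "(y, z)" "(y', z')"]
  by (auto simp: dist_real_def)

text \<open>Where \<open>\<partial>F/\<partial>z \<noteq> 0\<close> the surface is locally a graph over the \<open>(x, y)\<close>-plane.\<close>

lemma lift_nearby:
  assumes p: "(x, y, z) \<in> rsurf a b c d" "2 * z + x * y \<noteq> c" and "e > 0"
  obtains r where "r > 0" "\<And>x' y'. \<bar>x' - x\<bar> < r \<Longrightarrow> \<bar>y' - y\<bar> < r \<Longrightarrow> \<exists>z'. (x', y', z') \<in> rsurf a b c d \<and> \<bar>z' - z\<bar> < e"
proof -
  \<comment> \<open>The discriminant of the surface equation as a quadratic in \<open>z\<close>; the
    sign \<open>s\<close> selects the branch of the root through the given point.\<close>
  define disc where "disc q = (c - fst q * snd q)\<^sup>2 - 4 * ((fst q)\<^sup>2 + (snd q)\<^sup>2 - a * fst q - b * snd q - d)" for q :: "real \<times> real"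
  define s where "s = sgn (2 * z + x * y - c)"
  define zz where "zz q = (c - fst q * snd q + s * sqrt (disc q)) / 2" for q
  have s: "s\<^sup>2 = 1" using p(2) by (simp add: s_def sgn_if)
  have on: "(x', y', zz (x', y')) \<in> rsurf a b c d" if "disc (x', y') \<ge> 0" for x' y'
  proof -
    define w where "w = s * sqrt (disc (x', y'))"
    have w: "w * w = disc (x', y')" using that s by (simp add: w_def power2_eq_square mult.assoc mult.left_commute)
    have z: "zz (x', y') = (c - x' * y' + w) / 2" by (simp add: zz_def w_def)
    have "(zz (x', y'))\<^sup>2 + x' * y' * zz (x', y') - c * zz (x', y') = (w * w - (c - x' * y') * (c - x' * y')) / 4"
      unfolding z by (simp add: power2_eq_square field_simps)
    also have "\<dots> = - (x'\<^sup>2 + y'\<^sup>2 - a * x' - b * y' - d)"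
      unfolding w by (simp add: disc_def power2_eq_square)
    finally show ?thesis by simp
  qed
  have d: "disc (x, y) = (2 * z + x * y - c)\<^sup>2"
    using p(1) by (simp add: disc_def power2_eq_square algebra_simps)
  hence d0: "disc (x, y) > 0" using p(2) by simp
  have z: "zz (x, y) = z"
    
  proof -
    have "s * sqrt (disc (x, y)) = 2 * z + x * y - c"
      unfolding s_def d real_sqrt_abs by (rule sgn_mult_abs)
    thus ?thesis by (simp add: zz_def)
  qed
  have cont: "isCont disc (x, y)" "isCont zz (x, y)"
    unfolding disc_def zz_def by (auto intro!: continuous_intros)
  have "\<forall>\<^sub>F q in at (x, y). disc q > 0 \<and> dist (zz q) z < e"
    using order_tendstoD(1)[OF cont(1)[unfolded isCont_def] d0] tendstoD[OF cont(2)[unfolded isCont_def] \<open>e > 0\<close>]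
    unfolding z by (rule eventually_conj)
  then obtain r where r: "r > 0" "\<And>q. q \<noteq> (x, y) \<Longrightarrow> dist q (x, y) < r \<Longrightarrow> disc q > 0 \<and> dist (zz q) z < e"
    unfolding eventually_at by blast
  show thesis
  proof (rule that[of "r / 2"])
    fix x' y' assume "\<bar>x' - x\<bar> < r / 2" "\<bar>y' - y\<bar> < r / 2"
    moreover have "dist (x', y') (x, y) \<le> \<bar>x' - x\<bar> + \<bar>y' - y\<bar>"
      using sqrt_sum_squares_le_sum[of "dist x' x" "dist y' y"] by (simp add: dist_Pair_Pair dist_real_def)
    ultimately have "dist (x', y') (x, y) < r" by linarith
    hence "disc (x', y') > 0 \<and> dist (zz (x', y')) z < e"
      using r(2)[of "(x', y')"] d0 z \<open>e > 0\<close> by (cases "(x', y') = (x, y)") auto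
    thus "\<exists>z'. (x', y', z') \<in> rsurf a b c d \<and> \<bar>z' - z\<bar> < e"
      using on[of x' y'] by (intro exI[of _ "zz (x', y')"]) (auto simp: dist_real_def)
  qed (use r in simp)
qed

text \<open>Off the centres one of the derivatives in \<open>y\<close> and \<open>z\<close> is
  nonzero, and solving for that coordinate leaves \<open>x\<close> free to move.\<close>

lemma move_nearby_x:
  assumes p: "(x, y, z) \<in> rsurf a b c d" "\<not> centre b c (x, y, z)" and "e > 0"
  obtains r where "r > 0" "\<And>x'. \<bar>x' - x\<bar> < r \<Longrightarrow> \<exists>y' z'. (x', y', z') \<in> rsurf a b c d \<and> dist (x', y', z') (x, y, z) < e"
proof (cases "2 * z + x * y = c")
  case False
  then obtain r where r: "r > 0" "\<And>x' y'. \<bar>x' - x\<bar> < r \<Longrightarrow> \<bar>y' - y\<bar> < r \<Longrightarrow> \<exists>z'. (x', y', z') \<in> rsurf a b c d \<and> \<bar>z' - z\<bar> < e / 2"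
    using lift_nearby[of x y z a b c d "e / 2"] p(1) \<open>e > 0\<close> by auto
  show thesis
  proof (rule that[of "min r (e / 2)"])
    fix x' assume x': "\<bar>x' - x\<bar> < min r (e / 2)"
    then obtain z' where "(x', y, z') \<in> rsurf a b c d" "\<bar>z' - z\<bar> < e / 2" using r(1) r(2)[of x' y] by auto
    moreover from this x' have "dist (x', y, z') (x, y, z) < e" using dist_le_sum3[of x' y z' x y z] by simp
    ultimately show "\<exists>y' z'. (x', y', z') \<in> rsurf a b c d \<and> dist (x', y', z') (x, y, z) < e" by blast
  qed (use r \<open>e > 0\<close> in simp)
next
  case True
  hence "2 * y + x * z \<noteq> b" using p(2) by simp
  moreover have "(x, z, y) \<in> rsurf a c b d" using p(1) by (simp add: algebra_simps)
  ultimately obtain r where r: "r > 0" "\<And>x' z'. \<bar>x' - x\<bar> < r \<Longrightarrow> \<bar>z' - z\<bar> < r \<Longrightarrow> \<exists>y'. (x', z', y') \<in> rsurf a c b d \<and> \<bar>y' - y\<bar> < e / 2"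
    using lift_nearby[of x z y a c b d "e / 2"] \<open>e > 0\<close> by auto
  show thesis
  proof (rule that[of "min r (e / 2)"])
    fix x' assume x': "\<bar>x' - x\<bar> < min r (e / 2)"
    then obtain y' where "(x', z, y') \<in> rsurf a c b d" "\<bar>y' - y\<bar> < e / 2" using r(1) r(2)[of x' z] by auto
    moreover from this x' have "dist (x', y', z) (x, y, z) < e" using dist_le_sum3[of x' y' z x y z] by simp
    ultimately show "\<exists>y' z'. (x', y', z') \<in> rsurf a b c d \<and> dist (x', y', z') (x, y, z) < e"
      by (intro exI[of _ y'] exI[of _ z]) (auto simp: algebra_simps)
  qed (use r \<open>e > 0\<close> in simp)
qed

definition interior_in :: "(real \<times> real \<times> real) set \<Rightarrow> (real \<times> real \<times> real) set \<Rightarrow> (real \<times> real \<times> real) set"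
  where "interior_in S G = {p \<in> S. \<exists>r>0. ball p r \<inter> S \<subseteq> G}"

lemma interior_in_isometry:
  assumes d: "\<And>p q. dist (f p) (f q) = dist p q"
  shows "f ` interior_in S G = interior_in (f ` S) (f ` G)"
proof -
  have inj: "inj f" using d by (metis dist_eq_0_iff injI)
  have eq: "ball (f p) r \<inter> f ` S = f ` (ball p r \<inter> S)" for p r
  proof -
    have "ball (f p) r \<inter> f ` S = f ` {q \<in> S. f q \<in> ball (f p) r}"
      using Compr_image_eq[of f S "\<lambda>q. q \<in> ball (f p) r"] by (simp only: Collect_conj_eq Collect_mem_eq Int_commute)
    also have "{q \<in> S. f q \<in> ball (f p) r} = ball p r \<inter> S" unfolding mem_ball d by auto
    finally show ?thesis .
  qed
  have *: "(\<exists>r>0. ball (f p) r \<inter> f ` S \<subseteq> f ` G) \<longleftrightarrow> (\<exists>r>0. ball p r \<inter> S \<subseteq> G)" for p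
    unfolding eq inj_image_subset_iff[OF inj] by (rule refl)
  have "f ` {p \<in> S. \<exists>r>0. ball p r \<inter> S \<subseteq> G} = f ` {p \<in> S. \<exists>r>0. ball (f p) r \<inter> f ` S \<subseteq> f ` G}"
    by (simp only: *)
  also have "\<dots> = {q \<in> f ` S. \<exists>r>0. ball q r \<inter> f ` S \<subseteq> f ` G}" by (rule Compr_image_eq[symmetric])
  finally show ?thesis by (simp only: interior_in_def)
qed

lemma dist_cyc: "dist (cyc p) (cyc q) = dist p q" for p q :: "real \<times> real \<times> real"
  by (cases p; cases q) (simp add: dist_Pair_Pair algebra_simps)

lemma dist_swap_yz: "dist (swap_yz p) (swap_yz q) = dist p q" for p q :: "real \<times> real \<times> real"
  by (cases p; cases q) (simp add: dist_Pair_Pair algebra_simps)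

lemmas interior_in_cyc = interior_in_isometry[of cyc, OF dist_cyc]
lemmas interior_in_swap = interior_in_isometry[of swap_yz, OF dist_swap_yz]

lemma cyc_closed: "closed G \<Longrightarrow> closed (cyc ` G)" for G :: "(real \<times> real \<times> real) set"
proof -
  assume "closed G"
  have "cyc ` G = (\<lambda>p. (snd (snd p), fst p, fst (snd p))) -` G" by (auto simp: set_eq_iff)
  also have "closed \<dots>" using \<open>closed G\<close> by (intro closed_vimage continuous_intros)
  finally show ?thesis .
qed

lemma swap_yz_closed: "closed G \<Longrightarrow> closed (swap_yz ` G)" for G :: "(real \<times> real \<times> real) set"
proof -
  assume "closed G"
  have "swap_yz ` G = (\<lambda>p. (fst p, snd (snd p), fst (snd p))) -` G" by (auto simp: set_eq_iff)
  also have "closed \<dots>" using \<open>closed G\<close> by (intro closed_vimage continuous_intros)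
  finally show ?thesis .
qed

section \<open>Real triples inside complex triples\<close>

definition cpoint :: "real \<times> real \<times> real \<Rightarrow> complex \<times> complex \<times> complex"
  where "cpoint = (\<lambda>(x, y, z). (complex_of_real x, complex_of_real y, complex_of_real z))"

definition rpoint :: "complex \<times> complex \<times> complex \<Rightarrow> real \<times> real \<times> real"
  where "rpoint = (\<lambda>(x, y, z). (Re x, Re y, Re z))"

lemma cpoint_simp [simp]: "cpoint (x, y, z) = (complex_of_real x, complex_of_real y, complex_of_real z)"
  by (simp add: cpoint_def)

lemma rpoint_cpoint [simp]: "rpoint (cpoint p) = p"
  by (cases p) (simp add: rpoint_def)

lemma continuous_on_cpoint: "continuous_on V cpoint"
  unfolding cpoint_def case_prod_beta by (intro continuous_intros)

lemma continuous_on_rpoint: "continuous_on V rpoint"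
  unfolding rpoint_def case_prod_beta by (intro continuous_intros)

lemma inj_cpoint: "inj cpoint"
  by (metis injI rpoint_cpoint)

lemma norm_cpoint: "norm (cpoint p) = norm p"
  by (cases p) (simp add: norm_Pair)

lemma bounded_cpoint_iff: "bounded (cpoint ` V) \<longleftrightarrow> bounded V"
  by (simp add: bounded_iff norm_cpoint)

lemma of_real_gradient_eq:
  "2 * complex_of_real x + of_real y * of_real z = of_real a \<longleftrightarrow> 2 * x + y * z = a"
proof -
  have "2 * complex_of_real x + of_real y * of_real z = of_real (2 * x + y * z)" by simp
  thus ?thesis by (simp only: of_real_eq_iff)
qed

lemma invariant_under_cpoint:
  "invariant_under (complex_of_real a) (of_real b) (of_real c) (cpoint ` V) \<longleftrightarrow> invariant_under a b c V"
proof -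
  have mem: "(complex_of_real x, complex_of_real y, complex_of_real z) \<in> cpoint ` V \<longleftrightarrow> (x, y, z) \<in> V" for x y z
    using inj_image_mem_iff[OF inj_cpoint, of "(x, y, z)" V] by simp
  show ?thesis
  proof
    assume L: "invariant_under (complex_of_real a) (of_real b) (of_real c) (cpoint ` V)"
    show "invariant_under a b c V" unfolding invariant_under_def
    proof (intro allI impI)
      fix x y z assume "(x, y, z) \<in> V"
      hence "(complex_of_real x, complex_of_real y, complex_of_real z) \<in> cpoint ` V" using mem by blast
      with L have "(complex_of_real (a - x - y * z), complex_of_real y, complex_of_real z) \<in> cpoint ` V \<and>
        (complex_of_real x, complex_of_real (b - y - x * z), complex_of_real z) \<in> cpoint ` V \<and>
        (complex_of_real x, complex_of_real y, complex_of_real (c - z - x * y)) \<in> cpoint ` V"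
        unfolding invariant_under_def by (simp del: cpoint_simp)
      thus "(a - x - y * z, y, z) \<in> V \<and> (x, b - y - x * z, z) \<in> V \<and> (x, y, c - z - x * y) \<in> V"
        unfolding mem .
    qed
  next
    assume R: "invariant_under a b c V"
    show "invariant_under (complex_of_real a) (of_real b) (of_real c) (cpoint ` V)" unfolding invariant_under_def
    proof (intro allI impI)
      fix u v w assume "(u, v, w) \<in> cpoint ` V"
      then obtain x y z where p: "(x, y, z) \<in> V" "u = of_real x" "v = of_real y" "w = of_real z" by auto
      have "(complex_of_real (a - x - y * z), complex_of_real y, complex_of_real z) \<in> cpoint ` V \<and>
        (complex_of_real x, complex_of_real (b - y - x * z), complex_of_real z) \<in> cpoint ` V \<and>
        (complex_of_real x, complex_of_real y, complex_of_real (c - z - x * y)) \<in> cpoint ` V"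
        unfolding mem using R p(1) unfolding invariant_under_def by blast
      thus "(of_real a - u - v * w, v, w) \<in> cpoint ` V \<and> (u, of_real b - v - u * w, w) \<in> cpoint ` V \<and> (u, v, of_real c - w - u * v) \<in> cpoint ` V"
        unfolding p by simp
    qed
  qed
qed

lemma centre_of_real:
  "centre (complex_of_real b) (of_real c) (of_real x, of_real y, of_real z) \<longleftrightarrow> centre b c (x, y, z)"
  unfolding centre_simp of_real_gradient_eq ..

lemma real_bounded_invariant_coordinate:
  fixes x :: real
  assumes "bounded G" "invariant_under a b c G" "(x, y, z) \<in> G" "\<not> centre b c (x, y, z)"
  shows "\<bar>x\<bar> < 2"
proof -
  have "(complex_of_real x, complex_of_real y, complex_of_real z) \<in> cpoint ` G"
    using imageI[OF assms(3), of cpoint] by simp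
  thus ?thesis
    using bounded_invariant_coordinate[of "cpoint ` G" "complex_of_real a" "of_real b" "of_real c" "of_real x" "of_real y" "of_real z"]
      assms by (simp only: bounded_cpoint_iff invariant_under_cpoint centre_of_real) simp
qed

text \<open>If a whole ellipse lies in \<open>G\<close>, its \<open>y\<close>-coordinates sweep out an interval, and rotating about
  the other axis turns it into a neighbourhood.\<close>

lemma ellipse_thickens_z:
  assumes G: "closed G" "bounded G" "invariant_under a b c G"
    and p: "(x, y, z) \<in> rsurf a b c d" "2 * z + x * y \<noteq> c"
    and fibre: "\<And>y z. (x, y, z) \<in> rsurf a b c d \<Longrightarrow> (x, y, z) \<in> G"
  shows "(x, y, z) \<in> interior_in (rsurf a b c d) G"
proof -
  have "\<not> centre c a (y, z, x)" using p(2) by (auto simp: algebra_simps)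
  hence y2: "\<bar>y\<bar> < 2"
    using real_bounded_invariant_coordinate[of "cyc ` G" b c a y z x] fibre[OF p(1)] G(2,3)
    by (simp add: bounded_cyc invariant_under_cyc)
  obtain r where r: "r > 0" "\<And>x' y'. \<bar>x' - x\<bar> < r \<Longrightarrow> \<bar>y' - y\<bar> < r \<Longrightarrow> \<exists>z'. (x', y', z') \<in> rsurf a b c d \<and> \<bar>z' - z\<bar> < 1"
    using lift_nearby[OF p zero_less_one] by blast
  define F where "F q = 2 * snd (snd q) + fst q * fst (snd q) - c" for q :: "real \<times> real \<times> real"
  have "isCont F (x, y, z)" unfolding F_def by (intro continuous_intros)
  moreover have "F (x, y, z) \<noteq> 0" using p(2) by (simp add: F_def)
  ultimately obtain r' where r': "r' > 0" "\<And>q. dist q (x, y, z) < r' \<Longrightarrow> F q \<noteq> 0"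
    using continuous_at_avoid[of "(x, y, z)" F 0] by (auto simp: dist_commute)
  \<comment> \<open>Within \<open>R\<close> three things persist: the fibre over \<open>x\<close>
    has a point for every nearby \<open>y\<close>, the derivative in \<open>z\<close> stays nonzero,
    and the \<open>y\<close>-coordinate stays in the strip.\<close>
  define R where "R = Min {r, r', 2 - \<bar>y\<bar>}"
  have R: "R > 0" "R \<le> r" "R \<le> r'" "R \<le> 2 - \<bar>y\<bar>" using r(1) r'(1) y2 by (auto simp: R_def)
  have "q \<in> G" if q: "q \<in> rsurf a b c d" "dist q (x, y, z) < R" for q
  proof -
    obtain u v w where uvw: "q = (u, v, w)" by (cases q) auto
    have v: "\<bar>v - y\<bar> < R" using abs_coordinate_le_dist(2)[of v y u w x z] q(2) by (simp add: uvw)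
    have Fq: "2 * w + u * v \<noteq> c" using r'(2)[of q] q(2) R by (simp add: F_def uvw)
    have "\<exists>q'\<in>G. dist q' q < e" if "e > 0" for e
    proof -
      obtain r2 where r2: "r2 > 0" "\<And>x' y'. \<bar>x' - u\<bar> < r2 \<Longrightarrow> \<bar>y' - v\<bar> < r2 \<Longrightarrow> \<exists>z'. (x', y', z') \<in> rsurf a b c d \<and> \<bar>z' - w\<bar> < e / 2"
        using lift_nearby[of u v w a b c d "e / 2"] q(1) Fq \<open>e > 0\<close> by (auto simp: uvw)
      define e' where "e' = min (e / 2) (min r2 (R - \<bar>v - y\<bar>))"
      have e': "e' > 0" "e' \<le> r2" "e' \<le> e / 2" "e' \<le> R - \<bar>v - y\<bar>" using r2(1) v \<open>e > 0\<close> by (auto simp: e'_def min_def)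
      \<comment> \<open>A non-cyclotomic \<open>y\<close>-coordinate close to that of
        \<open>q\<close>. The conic of constant \<open>y\<close> over it meets the fibre over
        \<open>x\<close>, which lies in \<open>G\<close>, so all of that conic lies in
        \<open>G\<close>, including a point near \<open>q\<close>.\<close>
      obtain v' where v': "\<bar>v' - v\<bar> < e'" "\<not> cyclotomic (complex_of_real v')"
        using non_cyclotomic_dense[OF e'(1)] by blast
      obtain w' where w': "(u, v', w') \<in> rsurf a b c d" "\<bar>w' - w\<bar> < e / 2"
        using r2(2)[of u v'] r2(1) v'(1) e' by auto
      have v'y: "\<bar>v' - y\<bar> < R" using v'(1) e'(4) by linarith
      obtain z' where z': "(x, v', z') \<in> rsurf a b c d" using r(2)[of x v'] r(1) v'y R by auto
      have "(v', w', u) \<in> cyc ` G"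
      proof (rule conic_orbit_dense)
        show "closed (cyc ` G)" using G(1) by (rule cyc_closed)
        show "invariant_under b c a (cyc ` G)" using G(3) by (rule invariant_under_cyc)
        show "(v', z', x) \<in> cyc ` G" using fibre[OF z'] by simp
        show "(v', z', x) \<in> rsurf b c a d" "(v', w', u) \<in> rsurf b c a d"
          using z' w'(1) by (simp_all add: algebra_simps)
        show "\<bar>v'\<bar> < 2" using v'y R(4) by linarith
      qed (rule v'(2))
      hence "(u, v', w') \<in> G" by simp
      moreover have "dist (u, v', w') q < e"
        using dist_le_sum3[of u v' w' u v w] v'(1) e'(3) w'(2) by (simp add: uvw)
      ultimately show ?thesis by blast
    qed
    hence "q \<in> closure G" by (simp add: closure_approachable)
    thus ?thesis using G(1) by simp
  qed
  thus ?thesis using R(1) p(1) unfolding interior_in_def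
    by (auto simp: dist_commute intro!: exI[of _ R] simp del: in_rsurf)
qed

lemma ellipse_thickens:
  assumes G: "closed G" "bounded G" "invariant_under a b c G"
    and p: "(x, y, z) \<in> rsurf a b c d" "\<not> centre b c (x, y, z)"
    and fibre: "\<And>y z. (x, y, z) \<in> rsurf a b c d \<Longrightarrow> (x, y, z) \<in> G"
  shows "(x, y, z) \<in> interior_in (rsurf a b c d) G"
proof (cases "2 * z + x * y = c")
  case False
  thus ?thesis using ellipse_thickens_z[OF G p(1)] fibre by blast
next
  case True
  hence "2 * y + x * z \<noteq> b" using p(2) by simp
  moreover have "(x, z, y) \<in> rsurf a c b d" using p(1) by (simp add: algebra_simps)
  moreover have "(x, z, y) \<in> swap_yz ` G" if "(x, z, y) \<in> rsurf a c b d" for y z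
    using fibre[of y z] that by (simp add: algebra_simps)
  ultimately have "(x, z, y) \<in> interior_in (rsurf a c b d) (swap_yz ` G)"
    by (intro ellipse_thickens_z swap_yz_closed bounded_swap_yz invariant_under_swap G)
  hence "(x, z, y) \<in> swap_yz ` interior_in (rsurf a b c d) G"
    by (simp only: interior_in_swap swap_rsurf)
  thus ?thesis by simp
qed

text \<open>One interior point close to \<open>(x, y, z)\<close> provides points of \<open>G\<close>
  over a whole interval of first coordinates. The conics over its non-cyclotomic values then lie in
  \<open>G\<close>, and values close to \<open>x\<close> give points of \<open>G\<close> arbitrarily
  near every point of the fibre over \<open>x\<close>.\<close>

lemma interior_limit_ellipse:
  assumes G: "closed G" "bounded G" "invariant_under a b c G"
    and q: "(x, y, z) \<in> rsurf a b c d" "\<not> centre b c (x, y, z)"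
      "(x, y, z) \<in> closure (interior_in (rsurf a b c d) G)"
    and p: "(x, y', z') \<in> rsurf a b c d"
  shows "(x, y', z') \<in> G"
proof -
  let ?S = "rsurf a b c d" and ?U = "interior_in (rsurf a b c d) G"
  have UG: "?U \<subseteq> G" by (auto simp: interior_in_def)
  hence "(x, y, z) \<in> G" using q(3) G(1) closure_minimal by blast
  hence x2: "\<bar>x\<bar> < 2" using real_bounded_invariant_coordinate[OF G(2,3)] q(2) by blast
  have p': "\<not> centre b c (x, y', z')"
    using fibre_poly_nonneg(2)[OF q(1) x2] fibre_poly_nonneg(2)[OF p x2] q(2) by blast
  have "\<exists>p'\<in>G. dist p' (x, y', z') < e" if "e > 0" for e
  proof -
    obtain r where r: "r > 0" "\<And>x'. \<bar>x' - x\<bar> < r \<Longrightarrow> \<exists>y'' z''. (x', y'', z'') \<in> ?S \<and> dist (x', y'', z'') (x, y', z') < e"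
      using move_nearby_x[OF p p' \<open>e > 0\<close>] by blast
    define F where "F q = \<bar>2 * fst (snd q) + fst q * snd (snd q) - b\<bar> + \<bar>2 * snd (snd q) + fst q * fst (snd q) - c\<bar>" for q :: "real \<times> real \<times> real"
    have "isCont F (x, y, z)" unfolding F_def by (intro continuous_intros)
    moreover have "F (x, y, z) \<noteq> 0" using q(2) by (auto simp: F_def)
    ultimately obtain r1 where r1: "r1 > 0" "\<And>q. dist q (x, y, z) < r1 \<Longrightarrow> F q \<noteq> 0"
      using continuous_at_avoid[of "(x, y, z)" F 0] by (auto simp: dist_commute)
    define R where "R = Min {r, r1, 2 - \<bar>x\<bar>}"
    have R: "R > 0" "R \<le> r" "R \<le> r1" "R \<le> 2 - \<bar>x\<bar>" using r(1) r1(1) x2 by (auto simp: R_def)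
    obtain q' where q': "q' \<in> ?U" "dist q' (x, y, z) < R"
      using q(3) R(1) unfolding closure_approachable by blast
    obtain u v w where uvw: "q' = (u, v, w)" by (cases q') auto
    have q'S: "(u, v, w) \<in> ?S" using q'(1) by (simp add: interior_in_def uvw del: in_rsurf)
    have q'c: "\<not> centre b c (u, v, w)" using r1(2)[of q'] q'(2) R(3) by (auto simp: F_def uvw)
    obtain r2 where r2: "r2 > 0" "ball (u, v, w) r2 \<inter> ?S \<subseteq> G"
      using q'(1) by (auto simp: interior_in_def uvw simp del: in_rsurf)
    obtain r3 where r3: "r3 > 0" "\<And>x'. \<bar>x' - u\<bar> < r3 \<Longrightarrow> \<exists>y'' z''. (x', y'', z'') \<in> ?S \<and> dist (x', y'', z'') (u, v, w) < r2"
      using move_nearby_x[OF q'S q'c r2(1)] by blast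
    have ux: "\<bar>u - x\<bar> < R" using abs_coordinate_le_dist(1)[of u x v w y z] q'(2) by (simp add: uvw)
    obtain x' where x': "\<bar>x' - u\<bar> < min r3 (R - \<bar>u - x\<bar>)" "\<not> cyclotomic (complex_of_real x')"
      using non_cyclotomic_dense[of "min r3 (R - \<bar>u - x\<bar>)" u] r3(1) ux by auto
    obtain v1 w1 where 1: "(x', v1, w1) \<in> ?S" "dist (x', v1, w1) (u, v, w) < r2"
      using r3(2)[of x'] x'(1) by auto
    have x'x: "\<bar>x' - x\<bar> < R" using x'(1) by linarith
    obtain v2 w2 where 2: "(x', v2, w2) \<in> ?S" "dist (x', v2, w2) (x, y', z') < e"
      using r(2)[of x'] x'x R(2) by auto
    have "(x', v2, w2) \<in> G"
    proof (rule conic_orbit_dense[OF G(1,3) _ 1(1) 2(1)])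
      show "(x', v1, w1) \<in> G" using 1 r2(2) by (auto simp: dist_commute simp del: in_rsurf)
      show "\<bar>x'\<bar> < 2" using x'x R(4) by linarith
    qed (rule x'(2))
    with 2(2) show ?thesis by blast
  qed
  hence "(x, y', z') \<in> closure G" by (simp add: closure_approachable)
  thus ?thesis using G(1) by simp
qed

definition rsmooth :: "real \<Rightarrow> real \<Rightarrow> real \<Rightarrow> real \<Rightarrow> (real \<times> real \<times> real) set"
  where "rsmooth a b c d = {(x, y, z) \<in> rsurf a b c d. 2 * x + y * z \<noteq> a \<or> 2 * y + x * z \<noteq> b \<or> 2 * z + x * y \<noteq> c}"

lemma in_rsmooth: "(x, y, z) \<in> rsmooth a b c d \<longleftrightarrow> (x, y, z) \<in> rsurf a b c d \<and>
    (2 * x + y * z \<noteq> a \<or> 2 * y + x * z \<noteq> b \<or> 2 * z + x * y \<noteq> c)"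
  by (simp add: rsmooth_def)

lemma cyc_rsmooth: "cyc ` rsmooth a b c d = rsmooth b c a d"
  by (auto simp: set_eq_iff in_rsmooth algebra_simps)

text \<open>Two of the three cyclic views already involve all three partial derivatives, so two
  cases suffice at a smooth point.\<close>

lemma rsmooth_noncentre: "(x, y, z) \<in> rsmooth a b c d \<Longrightarrow> \<not> centre b c (x, y, z) \<or> \<not> centre c a (y, z, x)"
  by (auto simp: in_rsmooth algebra_simps)

text \<open>At a smooth point the first or, after \<open>cyc\<close>, the second coordinate is
  noncentral. The limit argument puts its whole fibre into \<open>G\<close>, and thickening that
  fibre makes the point interior again.\<close>

theorem interior_closed_in_smooth:
  assumes G: "closed G" "bounded G" "invariant_under a b c G"
    and q: "q \<in> rsmooth a b c d" "q \<in> closure (interior_in (rsurf a b c d) G)"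
  shows "q \<in> interior_in (rsurf a b c d) G"
proof -
  obtain x y z where xyz: "q = (x, y, z)" by (cases q) auto
  have S: "(x, y, z) \<in> rsurf a b c d" using q(1) by (simp add: in_rsmooth xyz)
  show ?thesis
  proof (cases "centre b c (x, y, z)")
    case False
    show ?thesis unfolding xyz
      using G S False interior_limit_ellipse[OF G S False] q(2) by (intro ellipse_thickens) (simp_all add: xyz del: in_rsurf)
  next
    case True
    hence nc: "\<not> centre c a (y, z, x)" using rsmooth_noncentre q(1) xyz by blast
    have G': "closed (cyc ` G)" "bounded (cyc ` G)" "invariant_under b c a (cyc ` G)"
      using G by (auto intro: cyc_closed bounded_cyc invariant_under_cyc)
    have S': "(y, z, x) \<in> rsurf b c a d" using S by (simp add: algebra_simps)
    have cont: "continuous_on UNIV (cyc :: real \<times> real \<times> real \<Rightarrow> _)"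
      unfolding cyc_def case_prod_beta by (intro continuous_intros)
    have "cyc q \<in> cyc ` closure (interior_in (rsurf a b c d) G)" using q(2) by simp
    also have "\<dots> \<subseteq> closure (cyc ` interior_in (rsurf a b c d) G)"
      using cont by (rule image_closure_subset[OF continuous_on_subset[OF _ subset_UNIV] closed_closure closure_subset])
    also have "\<dots> = closure (interior_in (rsurf b c a d) (cyc ` G))"
      by (simp only: interior_in_cyc cyc_rsurf)
    finally have q': "(y, z, x) \<in> closure (interior_in (rsurf b c a d) (cyc ` G))" by (simp add: xyz)
    have "(y, z, x) \<in> interior_in (rsurf b c a d) (cyc ` G)"
      using interior_limit_ellipse[OF G' S' nc q'] by (intro ellipse_thickens[OF G' S' nc]) blast
    hence "cyc q \<in> cyc ` interior_in (rsurf a b c d) G" by (simp add: xyz interior_in_cyc cyc_rsurf)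
    thus ?thesis by (simp add: inj_image_mem_iff[OF inj_cyc])
  qed
qed

section \<open>Bounded components of the smooth part\<close>

lemma continuous_on_ellipse_point:
  assumes "J \<subseteq> {- 2<..<2}"
  shows "continuous_on (J \<times> UNIV) (\<lambda>(x, t). ellipse_point a b c d x t)"
proof -
  have nz: "4 - x\<^sup>2 \<noteq> 0" if "x \<in> J" for x
    using four_minus_square_pos[of x] that assms by (auto simp: abs_less_iff)
  have ac: "- 1 \<le> x / 2" "x / 2 \<le> 1" if "x \<in> J" for x using that assms by auto
  show ?thesis
    unfolding ellipse_point_def y_centre_def ellipse_radius_def fibre_poly_def case_prod_beta
    by (intro continuous_intros) (use nz ac in auto)
qed

lemma band_connected:
  assumes "connected J" "J \<subseteq> {- 2<..<2}" "\<And>x. x \<in> J \<Longrightarrow> fibre_poly a b c d x > 0"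
  shows "connected {(x, y, z) \<in> rsurf a b c d. x \<in> J}"
    and "{(x, y, z) \<in> rsurf a b c d. x \<in> J} \<subseteq> rsmooth a b c d"
proof -
  have x2: "\<bar>x\<bar> < 2" if "x \<in> J" for x using that assms(2) by (auto simp: abs_less_iff)
  have "{(x, y, z) \<in> rsurf a b c d. x \<in> J} = (\<lambda>(x, t). ellipse_point a b c d x t) ` (J \<times> UNIV)"
  proof (intro subset_antisym subsetI)
    fix p assume "p \<in> {(x, y, z) \<in> rsurf a b c d. x \<in> J}"
    then obtain x y z where p: "p = (x, y, z)" "(x, y, z) \<in> rsurf a b c d" "x \<in> J" by blast
    then obtain t where "p = ellipse_point a b c d x t" using ellipse_point_exists x2 by blast
    thus "p \<in> (\<lambda>(x, t). ellipse_point a b c d x t) ` (J \<times> UNIV)" using p(3) by force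
  next
    fix p assume "p \<in> (\<lambda>(x, t). ellipse_point a b c d x t) ` (J \<times> UNIV)"
    then obtain x t where p: "p = ellipse_point a b c d x t" "x \<in> J" by auto
    hence "p \<in> rsurf a b c d" using ellipse_point_in_rsurf x2 assms(3) less_imp_le by blast
    thus "p \<in> {(x, y, z) \<in> rsurf a b c d. x \<in> J}" using p unfolding ellipse_point_def by blast
  qed
  moreover have "connected (J \<times> (UNIV :: real set))" using assms(1) by (intro connected_Times) auto
  ultimately show "connected {(x, y, z) \<in> rsurf a b c d. x \<in> J}"
    using connected_continuous_image[OF continuous_on_ellipse_point[OF assms(2)]] by (simp only:)
  show "{(x, y, z) \<in> rsurf a b c d. x \<in> J} \<subseteq> rsmooth a b c d"
    using fibre_poly_nonneg(2) x2 assms(3) by (fastforce simp: in_rsmooth)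
qed

section \<open>Location of the roots of the fibre quartic\<close>

lemma fibre_poly_at_2: "fibre_poly a b c d 2 = (b - c)\<^sup>2" "fibre_poly a b c d (- 2) = (b + c)\<^sup>2"
  by (simp_all add: fibre_poly_def power2_eq_square algebra_simps)

lemma endpoint_nonneg:
  fixes f :: "real \<Rightarrow> real"
  assumes "u < v" "continuous_on {u..v} f" "\<And>t. u < t \<Longrightarrow> t < v \<Longrightarrow> f t \<ge> 0"
  shows "f u \<ge> 0" "f v \<ge> 0"
proof -
  have cl: "closure {u<..<v} = {u..v}" using assms(1) by simp
  have "f t \<ge> 0" if "t \<in> {u..v}" for t
    using continuous_ge_on_closure[of "{u<..<v}" f t 0] assms that unfolding cl by simp
  thus "f u \<ge> 0" "f v \<ge> 0" using assms(1) by auto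
qed

lemma quartic_divide:
  assumes "fibre_poly a b c d u = 0" "fibre_poly a b c d v = 0" "u \<noteq> v"
  obtains e f where "\<And>t. fibre_poly a b c d t = (t - u) * (t - v) * (t\<^sup>2 + e * t + f)"
proof -
  \<comment> \<open>The coefficients come from long division by \<open>(t - u) * (t - v)\<close>;
    \<open>\<alpha>\<close> and \<open>\<beta>\<close> form the linear remainder, which has two
    distinct zeros.\<close>
  define e where "e = u + v - a"
  define f where "f = (u + v) * e - u * v - d - 4"
  define \<alpha> \<beta> where "\<alpha> = 4 * a - b * c - u * v * e + (u + v) * f" and "\<beta> = 4 * d + b\<^sup>2 + c\<^sup>2 - u * v * f"
  have rem: "fibre_poly a b c d t = (t - u) * (t - v) * (t\<^sup>2 + e * t + f) + (\<alpha> * t + \<beta>)" for t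
    unfolding fibre_poly_def \<alpha>_def \<beta>_def f_def e_def by (simp add: power2_eq_square algebra_simps)
  have "\<alpha> * u + \<beta> = 0" "\<alpha> * v + \<beta> = 0" using rem[of u] rem[of v] assms by simp_all
  moreover have "\<alpha> * (u - v) = (\<alpha> * u + \<beta>) - (\<alpha> * v + \<beta>)" by (simp add: algebra_simps)
  ultimately have "\<alpha> * (u - v) = 0" by simp
  hence "\<alpha> = 0" "\<beta> = 0" using assms(3) \<open>\<alpha> * u + \<beta> = 0\<close> by simp_all
  with rem show thesis by (intro that[of e f]) simp
qed

lemma quadratic_roots:
  fixes e f t0 :: real
  assumes "t0\<^sup>2 + e * t0 + f < 0"
  obtains r s where "\<And>t. t\<^sup>2 + e * t + f = (t - r) * (t - s)" "r < s"
proof -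
  define D where "D = sqrt (e\<^sup>2 - 4 * f)"
  define q where "q = t0\<^sup>2 + e * t0 + f"
  have "(2 * t0 + e)\<^sup>2 = 4 * q + (e\<^sup>2 - 4 * f)" by (simp add: q_def power2_eq_square algebra_simps)
  hence "4 * q + (e\<^sup>2 - 4 * f) \<ge> 0" using zero_le_power2[of "2 * t0 + e"] by (simp only:)
  hence "e\<^sup>2 - 4 * f > 0" using assms unfolding q_def[symmetric] by linarith
  hence D: "D > 0" "D * D = e\<^sup>2 - 4 * f" by (simp_all add: D_def)
  have "(t - (- e - D) / 2) * (t - (- e + D) / 2) = t\<^sup>2 + e * t + (e\<^sup>2 - D * D) / 4" for t
    by (simp add: power2_eq_square field_simps)
  hence "t\<^sup>2 + e * t + f = (t - (- e - D) / 2) * (t - (- e + D) / 2)" for t unfolding D by simp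
  thus thesis using D(1) by (intro that[of "(- e - D) / 2" "(- e + D) / 2"]) auto
qed

text \<open>Only the middle inequality is strict: the fibres over \<open>(r2, r3)\<close> are
  nondegenerate ellipses, while an outer root may coincide with its inner neighbour or with an end
  of the strip.\<close>

definition four_roots :: "real \<Rightarrow> real \<Rightarrow> real \<Rightarrow> real \<Rightarrow> real \<Rightarrow> real \<Rightarrow> real \<Rightarrow> real \<Rightarrow> bool"
  where "four_roots a b c d r1 r2 r3 r4 \<longleftrightarrow> - 2 \<le> r1 \<and> r1 \<le> r2 \<and> r2 < r3 \<and> r3 \<le> r4 \<and> r4 \<le> 2 \<and>
    (\<forall>t. fibre_poly a b c d t = (t - r1) * (t - r2) * (t - r3) * (t - r4))"

lemma four_roots_pos:
  assumes "four_roots a b c d r1 r2 r3 r4" "r2 < t" "t < r3"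
  shows "fibre_poly a b c d t > 0"
proof -
  have "(t - r1) * (t - r2) > 0" "(r3 - t) * (r4 - t) > 0"
    using assms unfolding four_roots_def by (auto intro!: mult_pos_pos)
  hence "(t - r1) * (t - r2) * ((r3 - t) * (r4 - t)) > 0" by (rule mult_pos_pos)
  moreover have "fibre_poly a b c d t = (t - r1) * (t - r2) * ((r3 - t) * (r4 - t))"
  proof -
    have "fibre_poly a b c d t = (t - r1) * (t - r2) * (t - r3) * (t - r4)"
      using assms(1) unfolding four_roots_def by blast
    thus ?thesis by (simp add: algebra_simps)
  qed
  ultimately show ?thesis by simp
qed

lemma four_roots_last:
  assumes "four_roots a b c d r1 r2 r3 r4" "fibre_poly a b c d t = 0"
  shows "t \<le> r4"
  using assms unfolding four_roots_def by auto

text \<open>To the right of \<open>r3\<close> the quartic is positive only beyond \<open>r4\<close>,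
  whereas \<open>s3\<close> is a root and hence at most \<open>r4\<close>. Overlapping middle
  intervals serve instead of uniqueness of the ordered roots.\<close>

lemma four_roots_overlap_aux:
  assumes "four_roots a b c d r1 r2 r3 r4" "four_roots a b c d s1 s2 s3 s4"
  shows "s2 < r3"
proof (rule ccontr)
  assume "\<not> s2 < r3"
  have "r4 \<le> t" if t: "s2 < t" "t < s3" for t
  proof (rule ccontr)
    assume "\<not> r4 \<le> t"
    have "(t - r1) * (t - r2) * (t - r3) \<ge> 0"
      using assms(1) t \<open>\<not> s2 < r3\<close> unfolding four_roots_def by (auto intro!: mult_nonneg_nonneg)
    hence "fibre_poly a b c d t \<le> 0"
      using assms(1) \<open>\<not> r4 \<le> t\<close> unfolding four_roots_def by (auto intro!: mult_nonneg_nonpos)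
    thus False using four_roots_pos[OF assms(2) t] by simp
  qed
  from this[of "(s2 + s3) / 2"] have "r4 < s3" using assms(2) by (simp add: four_roots_def)
  moreover have "s3 \<le> r4" using assms by (intro four_roots_last) (auto simp: four_roots_def)
  ultimately show False by simp
qed

lemma four_roots_overlap:
  assumes "four_roots a b c d r1 r2 r3 r4" "four_roots a b c d s1 s2 s3 s4"
  obtains t where "r2 < t" "t < r3" "s2 < t" "t < s3"
proof -
  have "max r2 s2 < min r3 s3"
    using four_roots_overlap_aux[OF assms] four_roots_overlap_aux[OF assms(2,1)] assms
    by (auto simp: four_roots_def)
  then obtain t where "max r2 s2 < t" "t < min r3 s3" using dense by blast
  thus thesis by (intro that[of t]) auto
qed

abbreviation rcomp :: "real \<Rightarrow> real \<Rightarrow> real \<Rightarrow> real \<Rightarrow> real \<times> real \<times> real \<Rightarrow> (real \<times> real \<times> real) set"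
  where "rcomp a b c d p \<equiv> connected_component_set (rsmooth a b c d) p"

theorem bounded_component_four_roots:
  assumes p: "(x, y, z) \<in> rsurf a b c d" "\<not> centre b c (x, y, z)" "\<bar>x\<bar> < 2"
    and bdd: "bounded (rcomp a b c d (x, y, z))"
  obtains r1 r2 r3 r4 where "four_roots a b c d r1 r2 r3 r4" "r2 < x" "x < r3"
proof -
  let ?P = "fibre_poly a b c d"
  have cont: "continuous_on V ?P" for V
    unfolding fibre_poly_def by (intro continuous_intros)
  have Px: "?P x > 0" using fibre_poly_nonneg(2)[OF p(1,3)] p(2) by blast
  have closed0: "closed {t. ?P t = 0}"
    using continuous_closed_preimage[OF cont[of UNIV] closed_UNIV closed_singleton[of 0]]
    by (simp add: vimage_def)
  \<comment> \<open>Its largest element \<open>u\<close> is the nearest zero of the quartic to the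
    left of \<open>x\<close>, or -2 if there is none in the strip; \<open>B\<close> and
    \<open>v\<close> do the same on the right.\<close>
  define A where "A = {- 2..x} \<inter> ({- 2} \<union> {t. ?P t = 0})"
  have "compact A" unfolding A_def by (intro compact_Int_closed closed_Un closed0) auto
  moreover have "- 2 \<in> A" using p(3) by (auto simp: A_def)
  ultimately obtain u where u: "u \<in> A" "\<And>t. t \<in> A \<Longrightarrow> t \<le> u" using compact_attains_sup[of A] by blast
  define B where "B = {x..2} \<inter> ({2} \<union> {t. ?P t = 0})"
  have "compact B" unfolding B_def by (intro compact_Int_closed closed_Un closed0) auto
  moreover have "2 \<in> B" using p(3) by (auto simp: B_def)
  ultimately obtain v where v: "v \<in> B" "\<And>t. t \<in> B \<Longrightarrow> v \<le> t" using compact_attains_inf[of B] by blast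
  have ux: "- 2 \<le> u" "u < x" and xv: "x < v" "v \<le> 2"
    using u(1) v(1) Px p(3) by (auto simp: A_def B_def less_le)
  have pos: "?P t > 0" if t: "u < t" "t < v" for t
  proof (rule ccontr)
    assume neg: "\<not> ?P t > 0"
    show False
    proof (cases "t \<le> x")
      case True
      then obtain s where "t \<le> s" "s \<le> x" "?P s = 0"
        using IVT'[of ?P t 0 x] neg Px cont by auto
      thus False using u(2)[of s] t ux by (auto simp: A_def)
    next
      case False
      then obtain s where "x \<le> s" "s \<le> t" "?P s = 0"
        using IVT2'[of ?P t 0 x] neg Px cont by auto
      thus False using v(2)[of s] t xv by (auto simp: B_def)
    qed
  qed
  let ?band = "{(x, y, z) \<in> rsurf a b c d. x \<in> {u<..<v}}"
  have J: "{u<..<v} \<subseteq> {- 2<..<2}" using ux xv by auto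
  have "?band \<subseteq> rcomp a b c d (x, y, z)"
    using band_connected[OF _ J] pos p(1) ux xv by (intro connected_component_maximal) auto
  with bdd have "bounded ?band" by (rule bounded_subset)
  then obtain M where M: "\<And>q. q \<in> ?band \<Longrightarrow> norm q \<le> M" by (auto simp: bounded_iff)
  \<comment> \<open>The \<open>y\<close>-coordinates at parameters 0 and \<open>pi\<close> are the
    centre plus and minus the radius, so \<open>M\<close> bounds the radius. The squared factor then
    forces the quartic to vanish to second order at \<open>u\<close> or \<open>v\<close> whenever
    that is an end of the strip.\<close>
  have bound: "?P t \<le> M\<^sup>2 / 4 * (4 - t\<^sup>2)\<^sup>2" if t: "u < t" "t < v" for t
  proof -
    have t2: "\<bar>t\<bar> < 2" using subsetD[OF J, of t] t by (simp add: abs_less_iff)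
    define r where "r = ellipse_radius a b c d t"
    have r0: "r \<ge> 0" using four_minus_square_pos[OF t2] pos[OF t] by (simp add: r_def ellipse_radius_def)
    have E: "norm (ellipse_point a b c d t s) \<le> M" for s
      using M[of "ellipse_point a b c d t s"] ellipse_point_in_rsurf[OF t2, of a b c d s] pos[OF t] t
      unfolding ellipse_point_def by (simp del: in_rsurf add: less_imp_le)
    have "\<bar>y_centre b c t + r * cos s\<bar> \<le> M" for s
    proof -
      have "\<bar>fst (snd (ellipse_point a b c d t s))\<bar> \<le> norm (ellipse_point a b c d t s)"
        by (metis norm_fst_le norm_snd_le order_trans prod.collapse real_norm_def)
      also have "fst (snd (ellipse_point a b c d t s)) = y_centre b c t + r * cos s"
        by (simp add: ellipse_point_def r_def)
      finally show ?thesis using E[of s] by linarith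
    qed
    from this[of 0] this[of pi] have "r \<le> M" by (simp add: abs_le_iff)
    hence "r\<^sup>2 \<le> M\<^sup>2" using r0 by (intro power_mono)
    hence "r\<^sup>2 * (4 - t\<^sup>2)\<^sup>2 \<le> M\<^sup>2 * (4 - t\<^sup>2)\<^sup>2" by (intro mult_right_mono) auto
    thus ?thesis using ellipse_radius_square[OF t2, of a b c d] pos[OF t] by (simp add: r_def)
  qed
  have ends: "M\<^sup>2 / 4 * (4 - u\<^sup>2)\<^sup>2 - ?P u \<ge> 0" "M\<^sup>2 / 4 * (4 - v\<^sup>2)\<^sup>2 - ?P v \<ge> 0"
  proof -
    have 1: "u < v" using ux xv by simp
    have 2: "continuous_on {u..v} (\<lambda>t. M\<^sup>2 / 4 * (4 - t\<^sup>2)\<^sup>2 - ?P t)"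
      by (intro continuous_intros cont)
    have 3: "M\<^sup>2 / 4 * (4 - t\<^sup>2)\<^sup>2 - ?P t \<ge> 0" if "u < t" "t < v" for t
      using bound[OF that] by simp
    show "M\<^sup>2 / 4 * (4 - u\<^sup>2)\<^sup>2 - ?P u \<ge> 0" "M\<^sup>2 / 4 * (4 - v\<^sup>2)\<^sup>2 - ?P v \<ge> 0"
      using endpoint_nonneg[OF 1 2 3] by blast+
  qed
  have Pu: "?P u = 0"
  proof (cases "u = - 2")
    case True
    thus ?thesis using ends(1) by (simp add: fibre_poly_at_2)
  qed (use u in \<open>auto simp: A_def\<close>)
  have Pv: "?P v = 0"
  proof (cases "v = 2")
    case True
    thus ?thesis using ends(2) by (simp add: fibre_poly_at_2)
  qed (use v in \<open>auto simp: B_def\<close>)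
  obtain e f where ef: "\<And>t. ?P t = (t - u) * (t - v) * (t\<^sup>2 + e * t + f)"
    using quartic_divide[OF Pu Pv] ux xv by auto
  have neg: "t\<^sup>2 + e * t + f < 0" if "u < t" "t < v" for t
  proof -
    have "(t - u) * (v - t) > 0" using that by simp
    moreover have "(t - u) * (v - t) * - (t\<^sup>2 + e * t + f) > 0" using pos[OF that] ef[of t] by (simp add: algebra_simps)
    ultimately show ?thesis by (metis neg_0_less_iff_less zero_less_mult_pos)
  qed
  then obtain r1 r4 where r: "\<And>t. t\<^sup>2 + e * t + f = (t - r1) * (t - r4)" "r1 < r4"
    using quadratic_roots[of x e f] ux xv by blast
  have between: "r1 < t \<and> t < r4" if "u < t" "t < v" for t
    using neg[OF that] r(2) unfolding r(1) by (auto simp: mult_less_0_iff)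
  have "u < v" using ux xv by simp
  have "r1 \<le> u" using \<open>u < v\<close>
    by (rule dense_ge_bounded) (rule less_imp_le, use between in blast)
  have "v \<le> r4" using \<open>u < v\<close>
    by (rule dense_le_bounded) (rule less_imp_le, use between in blast)
  have P2: "?P (- 2) \<ge> 0" "?P 2 \<ge> 0" by (simp_all add: fibre_poly_at_2)
  \<comment> \<open>The point -2 must not lie strictly between \<open>r1\<close> and
    \<open>r4\<close>. If \<open>u = -2\<close>, one factor \<open>t - u\<close> cancels from the
    quadratic bound before passing to the endpoint; otherwise the value of the quartic at -2, a
    square, gives the sign.\<close>
  have "(- 2 - r1) * (- 2 - r4) \<ge> 0"
  proof (cases "u = - 2")
    case True
    have fn: "M\<^sup>2 / 4 * ((t - u) * (2 - t)\<^sup>2) - (t - v) * ((t - r1) * (t - r4)) \<ge> 0" if t: "u < t" "t < v" for t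
    proof -
      have "(t - u) * ((t - v) * ((t - r1) * (t - r4))) \<le> (t - u) * (M\<^sup>2 / 4 * ((t - u) * (2 - t)\<^sup>2))"
      proof -
        have "m * (4 - t\<^sup>2)\<^sup>2 = (t - u) * (m * ((t - u) * (2 - t)\<^sup>2))" for m
          unfolding True by (simp add: power2_eq_square algebra_simps)
        thus ?thesis using bound[OF t] unfolding ef r(1) by (simp only: mult.assoc)
      qed
      hence "(t - v) * ((t - r1) * (t - r4)) \<le> M\<^sup>2 / 4 * ((t - u) * (2 - t)\<^sup>2)"
        using t by (subst (asm) mult_le_cancel_left_pos) simp_all
      thus ?thesis by (simp only: diff_ge_0_iff_ge)
    qed
    have "M\<^sup>2 / 4 * ((u - u) * (2 - u)\<^sup>2) - (u - v) * ((u - r1) * (u - r4)) \<ge> 0"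
      by (rule endpoint_nonneg(1)[of u v "\<lambda>t. M\<^sup>2 / 4 * ((t - u) * (2 - t)\<^sup>2) - (t - v) * ((t - r1) * (t - r4))",
            OF \<open>u < v\<close> _ fn]) (intro continuous_intros)
    moreover have "M\<^sup>2 / 4 * ((u - u) * (2 - u)\<^sup>2) - (u - v) * w = (v - u) * w" for w
      by (simp add: algebra_simps)
    ultimately have "(v - u) * ((u - r1) * (u - r4)) \<ge> 0" by (simp only:)
    thus ?thesis using ux xv True by (simp add: zero_le_mult_iff)
  next
    case False
    have "(- 2 - u) * (- 2 - v) > 0" using False ux xv by (intro mult_neg_neg) auto
    moreover have "(- 2 - u) * (- 2 - v) * ((- 2 - r1) * (- 2 - r4)) \<ge> 0" using P2(1) unfolding ef r(1) .
    ultimately show ?thesis by (meson mult_pos_neg not_le)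
  qed
  hence r1: "- 2 \<le> r1" using \<open>v \<le> r4\<close> ux xv by (auto simp: zero_le_mult_iff)
  have "(2 - r1) * (2 - r4) \<ge> 0"
  proof (cases "v = 2")
    case True
    have fn: "M\<^sup>2 / 4 * ((v - t) * (2 + t)\<^sup>2) + (t - u) * ((t - r1) * (t - r4)) \<ge> 0" if t: "u < t" "t < v" for t
    proof -
      have "(v - t) * - ((t - u) * ((t - r1) * (t - r4))) \<le> (v - t) * (M\<^sup>2 / 4 * ((v - t) * (2 + t)\<^sup>2))"
      proof -
        have "m * (4 - t\<^sup>2)\<^sup>2 = (v - t) * (m * ((v - t) * (2 + t)\<^sup>2))" for m
          unfolding True by (simp add: power2_eq_square algebra_simps)
        moreover have "(t - u) * (t - v) * ((t - r1) * (t - r4)) = (v - t) * - ((t - u) * ((t - r1) * (t - r4)))"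
          by (simp add: algebra_simps)
        ultimately show ?thesis using bound[OF t] unfolding ef r(1) by (simp only:)
      qed
      hence "- ((t - u) * ((t - r1) * (t - r4))) \<le> M\<^sup>2 / 4 * ((v - t) * (2 + t)\<^sup>2)"
        using t by (subst (asm) mult_le_cancel_left_pos) simp_all
      thus ?thesis by linarith
    qed
    have "M\<^sup>2 / 4 * ((v - v) * (2 + v)\<^sup>2) + (v - u) * ((v - r1) * (v - r4)) \<ge> 0"
      by (rule endpoint_nonneg(2)[of u v "\<lambda>t. M\<^sup>2 / 4 * ((v - t) * (2 + t)\<^sup>2) + (t - u) * ((t - r1) * (t - r4))",
            OF \<open>u < v\<close> _ fn]) (intro continuous_intros)
    thus ?thesis using ux xv True by (simp add: zero_le_mult_iff)
  next
    case False
    have "(2 - u) * (2 - v) > 0" using False ux xv by (intro mult_pos_pos) auto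
    moreover have "(2 - u) * (2 - v) * ((2 - r1) * (2 - r4)) \<ge> 0" using P2(2) unfolding ef r(1) .
    ultimately show ?thesis by (meson mult_pos_neg not_le)
  qed
  hence r4: "r4 \<le> 2" using \<open>r1 \<le> u\<close> ux xv by (auto simp: zero_le_mult_iff)
  have "?P t = (t - r1) * (t - u) * (t - v) * (t - r4)" for t unfolding ef r(1) by simp
  hence "four_roots a b c d r1 u v r4"
    using r1 r4 \<open>r1 \<le> u\<close> \<open>v \<le> r4\<close> ux xv by (simp add: four_roots_def)
  thus thesis using ux xv by (intro that)
qed

text \<open>Outside the strip \<open>\<bar>x\<bar> < 2\<close> a non-central point moves to infinity along its fibre, a
  hyperbola, a parabola or a union of lines.\<close>

lemma unbounded_curveI:
  fixes f g :: "real \<Rightarrow> real"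
  assumes "connected I" "continuous_on I f" "continuous_on I g"
    and "\<And>k. k \<in> I \<Longrightarrow> (x, f k, g k) \<in> rsmooth a b c d"
    and "k0 \<in> I" "f k0 = y" "g k0 = z"
    and unb: "\<And>M. \<exists>k\<in>I. \<bar>\<xi> * f k + \<eta> * g k\<bar> > M"
  shows "\<exists>V. connected V \<and> V \<subseteq> rsmooth a b c d \<and> (x, y, z) \<in> V \<and> \<not> bounded V"
proof (intro exI conjI)
  let ?h = "\<lambda>k. (x, f k, g k)"
  show "connected (?h ` I)"
    using assms(1-3) by (intro connected_continuous_image continuous_intros)
  show "?h ` I \<subseteq> rsmooth a b c d" using assms(4) by blast
  show "(x, y, z) \<in> ?h ` I" using assms(5-7) by (intro image_eqI[of _ _ k0]) auto
  show "\<not> bounded (?h ` I)"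
  proof
    assume "bounded (?h ` I)"
    then obtain M where M: "\<And>k. k \<in> I \<Longrightarrow> norm (x, f k, g k) \<le> M" by (auto simp: bounded_iff)
    obtain k where k: "k \<in> I" "\<bar>\<xi> * f k + \<eta> * g k\<bar> > (\<bar>\<xi>\<bar> + \<bar>\<eta>\<bar>) * M" using unb by blast
    have "norm (f k, g k) \<le> M" using M[OF k(1)] norm_snd_le[of "(f k, g k)" x] by linarith
    hence "\<bar>f k\<bar> \<le> M" "\<bar>g k\<bar> \<le> M" using norm_fst_le[of "f k" "g k"] norm_snd_le[of "g k" "f k"] by auto
    hence "\<bar>\<xi>\<bar> * \<bar>f k\<bar> + \<bar>\<eta>\<bar> * \<bar>g k\<bar> \<le> (\<bar>\<xi>\<bar> + \<bar>\<eta>\<bar>) * M"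
      unfolding distrib_right by (intro add_mono mult_left_mono) auto
    moreover have "\<bar>\<xi> * f k + \<eta> * g k\<bar> \<le> \<bar>\<xi>\<bar> * \<bar>f k\<bar> + \<bar>\<eta>\<bar> * \<bar>g k\<bar>"
      unfolding abs_mult[symmetric] by (rule abs_triangle_ineq)
    ultimately show False using k(2) by linarith
  qed
qed

text \<open>For \<open>\<bar>x\<bar> > 2\<close> the form factors as
  \<open>(u + \<mu> v) (u + \<nu> v)\<close> over the reals. Scaling one factor by
  \<open>k > 0\<close> and the other by \<open>1/k\<close> moves along the branch; \<open>k\<close>
  tends to infinity if \<open>s\<close> is nonzero, and to 0 otherwise.\<close>

lemma unbounded_hyperbolic:
  assumes p: "(x, y, z) \<in> rsurf a b c d" "\<not> centre b c (x, y, z)" and x: "\<bar>x\<bar> > 2"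
  shows "\<exists>V. connected V \<and> V \<subseteq> rsmooth a b c d \<and> (x, y, z) \<in> V \<and> \<not> bounded V"
proof -
  define \<Delta> where "\<Delta> = sqrt (x\<^sup>2 - 4)"
  define \<mu> \<nu> where "\<mu> = (x + \<Delta>) / 2" and "\<nu> = (x - \<Delta>) / 2"
  have "x\<^sup>2 > 4" using power_strict_mono[OF x, of 2] by simp
  hence \<Delta>: "\<Delta> > 0" "\<Delta> * \<Delta> = x * x - 4" by (simp_all add: \<Delta>_def power2_eq_square)
  have \<mu>: "\<mu> * \<nu> = 1" "\<mu> + \<nu> = x" "\<mu> - \<nu> = \<Delta>"
    using \<Delta>(2) by (simp_all add: \<mu>_def \<nu>_def field_simps)
  have x4: "x\<^sup>2 \<noteq> 4" using \<open>x\<^sup>2 > 4\<close> by simp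
  define Y Z where "Y = y_centre b c x" and "Z = y_centre c b x"
  define s w where "s = (y - Y) + \<mu> * (z - Z)" and "w = (y - Y) + \<nu> * (z - Z)"
  define v where "v k = (s * k - w / k) / \<Delta>" for k :: real
  define u where "u k = s * k - \<mu> * v k" for k :: real
  have uw: "u k + \<mu> * v k = s * k" "u k + \<nu> * v k = w / k" for k
  proof -
    show "u k + \<mu> * v k = s * k" by (simp add: u_def)
    have "u k + \<nu> * v k = s * k - (\<mu> - \<nu>) * v k" by (simp add: u_def algebra_simps)
    thus "u k + \<nu> * v k = w / k" using \<Delta>(1) by (simp add: \<mu>(3) v_def)
  qed
  have form: "(u + \<mu> * v) * (u + \<nu> * v) = u\<^sup>2 + v\<^sup>2 + x * u * v" for u v
    unfolding \<mu>(2)[symmetric] using \<mu>(1) by (simp add: power2_eq_square algebra_simps)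
  have vanish: "u = 0 \<and> v = 0" if "u + \<mu> * v = 0" "u + \<nu> * v = 0" for u v
  proof -
    have "(\<mu> - \<nu>) * v = (u + \<mu> * v) - (u + \<nu> * v)" by (simp add: algebra_simps)
    thus ?thesis using that \<Delta>(1) by (simp add: \<mu>(3))
  qed
  have sw: "s \<noteq> 0 \<or> w \<noteq> 0"
    using p(2) centre_iff[OF x4, of b c "y - Y" "z - Z"] vanish[of "y - Y" "z - Z"] by (auto simp: s_def w_def Y_def Z_def)
  have "(x, Y + u k, Z + v k) \<in> rsmooth a b c d" if "k \<in> {0<..}" for k
  proof -
    have "(u k)\<^sup>2 + (v k)\<^sup>2 + x * u k * v k = s * w"
      using that unfolding form[symmetric] uw by simp
    also have "\<dots> = (y - Y)\<^sup>2 + (z - Z)\<^sup>2 + x * (y - Y) * (z - Z)" unfolding s_def w_def by (rule form)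
    finally have eq: "(u k)\<^sup>2 + (v k)\<^sup>2 + x * u k * v k = (y - Y)\<^sup>2 + (z - Z)\<^sup>2 + x * (y - Y) * (z - Z)" .
    have "(x, Y + (y - Y), Z + (z - Z)) \<in> rsurf a b c d" using p(1) by simp
    hence "(x, Y + u k, Z + v k) \<in> rsurf a b c d"
      unfolding Y_def Z_def conic_iff[OF x4] using eq unfolding Y_def Z_def by (simp only:)
    moreover have "\<not> (u k = 0 \<and> v k = 0)" using uw[of k] that sw by auto
    hence "\<not> centre b c (x, Y + u k, Z + v k)" unfolding Y_def Z_def centre_iff[OF x4] .
    ultimately show ?thesis by (auto simp: in_rsmooth)
  qed
  moreover have "continuous_on {0<..} v" unfolding v_def using \<Delta>(1) by (intro continuous_intros) auto
  moreover from this have "continuous_on {0<..} u" unfolding u_def by (intro continuous_intros)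
  moreover have "v 1 = z - Z" "u 1 = y - Y"
  proof -
    have "s - w = (\<mu> - \<nu>) * (z - Z)" by (simp add: s_def w_def algebra_simps)
    thus "v 1 = z - Z" using \<Delta>(1) by (simp add: v_def \<mu>(3))
    thus "u 1 = y - Y" by (simp add: u_def s_def)
  qed
  moreover have "\<exists>\<kappa>. \<forall>M. \<exists>k\<in>{0<..}. \<bar>1 * (Y + u k) + \<kappa> * (Z + v k)\<bar> > M"
  proof (cases "s = 0")
    case False
    have "\<exists>k\<in>{0<..}. \<bar>1 * (Y + u k) + \<mu> * (Z + v k)\<bar> > M" for M
    proof -
      define k where "k = (\<bar>M\<bar> + \<bar>Y + \<mu> * Z\<bar> + 1) / \<bar>s\<bar>"
      have k: "k > 0" "\<bar>s * k\<bar> = \<bar>M\<bar> + \<bar>Y + \<mu> * Z\<bar> + 1" using False by (simp_all add: k_def abs_mult)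
      have "1 * (Y + u k) + \<mu> * (Z + v k) = (Y + \<mu> * Z) + s * k" unfolding uw(1)[symmetric] by (simp add: algebra_simps)
      hence "\<bar>1 * (Y + u k) + \<mu> * (Z + v k)\<bar> > M" using k(2) by linarith
      thus ?thesis using k(1) by auto
    qed
    thus ?thesis by blast
  next
    case True
    hence w0: "w \<noteq> 0" using sw by simp
    have "\<exists>k\<in>{0<..}. \<bar>1 * (Y + u k) + \<nu> * (Z + v k)\<bar> > M" for M
    proof -
      define N where "N = \<bar>M\<bar> + \<bar>Y + \<nu> * Z\<bar> + 1"
      define k where "k = \<bar>w\<bar> / N"
      have "N > 0" unfolding N_def by linarith
      hence k: "k > 0" "\<bar>w / k\<bar> = N" using w0 by (simp_all add: k_def abs_mult)
      have "1 * (Y + u k) + \<nu> * (Z + v k) = (Y + \<nu> * Z) + w / k" unfolding uw(2)[symmetric] by (simp add: algebra_simps)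
      hence "\<bar>1 * (Y + u k) + \<nu> * (Z + v k)\<bar> > M" using k(2) unfolding N_def by linarith
      thus ?thesis using k(1) by auto
    qed
    thus ?thesis by blast
  qed
  then obtain \<kappa> where "\<And>M. \<exists>k\<in>{0<..}. \<bar>1 * (Y + u k) + \<kappa> * (Z + v k)\<bar> > M" by blast
  ultimately show ?thesis
    by (intro unbounded_curveI[of "{0<..}" "\<lambda>k. Y + u k" "\<lambda>k. Z + v k" x a b c d 1 y z 1 \<kappa>])
      (auto intro!: continuous_intros)
qed

text \<open>For \<open>x = 2 s\<close> with \<open>s\<close> equal to 1 or -1 the quadratic part is
  the square of \<open>y + s z\<close>. The fibre is a parabola unless \<open>c = s * b\<close>; in
  that case it contains the whole line of constant \<open>y + s z\<close> through the point.\<close>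

lemma unbounded_parabolic:
  assumes p: "(x, y, z) \<in> rsurf a b c d" "\<not> centre b c (x, y, z)" and x: "\<bar>x\<bar> = 2"
  shows "\<exists>V. connected V \<and> V \<subseteq> rsmooth a b c d \<and> (x, y, z) \<in> V \<and> \<not> bounded V"
proof -
  define s where "s = x / 2"
  have s: "x = 2 * s" "s * s = 1"
  proof -
    have "x = 2 \<or> x = - 2" using x by linarith
    thus "x = 2 * s" "s * s = 1" by (auto simp: s_def)
  qed
  have ss: "s * (s * w) = w" for w using s(2) by (simp flip: mult.assoc)
  have surf: "(x, y', z') \<in> rsurf a b c d \<longleftrightarrow> (y' + s * z')\<^sup>2 = b * y' + c * z' + (a * x + d - x\<^sup>2)" for y' z'
    unfolding in_rsurf s(1) by (simp add: power2_eq_square algebra_simps ss)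
  have cen: "centre b c (x, y', z') \<longleftrightarrow> 2 * (y' + s * z') = b \<and> 2 * (y' + s * z') = s * c" for y' z'
  proof -
    have "2 * (y' + s * z') = s * c \<longleftrightarrow> s * (2 * (y' + s * z')) = s * (s * c)" using s(2) by (auto simp del: mult_cancel_left simp: ss)
    also have "\<dots> \<longleftrightarrow> 2 * z' + x * y' = c" unfolding ss by (simp add: s(1) algebra_simps ss)
    finally show ?thesis by (simp add: s(1) algebra_simps)
  qed
  show ?thesis
  proof (cases "c = s * b")
    case True
    hence nb: "2 * (y + s * z) \<noteq> b" using p(2) cen ss by auto
    have "(x, y + k, z - s * k) \<in> rsmooth a b c d" for k
    proof -
      have 1: "(y + k) + s * (z - s * k) = y + s * z" by (simp add: algebra_simps ss s(2))
      have 2: "b * (y + k) + c * (z - s * k) = b * y + c * z" unfolding True by (simp add: algebra_simps ss s(2))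
      have "(x, y + k, z - s * k) \<in> rsurf a b c d \<and> \<not> centre b c (x, y + k, z - s * k)"
        using p(1) nb unfolding surf cen 1 2 by blast
      thus ?thesis by (auto simp: in_rsmooth)
    qed
    moreover have "\<exists>k\<in>UNIV. \<bar>1 * (y + k) + 0 * (z - s * k)\<bar> > M" for M
      by (intro bexI[of _ "\<bar>M\<bar> + 1 - y"]) auto
    ultimately show ?thesis
      by (intro unbounded_curveI[of UNIV "\<lambda>k. y + k" "\<lambda>k. z - s * k" x a b c d 0 y z 1 0])
        (auto intro!: continuous_intros)
  next
    case False
    define e where "e = a * x + d - x\<^sup>2"
    define g where "g k = (y + s * z) + k" for k
    define w where "w k = ((g k)\<^sup>2 - e - b * g k) / (c - s * b)" for k
    have nz: "c - s * b \<noteq> 0" using False by simp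
    have "(x, g k - s * w k, w k) \<in> rsmooth a b c d" for k
    proof -
      have "(c - s * b) * w k = (g k)\<^sup>2 - e - b * g k" using nz by (simp add: w_def)
      hence "(g k)\<^sup>2 = b * (g k - s * w k) + c * w k + e" by (simp add: algebra_simps)
      hence "(x, g k - s * w k, w k) \<in> rsurf a b c d" unfolding surf e_def[symmetric] by simp
      moreover have "\<not> centre b c (x, g k - s * w k, w k)"
        unfolding cen using False ss by auto
      ultimately show ?thesis by (auto simp: in_rsmooth)
    qed
    moreover have "w 0 = z"
    proof -
      have "(g 0)\<^sup>2 - e - b * g 0 = (c - s * b) * z"
        using p(1) unfolding surf e_def[symmetric] g_def by (simp add: algebra_simps)
      thus ?thesis using nz by (simp add: w_def)
    qed
    moreover have "\<exists>k\<in>UNIV. \<bar>1 * (g k - s * w k) + s * w k\<bar> > M" for M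
      by (intro bexI[of _ "\<bar>M\<bar> + 1 - (y + s * z)"]) (auto simp: g_def)
    ultimately show ?thesis using nz
      by (intro unbounded_curveI[of UNIV "\<lambda>k. g k - s * w k" w x a b c d 0 y z 1 s])
        (auto intro!: continuous_intros simp: g_def w_def)
  qed
qed

lemma bounded_component_strip:
  assumes p: "(x, y, z) \<in> rsurf a b c d" "\<not> centre b c (x, y, z)"
    and bdd: "bounded (rcomp a b c d (x, y, z))"
  shows "\<bar>x\<bar> < 2"
proof (rule ccontr)
  assume "\<not> \<bar>x\<bar> < 2"
  then obtain V where V: "connected V" "V \<subseteq> rsmooth a b c d" "(x, y, z) \<in> V" "\<not> bounded V"
    using unbounded_hyperbolic[OF p] unbounded_parabolic[OF p] by (metis linorder_neqE_linordered_idom)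
  hence "V \<subseteq> rcomp a b c d (x, y, z)" by (intro connected_component_maximal)
  thus False using bdd V(4) bounded_subset by blast
qed

lemma continuous_on_cyc: "continuous_on V (cyc :: 'a::topological_space \<times> 'a \<times> 'a \<Rightarrow> _)"
  unfolding cyc_def case_prod_beta by (intro continuous_intros)

lemma connected_component_cyc:
  "rcomp b c a d (cyc p) = cyc ` rcomp a b c d p"
proof -
  have sub: "cyc ` rcomp a b c d p \<subseteq> rcomp b c a d (cyc p)" for a b c d p
  proof (cases "p \<in> rsmooth a b c d")
    case True
    show ?thesis
    proof (rule connected_component_maximal)
      show "cyc p \<in> cyc ` rcomp a b c d p" using True by (intro imageI) auto
      show "connected (cyc ` rcomp a b c d p)"
        by (intro connected_continuous_image continuous_on_cyc connected_connected_component)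
      show "cyc ` rcomp a b c d p \<subseteq> rsmooth b c a d"
        unfolding cyc_rsmooth[of a b c d, symmetric] by (intro image_mono connected_component_subset)
    qed
  next
    case False
    hence "rcomp a b c d p = {}" using connected_component_eq_empty by blast
    thus ?thesis by (simp only: image_empty empty_subsetI)
  qed
  have c3: "cyc (cyc (cyc q)) = q" for q :: "real \<times> real \<times> real" by (cases q) simp
  \<comment> \<open>\<open>cyc\<close> has order three, so applying the inclusion twice more returns
    to the original component.\<close>
  have "cyc ` cyc ` rcomp b c a d (cyc p) \<subseteq> rcomp a b c d (cyc (cyc (cyc p)))"
    using sub[of c a b d "cyc (cyc p)"] image_mono[OF sub[of b c a d "cyc p"], of cyc] by blast
  hence "cyc ` cyc ` cyc ` rcomp b c a d (cyc p) \<subseteq> cyc ` rcomp a b c d p"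
    unfolding c3 by (rule image_mono)
  hence "rcomp b c a d (cyc p) \<subseteq> cyc ` rcomp a b c d p"
    by (simp add: image_image c3)
  with sub show ?thesis by (intro subset_antisym)
qed

text \<open>The roots of the quartic are found from a point noncentral in \<open>x\<close>. From a
  smooth point that is central there, moving along its ellipse of constant \<open>y\<close>, inside
  the component, reaches one.\<close>

lemma bounded_component_noncentral:
  assumes p: "p \<in> rsmooth a b c d" and bdd: "bounded (rcomp a b c d p)"
  obtains x y z where "(x, y, z) \<in> rcomp a b c d p" "(x, y, z) \<in> rsurf a b c d"
    "\<not> centre b c (x, y, z)" "\<bar>x\<bar> < 2"
proof -
  let ?C = "rcomp a b c d p"
  note found = that
  have fin: thesis if q: "(x, y, z) \<in> ?C" "\<not> centre b c (x, y, z)" for x y z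
  proof -
    have "?C = rcomp a b c d (x, y, z)"
      using q(1) connected_component_eq[of "(x, y, z)" "rsmooth a b c d" p] by simp
    moreover have S: "(x, y, z) \<in> rsurf a b c d"
      using q(1) connected_component_subset[of "rsmooth a b c d" p] by (auto simp: in_rsmooth)
    ultimately have "\<bar>x\<bar> < 2" using bounded_component_strip[OF S q(2)] bdd by simp
    with q(1) S q(2) show thesis by (rule found)
  qed
  obtain x y z where xyz: "p = (x, y, z)" by (cases p) auto
  show thesis
  proof (cases "centre b c (x, y, z)")
    case False
    thus thesis using fin[of x y z] p xyz by simp
  next
    case True
    hence nc: "\<not> centre c a (y, z, x)" using rsmooth_noncentre p xyz by blast
    have S: "(y, z, x) \<in> rsurf b c a d" using p by (simp add: xyz in_rsmooth algebra_simps)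
    have comp: "rcomp b c a d (y, z, x) = cyc ` ?C"
      using connected_component_cyc[of b c a d p] by (simp add: xyz)
    have y2: "\<bar>y\<bar> < 2"
      using bounded_component_strip[OF S nc] bdd by (simp add: comp bounded_cyc)
    have P: "fibre_poly b c a d y > 0" using fibre_poly_nonneg(2)[OF S y2] nc by blast
    define r where "r = ellipse_radius b c a d y"
    have r: "r \<noteq> 0" using P four_minus_square_pos[OF y2] by (simp add: r_def ellipse_radius_def)
    define \<phi> where "\<phi> = arccos (y / 2)"
    have y: "y = 2 * cos \<phi>" using y2 by (simp add: \<phi>_def cos_arccos)
    have s0: "sin \<phi> > 0" unfolding \<phi>_def sin_arccos_half[OF y2] using four_minus_square_pos[OF y2] by simp
    \<comment> \<open>At the parameter \<open>pi / 2 - \<phi>\<close> the displacement of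
      \<open>x\<close> vanishes and that of \<open>z\<close> is \<open>r sin \<phi>\<close>, so
      \<open>2 z' + x' y\<close> differs from \<open>c\<close> by \<open>2 r sin \<phi>\<close>,
      which is nonzero.\<close>
    define z' x' where "z' = y_centre c a y + r * cos (pi / 2 - \<phi>)" and "x' = y_centre a c y - r * cos (pi / 2)"
    have q: "(y, z', x') = ellipse_point b c a d y (pi / 2 - \<phi>)"
      by (simp add: ellipse_point_def z'_def x'_def r_def \<phi>_def)
    let ?band = "{(u, v, w) \<in> rsurf b c a d. u \<in> {y}}"
    have "?band \<subseteq> rcomp b c a d (y, z, x)"
      using band_connected[of "{y}" b c a d] y2 P S
      by (intro connected_component_maximal) (auto simp: abs_less_iff)
    moreover have "(y, z', x') \<in> rsurf b c a d"
      unfolding q using ellipse_point_in_rsurf[OF y2] P less_imp_le by blast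
    ultimately have "(y, z', x') \<in> cyc ` ?C" unfolding comp by blast
    hence "(x', y, z') \<in> ?C" by simp
    moreover have "2 * z' + x' * y \<noteq> c"
    proof -
      have "2 * z' + x' * y = (2 * y_centre c a y + y * y_centre a c y) + 2 * r * sin \<phi>"
        by (simp add: z'_def x'_def cos_diff algebra_simps)
      also have "2 * y_centre c a y + y * y_centre a c y = c" by (rule y_centre_eqs[OF strip_square[OF y2]])
      finally show ?thesis using r s0 by simp
    qed
    ultimately show thesis using fin[of x' y z'] by simp
  qed
qed

text \<open>Every bounded component contains the whole band over the middle interval of some root
  configuration. Two such intervals overlap, so the components share the point of parameter 0 over a
  common \<open>t\<close>.\<close>

theorem bounded_component_unique:
  assumes p: "p \<in> rsmooth a b c d" "bounded (rcomp a b c d p)"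
    and q: "q \<in> rsmooth a b c d" "bounded (rcomp a b c d q)"
  shows "rcomp a b c d p = rcomp a b c d q"
proof -
  have *: "\<exists>r1 r2 r3 r4. four_roots a b c d r1 r2 r3 r4 \<and>
      (\<forall>t. r2 < t \<longrightarrow> t < r3 \<longrightarrow> ellipse_point a b c d t 0 \<in> rcomp a b c d p)"
    if p: "p \<in> rsmooth a b c d" "bounded (rcomp a b c d p)" for p
  proof -
    obtain x y z where xyz: "(x, y, z) \<in> rcomp a b c d p" "(x, y, z) \<in> rsurf a b c d"
      "\<not> centre b c (x, y, z)" "\<bar>x\<bar> < 2" using bounded_component_noncentral[OF p] by blast
    have eq: "rcomp a b c d (x, y, z) = rcomp a b c d p"
      using xyz(1) connected_component_eq[of "(x, y, z)" "rsmooth a b c d" p] by simp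
    obtain r1 r2 r3 r4 where r: "four_roots a b c d r1 r2 r3 r4" "r2 < x" "x < r3"
      by (rule bounded_component_four_roots[OF xyz(2-4)]) (simp_all only: eq p(2))
    let ?band = "{(x, y, z) \<in> rsurf a b c d. x \<in> {r2<..<r3}}"
    have J: "{r2<..<r3} \<subseteq> {- 2<..<2}" using r(1) by (auto simp: four_roots_def)
    have "?band \<subseteq> rcomp a b c d (x, y, z)"
      using band_connected[OF _ J] four_roots_pos[OF r(1)] xyz(2) r(2,3)
      by (intro connected_component_maximal) auto
    moreover have "ellipse_point a b c d t 0 \<in> ?band" if "r2 < t" "t < r3" for t
    proof -
      have "\<bar>t\<bar> < 2" using subsetD[OF J, of t] that by (simp add: abs_less_iff)
      hence "ellipse_point a b c d t 0 \<in> rsurf a b c d"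
        using ellipse_point_in_rsurf four_roots_pos[OF r(1) that] less_imp_le by blast
      thus ?thesis using that by (simp add: ellipse_point_def del: in_rsurf)
    qed
    ultimately have "\<forall>t. r2 < t \<longrightarrow> t < r3 \<longrightarrow>
        ellipse_point a b c d t 0 \<in> rcomp a b c d p"
      unfolding eq by (intro allI impI) (erule subsetD, assumption)
    with r(1) show ?thesis by (intro exI conjI)
  qed
  from *[OF p] obtain r1 r2 r3 r4 where r: "four_roots a b c d r1 r2 r3 r4"
    "\<forall>t. r2 < t \<longrightarrow> t < r3 \<longrightarrow> ellipse_point a b c d t 0 \<in> rcomp a b c d p"
    by (elim exE conjE)
  from *[OF q] obtain s1 s2 s3 s4 where s: "four_roots a b c d s1 s2 s3 s4"
    "\<forall>t. s2 < t \<longrightarrow> t < s3 \<longrightarrow> ellipse_point a b c d t 0 \<in> rcomp a b c d q"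
    by (elim exE conjE)
  obtain t where t: "r2 < t" "t < r3" "s2 < t" "t < s3" using four_roots_overlap[OF r(1) s(1)] by blast
  show ?thesis
    using connected_component_eq[OF r(2)[rule_format, OF t(1,2)]]
      connected_component_eq[OF s(2)[rule_format, OF t(3,4)]] by simp
qed

section \<open>Representations into SU(2)\<close>

text \<open>By Fricke's identity the first factor is the trace of the commutator minus 2, for two
  matrices of determinant 1 with traces \<open>a\<close>, \<open>b\<close> and product of trace
  \<open>x\<close>; the second factor is the same for \<open>c\<close>, \<open>d\<close>.\<close>

lemma fibre_poly_Pi:
  "fibre_poly (a * b + c * d) (b * c + a * d) (a * c + b * d) (4 - a\<^sup>2 - b\<^sup>2 - c\<^sup>2 - d\<^sup>2 - a * b * c * d) x =
    (x\<^sup>2 - a * b * x + a\<^sup>2 + b\<^sup>2 - 4) * (x\<^sup>2 - c * d * x + c\<^sup>2 + d\<^sup>2 - 4)"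
  unfolding fibre_poly_def by (simp add: power2_eq_square algebra_simps)

lemma four_roots_coefficients:
  assumes "four_roots a b c d r1 r2 r3 r4"
  shows "a = r1 + r2 + r3 + r4" "d = - 4 - (r1 * r4 + r2 * r3 + (r1 + r4) * (r2 + r3))"
proof -
  define e1 e2 e3 e4 where "e1 = r1 + r2 + r3 + r4" and "e2 = r1 * r4 + r2 * r3 + (r1 + r4) * (r2 + r3)"
    and "e3 = r1 * r2 * r3 + r1 * r2 * r4 + r1 * r3 * r4 + r2 * r3 * r4" and "e4 = r1 * r2 * r3 * r4"
  have "(t - r1) * (t - r2) * (t - r3) * (t - r4) = t * t * t * t - e1 * (t * t * t) + e2 * (t * t) - e3 * t + e4" for t
    by (simp add: e1_def e2_def e3_def e4_def algebra_simps)
  moreover have "fibre_poly a b c d t = (t - r1) * (t - r2) * (t - r3) * (t - r4)" for t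
    using assms unfolding four_roots_def by blast
  moreover have "fibre_poly a b c d t = t * t * t * t - a * (t * t * t) - (d + 4) * (t * t) + (4 * a - b * c) * t + (4 * d + b * b + c * c)" for t
    unfolding fibre_poly_def by (simp add: power2_eq_square algebra_simps)
  ultimately have eq: "t * t * t * t - a * (t * t * t) - (d + 4) * (t * t) + (4 * a - b * c) * t + (4 * d + b * b + c * c) =
      t * t * t * t - e1 * (t * t * t) + e2 * (t * t) - e3 * t + e4" for t by metis
  \<comment> \<open>Opaque names for the nonlinear lower coefficients: evaluation at sample points
    then leaves linear equations.\<close>
  define k1 k2 where "k1 = 4 * a - b * c" and "k2 = 4 * d + b * b + c * c"
  note eq' = eq[folded k1_def k2_def]
  have "a = e1" using eq'[of 1] eq'[of "- 1"] eq'[of 2] eq'[of "- 2"] by simp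
  moreover have "- (d + 4) = e2" using eq'[of 0] eq'[of 1] eq'[of "- 1"] by simp
  ultimately show "a = r1 + r2 + r3 + r4" "d = - 4 - (r1 * r4 + r2 * r3 + (r1 + r4) * (r2 + r3))"
    unfolding e1_def e2_def by linarith+
qed

text \<open>Pairing the outer roots and the inner roots makes both quadratic factors of the quartic
  negative at \<open>x\<close>, which is what a representation into \<open>SU(2)\<close> requires.\<close>

lemma four_roots_parameters:
  assumes r: "four_roots A B C D r1 r2 r3 r4" and x: "r2 < x" "x < r3"
  obtains a b c d where "A = a * b + c * d" "B = b * c + a * d" "C = a * c + b * d"
    "D = 4 - a\<^sup>2 - b\<^sup>2 - c\<^sup>2 - d\<^sup>2 - a * b * c * d"
    "x\<^sup>2 - a * b * x + a\<^sup>2 + b\<^sup>2 - 4 < 0" "x\<^sup>2 - c * d * x + c\<^sup>2 + d\<^sup>2 - 4 < 0"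
proof -
  have ord: "- 2 \<le> r1" "r1 \<le> r2" "r2 < r3" "r3 \<le> r4" "r4 \<le> 2" using r by (auto simp: four_roots_def)
  \<comment> \<open>For a quadratic factor with roots \<open>u\<close>, \<open>v\<close> the
    conditions are \<open>a b = u + v\<close> and \<open>a^2 + b^2 = 4 + u v\<close>; equivalently
    \<open>a + b\<close> and \<open>a - b\<close> are square roots of \<open>(2 + u) (2 + v)\<close>
    and \<open>(2 - u) (2 - v)\<close>.\<close>
  have half: "\<exists>a b. a + b = s \<and> a - b = t \<and> a * b = u + v \<and> a\<^sup>2 + b\<^sup>2 = 4 + u * v"
    if "s * s = (2 + u) * (2 + v)" "t * t = (2 - u) * (2 - v)" for s t u v :: real
  proof (rule exI[of _ "(s + t) / 2"], rule exI[of _ "(s - t) / 2"], intro conjI)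
    have "(s + t) / 2 * ((s - t) / 2) = (s * s - t * t) / 4" by (simp add: field_simps)
    also have "\<dots> = u + v" unfolding that by (simp add: algebra_simps)
    finally show "(s + t) / 2 * ((s - t) / 2) = u + v" .
    have "((s + t) / 2)\<^sup>2 + ((s - t) / 2)\<^sup>2 = (s * s + t * t) / 2" by (simp add: power2_eq_square field_simps)
    also have "\<dots> = 4 + u * v" unfolding that by (simp add: algebra_simps)
    finally show "((s + t) / 2)\<^sup>2 + ((s - t) / 2)\<^sup>2 = 4 + u * v" .
  qed (simp_all add: field_simps)
  define s where "s = sqrt ((2 + r1) * (2 + r4))"
  define t where "t = sqrt ((2 - r1) * (2 - r4))"
  \<comment> \<open>The values of the quartic at -2 and 2 fix \<open>(a + b) (c + d) = B + C\<close>
    and \<open>(a - b) (c - d) = C - B\<close> up to sign; the signs of \<open>s'\<close> and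
    \<open>t'\<close> are chosen to make both hold.\<close>
  define s' where "s' = (if B + C \<ge> 0 then 1 else - 1) * sqrt ((2 + r2) * (2 + r3))"
  define t' where "t' = (if C - B \<ge> 0 then 1 else - 1) * sqrt ((2 - r2) * (2 - r3))"
  have pos: "(2 + r1) * (2 + r4) \<ge> 0" "(2 - r1) * (2 - r4) \<ge> 0" "(2 + r2) * (2 + r3) \<ge> 0" "(2 - r2) * (2 - r3) \<ge> 0"
    using ord by (auto intro!: mult_nonneg_nonneg)
  have sq: "s * s = (2 + r1) * (2 + r4)" "t * t = (2 - r1) * (2 - r4)"
    "s' * s' = (2 + r2) * (2 + r3)" "t' * t' = (2 - r2) * (2 - r3)"
    using pos by (simp_all add: s_def t_def s'_def t'_def)
  obtain a b where ab: "a + b = s" "a - b = t" "a * b = r1 + r4" "a\<^sup>2 + b\<^sup>2 = 4 + r1 * r4"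
    using half[OF sq(1,2)] by blast
  obtain c d where cd: "c + d = s'" "c - d = t'" "c * d = r2 + r3" "c\<^sup>2 + d\<^sup>2 = 4 + r2 * r3"
    using half[OF sq(3,4)] by blast
  have P: "fibre_poly A B C D t = (t - r1) * (t - r2) * (t - r3) * (t - r4)" for t
    using r unfolding four_roots_def by blast
  have "(B + C)\<^sup>2 = (2 + r1) * (2 + r4) * ((2 + r2) * (2 + r3))"
    using P[of "- 2"] unfolding fibre_poly_at_2 by (simp add: algebra_simps)
  hence "\<bar>B + C\<bar> = sqrt ((2 + r1) * (2 + r4)) * sqrt ((2 + r2) * (2 + r3))"
    by (metis real_sqrt_abs real_sqrt_mult)
  hence BC1: "s * s' = B + C" by (auto simp: s_def s'_def)
  have "(C - B)\<^sup>2 = (2 - r1) * (2 - r4) * ((2 - r2) * (2 - r3))"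
    using P[of 2] unfolding fibre_poly_at_2 by (simp add: algebra_simps power2_eq_square)
  hence "\<bar>C - B\<bar> = sqrt ((2 - r1) * (2 - r4)) * sqrt ((2 - r2) * (2 - r3))"
    by (metis real_sqrt_abs real_sqrt_mult)
  hence BC2: "t * t' = C - B" by (auto simp: t_def t'_def)
  have "(a + b) * (c + d) = B + C" "(a - b) * (c - d) = C - B" using ab cd BC1 BC2 by simp_all
  hence 1: "(a * c + b * d) + (b * c + a * d) = C + B" "(a * c + b * d) - (b * c + a * d) = C - B"
    by (simp_all add: algebra_simps)
  show thesis
  proof (rule that)
    show "A = a * b + c * d" unfolding ab cd using four_roots_coefficients(1)[OF r] by simp
    show "B = b * c + a * d" "C = a * c + b * d" using 1 by linarith+
    have "4 - a\<^sup>2 - b\<^sup>2 - c\<^sup>2 - d\<^sup>2 - a * b * c * d = 4 - (a\<^sup>2 + b\<^sup>2) - (c\<^sup>2 + d\<^sup>2) - (a * b) * (c * d)"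
      by simp
    also have "\<dots> = D" unfolding ab cd using four_roots_coefficients(2)[OF r] by simp
    finally show "D = 4 - a\<^sup>2 - b\<^sup>2 - c\<^sup>2 - d\<^sup>2 - a * b * c * d" by simp
    have "x\<^sup>2 - a * b * x + a\<^sup>2 + b\<^sup>2 - 4 = x\<^sup>2 - (a * b) * x + (a\<^sup>2 + b\<^sup>2) - 4" by simp
    also have "\<dots> = (x - r1) * (x - r4)" unfolding ab by (simp add: power2_eq_square algebra_simps)
    also have "\<dots> < 0" using x ord by (intro mult_pos_neg) auto
    finally show "x\<^sup>2 - a * b * x + a\<^sup>2 + b\<^sup>2 - 4 < 0" .
    have "x\<^sup>2 - c * d * x + c\<^sup>2 + d\<^sup>2 - 4 = x\<^sup>2 - (c * d) * x + (c\<^sup>2 + d\<^sup>2) - 4" by simp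
    also have "\<dots> = (x - r2) * (x - r3)" unfolding cd by (simp add: power2_eq_square algebra_simps)
    also have "\<dots> < 0" using x ord by (intro mult_pos_neg) auto
    finally show "x\<^sup>2 - c * d * x + c\<^sup>2 + d\<^sup>2 - 4 < 0" .
  qed
qed

section \<open>Matrices in SU(2) and representations of the presented group\<close>

definition su2 :: "complex \<Rightarrow> complex \<Rightarrow> complex ^ 2 ^ 2"
  where "su2 p q = mat2 p q (- cnj q) (cnj p)"

lemma mat2_adjoint: "transpose (map_matrix cnj (mat2 p q r s)) = mat2 (cnj p) (cnj r) (cnj q) (cnj s)"
  by (simp add: vec_eq_iff forall_2 transpose_def map_matrix_def)

lemma su2_mult: "su2 p q ** su2 p' q' = su2 (p * p' - q * cnj q') (p * q' + q * cnj p')"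
  by (simp add: su2_def mat2_mult mat2_eq_iff algebra_simps)

lemma su2_in_SU2: "p * cnj p + q * cnj q = 1 \<Longrightarrow> su2 p q \<in> carrier SU2"
  by (simp add: SU2_def su2_def mat2_adjoint mat2_mult mat_eq_mat2 mat2_eq_iff det_2 algebra_simps)

lemma trace_su2: "trace (su2 p q) = of_real (2 * Re p)"
  by (simp add: su2_def trace_def sum_2 complex_add_cnj)

lemma SU2_cases:
  assumes "M \<in> carrier SU2"
  obtains p q where "M = su2 p q" "p * cnj p + q * cnj q = 1"
proof -
  obtain p q r s where M: "M = mat2 p q r s" by (rule mat2_exhaust)
  have eqs: "p * cnj p + q * cnj q = 1" "p * cnj r + q * cnj s = 0" "r * cnj p + s * cnj q = 0" "p * s - q * r = 1"
    using assms by (auto simp: SU2_def M mat2_adjoint mat2_mult mat_eq_mat2 mat2_eq_iff det_2)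
  have "s = s * (p * cnj p + q * cnj q)" by (simp add: eqs)
  also have "\<dots> = (p * s - q * r) * cnj p + q * (r * cnj p + s * cnj q)" by (simp add: algebra_simps)
  also have "\<dots> = cnj p" by (simp add: eqs)
  finally have s: "s = cnj p" .
  have "r = r * (p * cnj p + q * cnj q)" by (simp add: eqs)
  also have "\<dots> = p * (r * cnj p + s * cnj q) - (p * s - q * r) * cnj q" by (simp add: algebra_simps)
  also have "\<dots> = - cnj q" by (simp add: eqs)
  finally have "M = su2 p q" unfolding M su2_def s by simp
  thus thesis using eqs(1) by (rule that)
qed

lemma SU2_mult_closed: "M \<in> carrier SU2 \<Longrightarrow> N \<in> carrier SU2 \<Longrightarrow> M ** N \<in> carrier SU2"
proof -
  assume "M \<in> carrier SU2" "N \<in> carrier SU2"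
  then obtain p q p' q' where M: "M = su2 p q" "p * cnj p + q * cnj q = 1"
    and N: "N = su2 p' q'" "p' * cnj p' + q' * cnj q' = 1" by (metis SU2_cases)
  have "(p * p' - q * cnj q') * cnj (p * p' - q * cnj q') + (p * q' + q * cnj p') * cnj (p * q' + q * cnj p') =
      (p * cnj p + q * cnj q) * (p' * cnj p' + q' * cnj q')" by (simp add: algebra_simps)
  thus ?thesis using M N by (simp add: su2_mult su2_in_SU2)
qed

text \<open>On \<open>SU2\<close> the conjugate transpose is the inverse, which is how it serves for
  inverse letters in words.\<close>

definition adj :: "complex ^ 2 ^ 2 \<Rightarrow> complex ^ 2 ^ 2"
  where "adj M = transpose (map_matrix cnj M)"

lemma adj_su2: "adj (su2 p q) = su2 (cnj p) (- q)"
  by (simp add: adj_def su2_def mat2_adjoint)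

lemma SU2_adj:
  assumes "M \<in> carrier SU2"
  shows "adj M \<in> carrier SU2" "M ** adj M = mat 1" "adj M ** M = mat 1" "trace (adj M) = trace M"
proof -
  obtain p q where M: "M = su2 p q" "p * cnj p + q * cnj q = 1" using assms by (rule SU2_cases)
  show "adj M \<in> carrier SU2" using M by (simp add: adj_su2 su2_in_SU2 mult.commute)
  have one: "mat 1 = su2 1 0" by (simp add: su2_def mat_eq_mat2)
  show "M ** adj M = mat 1" "adj M ** M = mat 1"
    using M by (simp_all add: adj_su2 su2_mult one mult.commute)
  show "trace (adj M) = trace M" by (simp add: M adj_su2 trace_su2)
qed

fun word_rep :: "(loop \<Rightarrow> complex ^ 2 ^ 2) \<Rightarrow> loop_word \<Rightarrow> complex ^ 2 ^ 2" where
  "word_rep f [] = mat 1"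
| "word_rep f ((g, e) # w) = (if e then adj (f g) else f g) ** word_rep f w"

lemma word_rep_append: "word_rep f (u @ v) = word_rep f u ** word_rep f v"
  by (induction f u rule: word_rep.induct) (auto simp: matrix_mul_assoc)

lemma one_in_SU2: "mat 1 \<in> carrier SU2"
  using su2_in_SU2[of 1 0] by (simp add: su2_def mat_eq_mat2)

text \<open>The matrix value of a word is unchanged by both kinds of \<open>loop_step\<close>, so it
  descends to classes of words.\<close>

lemma representation_from_generators:
  assumes "\<And>g. f g \<in> carrier SU2"
    and rel: "f loop_alpha ** (f loop_beta ** (f loop_gamma ** f loop_delta)) = mat 1"
  obtains \<rho> where "\<rho> \<in> hom pi1 SU2" "\<And>g. \<rho> (loop_gen g) = f g"
proof -
  have step: "word_rep f u = word_rep f v" if "loop_step u v" for u v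
    using that
  proof (induction rule: loop_step.induct)
    case (cancel u g e v)
    have "word_rep f [(g, e), (g, \<not> e)] = mat 1" using SU2_adj(2,3)[OF assms(1)[of g]] by simp
    thus ?case unfolding word_rep_append by simp
  next
    case (relator u v)
    have "word_rep f [(loop_alpha, False), (loop_beta, False), (loop_gamma, False), (loop_delta, False)] = mat 1"
      using rel by simp
    thus ?case unfolding word_rep_append by simp
  qed
  have eqv: "word_rep f u = word_rep f v" if "equivclp loop_step u v" for u v
    using that by (induction rule: equivclp_induct) (auto dest: step)
  define \<rho> where "\<rho> K = word_rep f (SOME w. w \<in> K)" for K
  have \<rho>: "\<rho> (loop_class w) = word_rep f w" for w
  proof -
    have "w \<in> loop_class w" by (simp add: loop_class_def)
    hence "(SOME v. v \<in> loop_class w) \<in> loop_class w" by (rule someI)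
    thus ?thesis unfolding \<rho>_def by (metis (no_types, lifting) eqv loop_class_def mem_Collect_eq)
  qed
  have mem: "word_rep f w \<in> carrier SU2" for w
  proof (induction w)
    case (Cons l w)
    thus ?case using assms(1) by (cases l) (auto intro!: SU2_mult_closed SU2_adj(1))
  qed (simp add: one_in_SU2)
  have "\<rho> \<in> hom pi1 SU2"
  proof (rule homI)
    fix K assume "K \<in> carrier pi1"
    thus "\<rho> K \<in> carrier SU2" using \<rho> mem by (auto simp: carrier_pi1)
  next
    fix K L assume "K \<in> carrier pi1" "L \<in> carrier pi1"
    then obtain u v where "K = loop_class u" "L = loop_class v" by (auto simp: carrier_pi1)
    thus "\<rho> (K \<otimes>\<^bsub>pi1\<^esub> L) = \<rho> K \<otimes>\<^bsub>SU2\<^esub> \<rho> L"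
      by (simp add: loop_class_mult \<rho> word_rep_append SU2_def)
  qed
  moreover have "\<rho> (loop_gen g) = f g" for g by (simp add: loop_gen_def \<rho>)
  ultimately show thesis by (rule that)
qed

text \<open>The relation forces \<open>loop_delta\<close> to be sent to the inverse of
  \<open>P ** Q ** R\<close>, and inversion preserves traces in \<open>SU2\<close>.\<close>

lemma representation_of_triple:
  assumes "P \<in> carrier SU2" "Q \<in> carrier SU2" "R \<in> carrier SU2"
  obtains \<rho> where "\<rho> \<in> hom pi1 SU2"
    "chi \<rho> = (trace P, trace Q, trace R, trace (P ** Q ** R), trace (P ** Q), trace (Q ** R), trace (R ** P))"
proof -
  define f where "f g = (case g of loop_alpha \<Rightarrow> P | loop_beta \<Rightarrow> Q | loop_gamma \<Rightarrow> R | loop_delta \<Rightarrow> adj (P ** Q ** R))" for g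
  have PQR: "P ** Q ** R \<in> carrier SU2" using assms by (intro SU2_mult_closed)
  have "f g \<in> carrier SU2" for g using assms SU2_adj(1)[OF PQR] by (cases g) (auto simp: f_def)
  moreover have "f loop_alpha ** (f loop_beta ** (f loop_gamma ** f loop_delta)) = mat 1"
    using SU2_adj(2)[OF PQR] by (simp add: f_def matrix_mul_assoc)
  ultimately obtain \<rho> where \<rho>: "\<rho> \<in> hom pi1 SU2" "\<And>g. \<rho> (loop_gen g) = f g"
    by (rule representation_from_generators) (use that in blast)
  have "\<rho> (loop_gen g \<otimes>\<^bsub>pi1\<^esub> loop_gen h) = f g ** f h" for g h
  proof -
    have "loop_gen g \<in> carrier pi1" "loop_gen h \<in> carrier pi1" by (auto simp: loop_gen_def carrier_pi1)
    hence "\<rho> (loop_gen g \<otimes>\<^bsub>pi1\<^esub> loop_gen h) = \<rho> (loop_gen g) \<otimes>\<^bsub>SU2\<^esub> \<rho> (loop_gen h)"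
      using hom_mult[OF \<rho>(1)] by blast
    thus ?thesis by (simp add: \<rho>(2) SU2_def)
  qed
  hence "chi \<rho> = (trace P, trace Q, trace R, trace (P ** Q ** R), trace (P ** Q), trace (Q ** R), trace (R ** P))"
    using SU2_adj(4)[OF PQR] by (simp add: chi_def \<rho>(2) f_def)
  with \<rho>(1) show thesis by (rule that)
qed

text \<open>Phrased with three matrices instead of a homomorphism, so that the cyclic renaming of
  coordinates merely renames \<open>P\<close>, \<open>Q\<close>, \<open>R\<close>.\<close>

definition su2_realised :: "real \<Rightarrow> real \<Rightarrow> real \<Rightarrow> real \<Rightarrow> real \<Rightarrow> real \<Rightarrow> real \<Rightarrow> bool"
  where "su2_realised A B C D x y z \<longleftrightarrow> (\<exists>a b c d P Q R. A = a * b + c * d \<and> B = b * c + a * d \<and> C = a * c + b * d \<and>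
      D = 4 - a\<^sup>2 - b\<^sup>2 - c\<^sup>2 - d\<^sup>2 - a * b * c * d \<and> P \<in> carrier SU2 \<and> Q \<in> carrier SU2 \<and> R \<in> carrier SU2 \<and>
      trace P = of_real a \<and> trace Q = of_real b \<and> trace R = of_real c \<and> trace (P ** Q ** R) = of_real d \<and>
      trace (P ** Q) = of_real x \<and> trace (Q ** R) = of_real y \<and> trace (R ** P) = of_real z)"

text \<open>After conjugation \<open>P ** Q\<close> is diagonal with entry \<open>n\<close> of angle
  \<open>\<phi>\<close>. The traces of \<open>P\<close>, \<open>Q\<close> and of \<open>R\<close>,
  \<open>P ** Q ** R\<close> determine the diagonal entries of \<open>P\<close> and
  \<open>R\<close>, and the norms of the off-diagonal ones. The relative phase of the latter is
  free; it moves \<open>(y, z)\<close> once around the ellipse.\<close>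

lemma su2_realised_if_factors_neg:
  fixes a b c d x y z :: real
  assumes S: "(x, y, z) \<in> rsurf (a * b + c * d) (b * c + a * d) (a * c + b * d) (4 - a\<^sup>2 - b\<^sup>2 - c\<^sup>2 - d\<^sup>2 - a * b * c * d)"
    and x: "\<bar>x\<bar> < 2"
    and neg: "x\<^sup>2 - a * b * x + a\<^sup>2 + b\<^sup>2 - 4 < 0" "x\<^sup>2 - c * d * x + c\<^sup>2 + d\<^sup>2 - 4 < 0"
  shows "su2_realised (a * b + c * d) (b * c + a * d) (a * c + b * d) (4 - a\<^sup>2 - b\<^sup>2 - c\<^sup>2 - d\<^sup>2 - a * b * c * d) x y z"
proof -
  define A B C D where "A = a * b + c * d" and "B = b * c + a * d" and "C = a * c + b * d"
    and "D = 4 - a\<^sup>2 - b\<^sup>2 - c\<^sup>2 - d\<^sup>2 - a * b * c * d"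
  define \<phi> where "\<phi> = arccos (x / 2)"
  define co si where "co = cos \<phi>" and "si = sin \<phi>"
  have xco: "x = 2 * co" using x by (simp add: co_def \<phi>_def cos_arccos)
  have unit: "co * co + si * si = 1" by (simp add: co_def si_def flip: power2_eq_square)
  have si: "si > 0" unfolding si_def \<phi>_def sin_arccos_half[OF x] using four_minus_square_pos[OF x] by simp
  have x4: "4 - x\<^sup>2 = 4 * (si * si)" using unit by (simp add: xco power2_eq_square algebra_simps)
  have ss: "si * si > 0" using si by simp
  \<comment> \<open>Imaginary parts of the diagonal entries, solved from the traces of
    \<open>Q\<close> and of \<open>P ** Q ** R\<close>.\<close>
  define p2 p2' where "p2 = (b - a * co) / (2 * si)" and "p2' = - (d - c * co) / (2 * si)"
  have p2: "2 * si * p2 = b - a * co" "2 * si * p2' = - (d - c * co)" using si by (simp_all add: p2_def p2'_def)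
  define p p' n where "p = Complex (a / 2) p2" and "p' = Complex (c / 2) p2'" and "n = Complex co si"
  \<comment> \<open>What the diagonal entries leave for the squared norms of the off-diagonal
    entries of \<open>P\<close> and \<open>R\<close>; positivity is the sign of the quadratic
    factors.\<close>
  define \<kappa> \<kappa>' where "\<kappa> = - (x\<^sup>2 - a * b * x + a\<^sup>2 + b\<^sup>2 - 4) / (4 - x\<^sup>2)"
    and "\<kappa>' = - (x\<^sup>2 - c * d * x + c\<^sup>2 + d\<^sup>2 - 4) / (4 - x\<^sup>2)"
  have \<kappa>: "\<kappa> > 0" using neg four_minus_square_pos[OF x] unfolding \<kappa>_def by (intro divide_pos_pos) auto
  have norm_eq: "a / 2 * (a / 2) + p2 * p2 = 1 - \<kappa>" "c / 2 * (c / 2) + p2' * p2' = 1 - \<kappa>'"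
  proof -
    have aux: "a / 2 * (a / 2) + q * q = 1 - - (x\<^sup>2 - a * b * x + a\<^sup>2 + b\<^sup>2 - 4) / (4 - x\<^sup>2)"
      if "2 * si * q = b - a * co \<or> 2 * si * q = - (b - a * co)" for a b q
    proof -
      have "(2 * si * q) * (2 * si * q) = (b - a * co) * (b - a * co)"
        using that by (elim disjE) (simp_all only: minus_mult_minus)
      hence "4 * (si * si) * (a / 2 * (a / 2) + q * q) = a * a * (co * co + si * si) + b * b - 2 * a * b * co"
        by (simp add: algebra_simps)
      hence 1: "4 * (si * si) * (a / 2 * (a / 2) + q * q) = a * a + b * b - 2 * a * b * co" by (simp add: unit)
      have gen: "m * (1 - e / m) = m - e" if "m \<noteq> 0" for m e :: real
        using that by (simp add: right_diff_distrib)
      have "4 * (si * si) * (1 - - (x\<^sup>2 - a * b * x + a\<^sup>2 + b\<^sup>2 - 4) / (4 - x\<^sup>2)) = (4 - x\<^sup>2) - - (x\<^sup>2 - a * b * x + a\<^sup>2 + b\<^sup>2 - 4)"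
        unfolding x4[symmetric] by (rule gen) (use four_minus_square_pos[OF x] in simp)
      also have "\<dots> = a * a + b * b - 2 * a * b * co" by (simp add: xco power2_eq_square)
      finally have "4 * (si * si) * (1 - - (x\<^sup>2 - a * b * x + a\<^sup>2 + b\<^sup>2 - 4) / (4 - x\<^sup>2)) =
          4 * (si * si) * (a / 2 * (a / 2) + q * q)" using 1 by simp
      thus ?thesis using ss by (metis mult_left_cancel mult_eq_0_iff less_irrefl zero_neq_numeral)
    qed
    show "a / 2 * (a / 2) + p2 * p2 = 1 - \<kappa>" "c / 2 * (c / 2) + p2' * p2' = 1 - \<kappa>'"
      unfolding \<kappa>_def \<kappa>'_def using p2 by (intro aux; simp)+
  qed
  define Y Z where "Y = y_centre B C x" and "Z = y_centre C B x"
  have YZ: "4 * (si * si) * Y = 2 * B - x * C" "4 * (si * si) * Z = 2 * C - x * B"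
    unfolding Y_def Z_def y_centre_def x4 using si by simp_all
  have cancel: "u = v" if "4 * (si * si) * u = 4 * (si * si) * v" for u v :: real
    using that ss by (metis mult_left_cancel mult_eq_0_iff less_irrefl zero_neq_numeral)
  have prods: "(2 * si * p2) * (2 * si * p2') = - ((b - a * co) * (d - c * co))"
    unfolding p2 by (simp only: mult_minus_right)
  have Rpp: "2 * Re (p * p') = Z"
  proof (rule cancel)
    have "4 * (si * si) * (2 * Re (p * p')) = 2 * (a * c * (si * si)) - 2 * ((2 * si * p2) * (2 * si * p2'))"
      by (simp add: p_def p'_def algebra_simps)
    also have "\<dots> = 2 * (a * c * (co * co + si * si)) + 2 * (b * d) - 2 * co * (b * c + a * d)"
      unfolding prods by (simp add: algebra_simps)
    also have "\<dots> = 4 * (si * si) * Z" unfolding unit YZ by (simp add: xco B_def C_def)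
    finally show "4 * (si * si) * (2 * Re (p * p')) = 4 * (si * si) * Z" .
  qed
  have Rpnp: "2 * Re (cnj p * n * p') = Y"
  proof (rule cancel)
    have "4 * (si * si) * (2 * Re (cnj p * n * p')) =
        2 * co * (a * c * (si * si)) + 2 * co * ((2 * si * p2) * (2 * si * p2')) +
        2 * (si * si) * (c * (2 * si * p2) - a * (2 * si * p2'))"
      by (simp add: p_def p'_def n_def algebra_simps)
    also have "\<dots> = 2 * (si * si) * (b * c + a * d) - 2 * co * (a * c) * (si * si) -
        2 * co * (b * d) + 2 * (co * co) * (b * c + a * d) - 2 * co * (a * c) * (co * co)"
      unfolding prods p2 by (simp add: algebra_simps)
    also have "\<dots> = 2 * (co * co + si * si) * (b * c + a * d) - 2 * co * (a * c) * (co * co + si * si) - 2 * co * (b * d)"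
      by (simp add: algebra_simps)
    also have "\<dots> = 4 * (si * si) * Y" unfolding unit YZ by (simp add: xco B_def C_def algebra_simps)
    finally show "4 * (si * si) * (2 * Re (cnj p * n * p')) = 4 * (si * si) * Y" .
  qed
  have S': "(x, y, z) \<in> rsurf A B C D" using S by (simp only: A_def B_def C_def D_def)
  obtain t where t: "(x, y, z) = ellipse_point A B C D x t" using ellipse_point_exists[OF S' x] .
  define r where "r = ellipse_radius A B C D x"
  have yz: "y = Y + r * cos t" "z = Z - r * cos (t + \<phi>)"
    using t by (simp_all add: ellipse_point_def Y_def Z_def r_def \<phi>_def)
  \<comment> \<open>The intended value of \<open>q * cnj q'\<close>: its argument is the shifted
    ellipse parameter, and its modulus fits because the quartic is the product of the two
    factors.\<close>
  define w where "w = Complex (r / 2 * cos (t + \<phi>)) (r / 2 * sin (t + \<phi>))"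
  have normw: "Re w * Re w + Im w * Im w = \<kappa> * \<kappa>'"
  proof -
    have "Re w * Re w + Im w * Im w = r / 2 * (r / 2) * ((sin (t + \<phi>))\<^sup>2 + (cos (t + \<phi>))\<^sup>2)"
      by (simp only: w_def complex.sel power2_eq_square algebra_simps)
    hence "Re w * Re w + Im w * Im w = r\<^sup>2 / 4"
      unfolding sin_cos_squared_add by (simp add: power2_eq_square)
    hence "(4 - x\<^sup>2) * (4 - x\<^sup>2) * (Re w * Re w + Im w * Im w) = r\<^sup>2 * (4 - x\<^sup>2)\<^sup>2 / 4"
      by (simp add: power2_eq_square)
    also have "\<dots> = fibre_poly A B C D x"
      unfolding r_def ellipse_radius_square[OF x fibre_poly_nonneg(1)[OF S' x]] by simp
    also have "\<dots> = ((4 - x\<^sup>2) * \<kappa>) * ((4 - x\<^sup>2) * \<kappa>')"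
    proof -
      have "(4 - x\<^sup>2) * \<kappa> = - (x\<^sup>2 - a * b * x + a\<^sup>2 + b\<^sup>2 - 4)" "(4 - x\<^sup>2) * \<kappa>' = - (x\<^sup>2 - c * d * x + c\<^sup>2 + d\<^sup>2 - 4)"
        unfolding \<kappa>_def \<kappa>'_def using four_minus_square_pos[OF x] by simp_all
      thus ?thesis unfolding A_def B_def C_def D_def fibre_poly_Pi by (simp only: minus_mult_minus)
    qed
    finally have "(4 - x\<^sup>2) * (4 - x\<^sup>2) * (Re w * Re w + Im w * Im w) = (4 - x\<^sup>2) * (4 - x\<^sup>2) * (\<kappa> * \<kappa>')"
      by (simp only: mult.assoc mult.left_commute)
    thus ?thesis using four_minus_square_pos[OF x] by simp
  qed
  \<comment> \<open>Conjugation by diagonal matrices allows \<open>q\<close> to be real and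
    positive; \<open>w\<close> then fixes \<open>q'\<close>.\<close>
  define q q' where "q = complex_of_real (sqrt \<kappa>)" and "q' = cnj w / complex_of_real (sqrt \<kappa>)"
  have sk: "sqrt \<kappa> \<noteq> 0" "sqrt \<kappa> * sqrt \<kappa> = \<kappa>" using \<kappa> by simp_all
  have qq: "q * cnj q' = w" using sk(1) by (simp add: q_def q'_def)
  have cc: "r * cnj r = of_real (Re r * Re r + Im r * Im r)" for r
    by (simp add: complex_eq_iff)
  have "p * cnj p + q * cnj q = of_real ((a / 2 * (a / 2) + p2 * p2) + sqrt \<kappa> * sqrt \<kappa>)"
    unfolding cc by (simp add: p_def q_def)
  hence 1: "p * cnj p + q * cnj q = 1" unfolding norm_eq sk by simp
  have "q' * cnj q' = (w * cnj w) / of_real (sqrt \<kappa> * sqrt \<kappa>)"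
    by (simp only: q'_def complex_cnj_divide complex_cnj_cnj complex_cnj_complex_of_real
        times_divide_times_eq of_real_mult mult.commute)
  also have "\<dots> = of_real \<kappa>'" unfolding cc normw sk using \<kappa> by simp
  finally have "p' * cnj p' + q' * cnj q' = of_real ((c / 2 * (c / 2) + p2' * p2') + \<kappa>')"
    unfolding cc by (simp add: p'_def)
  hence 2: "p' * cnj p' + q' * cnj q' = 1" unfolding norm_eq by simp
  have n1: "n * cnj n = 1" unfolding cc using unit by (simp add: n_def)
  have n2: "cnj n * (n * k) = k" for k using n1 by (metis mult.assoc mult.commute mult_1)
  define P Q R where "P = su2 p q" and "Q = su2 (cnj p * n) (- (q * cnj n))" and "R = su2 p' q'"
  have PQ: "P ** Q = su2 n 0"
  proof -
    have "p * (cnj p * n) - q * cnj (- (q * cnj n)) = (p * cnj p + q * cnj q) * n" by (simp add: algebra_simps)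
    thus ?thesis unfolding P_def Q_def su2_mult 1 by (simp add: algebra_simps)
  qed
  show ?thesis unfolding su2_realised_def
  proof (rule exI[of _ a], rule exI[of _ b], rule exI[of _ c], rule exI[of _ d],
      rule exI[of _ P], rule exI[of _ Q], rule exI[of _ R], intro conjI refl)
    show "P \<in> carrier SU2" "R \<in> carrier SU2" unfolding P_def R_def using 1 2 by (simp_all add: su2_in_SU2)
    have "(cnj p * n) * cnj (cnj p * n) + (- (q * cnj n)) * cnj (- (q * cnj n)) = (n * cnj n) * (p * cnj p + q * cnj q)"
      by (simp add: algebra_simps)
    thus "Q \<in> carrier SU2" unfolding Q_def 1 n1 by (intro su2_in_SU2) simp
    show "trace P = of_real a" "trace R = of_real c" by (simp_all add: P_def R_def trace_su2 p_def p'_def)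
    have "2 * Re (cnj p * n) = b" using p2(1) by (simp add: p_def n_def algebra_simps)
    thus "trace Q = of_real b" unfolding Q_def trace_su2 by simp
    have "2 * Re (n * p') = d" using p2(2) by (simp add: p'_def n_def algebra_simps)
    thus "trace (P ** Q ** R) = of_real d" unfolding PQ R_def su2_mult trace_su2 by simp
    show "trace (P ** Q) = of_real x" unfolding PQ trace_su2 by (simp add: n_def xco)
    have "2 * Re (w * cnj n) = r * (cos (t + \<phi>) * cos \<phi> + sin (t + \<phi>) * sin \<phi>)"
      by (simp add: w_def n_def co_def si_def algebra_simps)
    hence Rw: "2 * Re (w * cnj n) = r * cos t" unfolding cos_diff[symmetric] by simp
    have "cnj p * n * p' - - (q * cnj n) * cnj q' = cnj p * n * p' + w * cnj n" by (simp add: algebra_simps flip: qq)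
    hence "2 * Re (cnj p * n * p' - - (q * cnj n) * cnj q') = y"
      unfolding yz by (simp only: plus_complex.sel distrib_left Rpnp Rw)
    thus "trace (Q ** R) = of_real y" unfolding Q_def R_def su2_mult trace_su2 by simp
    have "Re (q' * cnj q) = Re (cnj (q * cnj q'))" by (simp add: mult.commute)
    hence "2 * Re (q' * cnj q) = r * cos (t + \<phi>)" unfolding qq by (simp add: w_def)
    moreover have "2 * Re (p' * p) = Z" using Rpp by (simp add: mult.commute)
    ultimately have "2 * Re (p' * p - q' * cnj q) = z" unfolding yz by (simp only: minus_complex.sel right_diff_distrib)
    thus "trace (R ** P) = of_real z" unfolding P_def R_def su2_mult trace_su2 by simp
  qed
qed

lemma su2_realised_cyc:
  assumes "su2_realised B C A D y z x"
  shows "su2_realised A B C D x y z"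
proof -
  from assms obtain a b c d P Q R where *: "B = a * b + c * d" "C = b * c + a * d" "A = a * c + b * d"
    "D = 4 - a\<^sup>2 - b\<^sup>2 - c\<^sup>2 - d\<^sup>2 - a * b * c * d" "P \<in> carrier SU2" "Q \<in> carrier SU2" "R \<in> carrier SU2"
    "trace P = of_real a" "trace Q = of_real b" "trace R = of_real c" "trace (P ** Q ** R) = of_real d"
    "trace (P ** Q) = of_real y" "trace (Q ** R) = of_real z" "trace (R ** P) = of_real x"
    unfolding su2_realised_def by (elim exE conjE)
  have "trace (R ** P ** Q) = of_real d"
    using *(11) trace_mul_sym[of R "P ** Q"] by (simp add: matrix_mul_assoc)
  with * show ?thesis unfolding su2_realised_def
    by (intro exI[of _ c] exI[of _ a] exI[of _ b] exI[of _ d] exI[of _ R] exI[of _ P] exI[of _ Q])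
      (simp add: algebra_simps)
qed

theorem su2_realised_bounded_component:
  assumes p: "(x, y, z) \<in> rsmooth A B C D" and bdd: "bounded (rcomp A B C D (x, y, z))"
  shows "su2_realised A B C D x y z"
proof -
  have key: "su2_realised A B C D x y z"
    if S: "(x, y, z) \<in> rsurf A B C D" and nc: "\<not> centre B C (x, y, z)"
      and bdd: "bounded (rcomp A B C D (x, y, z))" for x y z A B C D
  proof -
    have x2: "\<bar>x\<bar> < 2" using bounded_component_strip[OF S nc bdd] .
    obtain r1 r2 r3 r4 where r: "four_roots A B C D r1 r2 r3 r4" "r2 < x" "x < r3"
      using bounded_component_four_roots[OF S nc x2 bdd] .
    obtain a b c d where par: "A = a * b + c * d" "B = b * c + a * d" "C = a * c + b * d"
      "D = 4 - a\<^sup>2 - b\<^sup>2 - c\<^sup>2 - d\<^sup>2 - a * b * c * d"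
      "x\<^sup>2 - a * b * x + a\<^sup>2 + b\<^sup>2 - 4 < 0" "x\<^sup>2 - c * d * x + c\<^sup>2 + d\<^sup>2 - 4 < 0"
      using four_roots_parameters[OF r] .
    show ?thesis unfolding par(1-4)
      by (rule su2_realised_if_factors_neg[OF S[unfolded par(1-4)] x2 par(5,6)])
  qed
  show ?thesis
  proof (cases "centre B C (x, y, z)")
    case False
    have "(x, y, z) \<in> rsurf A B C D" using p by (simp only: in_rsmooth)
    thus ?thesis using False bdd by (rule key)
  next
    case True
    hence nc: "\<not> centre C A (y, z, x)" using rsmooth_noncentre p by blast
    have S: "(y, z, x) \<in> rsurf B C A D" using p by (simp add: in_rsmooth algebra_simps)
    have "bounded (rcomp B C A D (y, z, x))"
      using connected_component_cyc[of B C A D "(x, y, z)"] bdd by (simp add: bounded_cyc)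
    thus ?thesis by (rule su2_realised_cyc[OF key[OF S nc]])
  qed
qed

section \<open>Orbits\<close>

text \<open>If \<open>x\<close> were outside \<open>F\<close>, a neighbouring point would exhibit
  \<open>x - x'\<close> as a difference of elements of \<open>F\<close> divided by the nonzero
  \<open>z\<close> or \<open>y\<close>, with \<open>x'\<close> in \<open>F\<close>.\<close>

theorem orbit_in_subfield:
  fixes F :: "'a::field set"
  assumes F: "\<And>u v. u \<in> F \<Longrightarrow> v \<in> F \<Longrightarrow> u + v \<in> F" "\<And>u v. u \<in> F \<Longrightarrow> v \<in> F \<Longrightarrow> u - v \<in> F"
      "\<And>u v. u \<in> F \<Longrightarrow> v \<in> F \<Longrightarrow> u / v \<in> F"
    and Ob: "transitive_orbit a b c Ob" "infinite Ob \<or> card Ob > 4" "noncentral_coordinates_in F a b c Ob"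
  shows "Ob \<subseteq> F \<times> F \<times> F"
proof -
  have *: "x \<in> F" if Ob: "transitive_orbit a b c Ob" "infinite Ob \<or> card Ob > 4" "noncentral_coordinates_in F a b c Ob"
      and p: "(x, y, z) \<in> Ob" for a b c x y z and Ob :: "('a \<times> 'a \<times> 'a) set"
  proof (rule ccontr)
    assume "x \<notin> F"
    then obtain x' where x': "x' \<in> F" "y \<in> F" "z \<in> F"
      "z \<noteq> 0 \<and> y + (x - x') * z \<in> F \<or> y \<noteq> 0 \<and> z + (x - x') * y \<in> F"
      using neighbours_of_exceptional_point[OF Ob p] by metis
    hence "z \<noteq> 0 \<and> x' + (y + (x - x') * z - y) / z \<in> F \<or> y \<noteq> 0 \<and> x' + (z + (x - x') * y - z) / y \<in> F"
      by (meson F)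
    with \<open>x \<notin> F\<close> show False by auto
  qed
  have "x \<in> F \<and> y \<in> F \<and> z \<in> F" if p: "(x, y, z) \<in> Ob" for x y z
  proof (intro conjI)
    note Ob' = transitive_orbit_cyc[OF Ob(1)] orbit_size_cyc[OF Ob(2)] noncentral_coordinates_in_cyc[OF Ob(3)]
    note Ob'' = transitive_orbit_cyc[OF Ob'(1)] orbit_size_cyc[OF Ob'(2)] noncentral_coordinates_in_cyc[OF Ob'(3)]
    show "x \<in> F" using *[OF Ob p] .
    show "y \<in> F" using *[OF Ob', of y z x] p by simp
    show "z \<in> F" using *[OF Ob'', of z x y] p by simp
  qed
  thus ?thesis by auto
qed

lemma parameters_in_subfield:
  fixes F :: "complex set"
  assumes F: "\<And>u v. u \<in> F \<Longrightarrow> v \<in> F \<Longrightarrow> u + v \<in> F" "\<And>u v. u \<in> F \<Longrightarrow> v \<in> F \<Longrightarrow> u - v \<in> F"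
      "\<And>u v. u \<in> F \<Longrightarrow> v \<in> F \<Longrightarrow> u / v \<in> F"
    and Ob: "invariant_under A B C Ob" "Ob \<subseteq> F \<times> F \<times> F" "m \<in> Ob" "m \<in> surface A B C D"
  shows "{A, B, C, D} \<subseteq> F"
proof -
  have mult: "u * v \<in> F" if "u \<in> F" "v \<in> F" for u v
  proof (cases "v = 0")
    case False
    \<comment> \<open>The product as a quotient: \<open>v / v / v\<close> is the inverse of
      \<open>v\<close>.\<close>
    have "u / (v / v / v) \<in> F" by (intro F that)
    thus ?thesis using False by simp
  qed (use that in simp)
  obtain x y z where m: "m = (x, y, z)" by (cases m) auto
  have mem: "x \<in> F" "y \<in> F" "z \<in> F" "A - x - y * z \<in> F" "B - y - x * z \<in> F" "C - z - x * y \<in> F"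
    using Ob(1-3) unfolding m invariant_under_def by blast+
  have "(A - x - y * z) + (x + y * z) \<in> F" "(B - y - x * z) + (y + x * z) \<in> F" "(C - z - x * y) + (z + x * y) \<in> F"
    by (intro F mult mem)+
  hence ABC: "A \<in> F" "B \<in> F" "C \<in> F" by simp_all
  have "D = x * x + y * y + z * z + x * y * z - A * x - B * y - C * z"
    using Ob(4) by (simp add: m surface_def power2_eq_square algebra_simps)
  moreover have "x * x + y * y + z * z + x * y * z - A * x - B * y - C * z \<in> F"
    by (intro F mult mem ABC)
  ultimately show ?thesis using ABC by simp
qed

text \<open>For finite \<open>N\<close> this leaves finitely many values even at exceptional points,
  although \<open>x\<close> itself may lie outside \<open>N\<close>.\<close>

lemma exceptional_coordinate_value:
  fixes N :: "complex set"
  assumes "transitive_orbit a b c Ob" "infinite Ob" "noncentral_coordinates_in N a b c Ob" "(x, y, z) \<in> Ob"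
  shows "x \<in> N \<union> (\<lambda>(u, v, w). a - u - v * w) ` (N \<times> N \<times> N)"
proof (cases "x \<in> N")
  case False
  then obtain x' where x': "x' \<in> N" "y \<in> N" "z \<in> N" "a = x + x' + y * z"
    using neighbours_of_exceptional_point[OF assms(1) disjI1[OF assms(2)] assms(3,4)] by metis
  have "x = (\<lambda>(u, v, w). a - u - v * w) (x', y, z)" using x'(4) by simp
  with x'(1-3) show ?thesis by blast
qed simp

theorem infinite_orbit_non_cyclotomic:
  assumes Ob: "transitive_orbit A B C Ob" "infinite Ob" "m \<in> Ob" "m \<in> surface A B C D"
  shows "\<not> noncentral_coordinates_in {x. cyclotomic x} A B C Ob"
proof
  assume cycl: "noncentral_coordinates_in {x. cyclotomic x} A B C Ob"
  let ?Q = "{x. (CC.algebraic over \<rat>) x}"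
  note inv = Ob(1)[unfolded transitive_orbit_def, THEN conjunct1]
  have "noncentral_coordinates_in ?Q A B C Ob"
    using cycl cyclotomic_algebraic unfolding noncentral_coordinates_in_def by blast
  hence Q: "Ob \<subseteq> ?Q \<times> ?Q \<times> ?Q"
    using Ob(1,2) by (intro orbit_in_subfield[of ?Q A B C]) (auto intro: algebraic_closed)
  have par: "{A, B, C, D} \<subseteq> ?Q"
    using Q by (intro parameters_in_subfield[OF _ _ _ inv _ Ob(3,4)]) (auto intro: algebraic_closed)
  obtain x y z where m: "m = (x, y, z)" by (cases m) auto
  have alg: "\<And>u. u \<in> {A, B, C, x, y, z} \<Longrightarrow> (CC.algebraic over \<rat>) u" using par Q Ob(3) m by auto
  obtain F where F: "number_field F" "{A, B, C, x, y, z} \<subseteq> F"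
    by (rule number_field_of_algebraic_numbers[of "{A, B, C, x, y, z}", OF _ alg]) (simp, assumption, rule that)
  have mult: "u * v \<in> F" if "u \<in> F" "v \<in> F" for u v
  proof (cases "v = 0")
    case False
    have "u / (v / v / v) \<in> F" by (intro number_field_closed[OF F(1)] that)
    thus ?thesis using False by simp
  qed (use that in simp)
  \<comment> \<open>By minimality of the orbit, one of its points in this invariant set is
    enough.\<close>
  have "invariant_under A B C (F \<times> F \<times> F)"
    using F(2) unfolding invariant_under_def by (auto intro!: number_field_closed(2)[OF F(1)] mult)
  moreover have "F \<times> F \<times> F \<inter> Ob \<noteq> {}" using Ob(3) F(2) m by auto
  ultimately have OF: "Ob \<subseteq> F \<times> F \<times> F" using Ob(1) unfolding transitive_orbit_def by blast
  let ?N = "{x \<in> F. cyclotomic x}"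
  have finN: "finite ?N" using F(1) by (rule finite_cyclotomic_number_field)
  have N: "noncentral_coordinates_in ?N A B C Ob"
    using cycl OF unfolding noncentral_coordinates_in_def by blast
  let ?V = "\<lambda>a. ?N \<union> (\<lambda>(u, v, w). a - u - v * w) ` (?N \<times> ?N \<times> ?N)"
  have "x \<in> ?V A \<and> y \<in> ?V B \<and> z \<in> ?V C" if p: "(x, y, z) \<in> Ob" for x y z
  proof (intro conjI)
    have inf: "infinite (cyc ` Ob)" "infinite (cyc ` cyc ` Ob)"
      using Ob(2) by (simp_all add: finite_image_iff inj_on_subset[OF inj_cyc])
    show "x \<in> ?V A" using exceptional_coordinate_value[OF Ob(1,2) N p] .
    show "y \<in> ?V B"
      using exceptional_coordinate_value[OF transitive_orbit_cyc[OF Ob(1)] inf(1) noncentral_coordinates_in_cyc[OF N], of y z x] p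
      by simp
    show "z \<in> ?V C"
      using exceptional_coordinate_value[OF transitive_orbit_cyc[OF transitive_orbit_cyc[OF Ob(1)]] inf(2)
          noncentral_coordinates_in_cyc[OF noncentral_coordinates_in_cyc[OF N]], of z x y] p
      by simp
  qed
  hence "Ob \<subseteq> ?V A \<times> ?V B \<times> ?V C" by auto
  moreover have "finite (?V A \<times> ?V B \<times> ?V C)"
    using finN by (intro finite_cartesian_product finite_UnI finite_imageI)
  ultimately show False using Ob(2) finite_subset by blast
qed

section \<open>Closures and bounded components as invariant sets\<close>

lemma closure_cyc: "closure (cyc ` V) = cyc ` closure V" for V :: "(real \<times> real \<times> real) set"
proof
  show "closure (cyc ` V) \<subseteq> cyc ` closure V"
    by (intro closure_minimal image_mono closure_subset cyc_closed closed_closure)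
  show "cyc ` closure V \<subseteq> closure (cyc ` V)"
    by (intro image_closure_subset continuous_on_cyc closed_closure closure_subset)
qed

lemma invariant_under_closure:
  fixes Ob :: "(real \<times> real \<times> real) set"
  assumes "invariant_under a b c Ob"
  shows "invariant_under a b c (closure Ob)"
proof -
  have *: "f p \<in> closure Ob" if "continuous_on UNIV f" "f ` Ob \<subseteq> Ob" "p \<in> closure Ob"
    for f :: "real \<times> real \<times> real \<Rightarrow> real \<times> real \<times> real" and p
  proof -
    have "f ` closure Ob \<subseteq> closure Ob"
      using that(2) closure_subset by (intro image_closure_subset continuous_on_subset[OF that(1)]) auto
    thus ?thesis using that(3) by blast
  qed
  have 1: "continuous_on UNIV (\<lambda>(x, y, z). (a - x - y * z, y, z))"
    "continuous_on UNIV (\<lambda>(x, y, z). (x, b - y - x * z, z))"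
    "continuous_on UNIV (\<lambda>(x, y, z). (x, y, c - z - x * y))"
    unfolding case_prod_beta by (intro continuous_intros)+
  have 2: "(\<lambda>(x, y, z). (a - x - y * z, y, z)) ` Ob \<subseteq> Ob"
    "(\<lambda>(x, y, z). (x, b - y - x * z, z)) ` Ob \<subseteq> Ob"
    "(\<lambda>(x, y, z). (x, y, c - z - x * y)) ` Ob \<subseteq> Ob"
    using assms unfolding invariant_under_def by auto
  show ?thesis unfolding invariant_under_def
    using *[OF 1(1) 2(1)] *[OF 1(2) 2(2)] *[OF 1(3) 2(3)] by fastforce
qed

lemma invariant_under_rsmooth: "invariant_under a b c (rsmooth a b c d)"
  unfolding invariant_under_def
proof (intro allI impI conjI)
  fix x y z assume p: "(x, y, z) \<in> rsmooth a b c d"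
  show "(a - x - y * z, y, z) \<in> rsmooth a b c d"
  proof -
    have "(a - x - y * z, y, z) \<in> rsurf a b c d" using p by (simp add: in_rsmooth power2_eq_square algebra_simps)
    moreover have "a - x - y * z = x" if "2 * (a - x - y * z) + y * z = a"
      using that by (simp only: right_diff_distrib)
    ultimately show ?thesis using p unfolding in_rsmooth by metis
  qed
  show "(x, b - y - x * z, z) \<in> rsmooth a b c d"
  proof -
    have "(x, b - y - x * z, z) \<in> rsurf a b c d" using p by (simp add: in_rsmooth power2_eq_square algebra_simps)
    moreover have "b - y - x * z = y" if "2 * (b - y - x * z) + x * z = b"
      using that by (simp only: right_diff_distrib)
    ultimately show ?thesis using p unfolding in_rsmooth by metis
  qed
  show "(x, y, c - z - x * y) \<in> rsmooth a b c d"
  proof -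
    have "(x, y, c - z - x * y) \<in> rsurf a b c d" using p by (simp add: in_rsmooth power2_eq_square algebra_simps)
    moreover have "c - z - x * y = z" if "2 * (c - z - x * y) + x * y = c"
      using that by (simp only: right_diff_distrib)
    ultimately show ?thesis using p unfolding in_rsmooth by metis
  qed
qed

text \<open>\<open>f\<close> maps the compact closure of the component of \<open>q\<close> onto a
  compact set that contains the component of \<open>f q\<close>, which is therefore bounded;
  uniqueness of the bounded component identifies the two.\<close>

lemma involution_preserves_bounded_component:
  fixes f :: "real \<times> real \<times> real \<Rightarrow> real \<times> real \<times> real"
  assumes f: "continuous_on UNIV f" "\<And>q. f (f q) = q" "f ` rsmooth a b c d \<subseteq> rsmooth a b c d"
    and p: "bounded (rcomp a b c d p)"
    and q: "q \<in> rcomp a b c d p"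
  shows "f q \<in> rcomp a b c d p"
proof -
  let ?T = "rsmooth a b c d"
  let ?C = "rcomp a b c d"
  have Cq: "?C q = ?C p" using connected_component_eq[OF q] by simp
  have qT: "q \<in> ?T" using q connected_component_subset by blast
  hence fqT: "f q \<in> ?T" using f(3) by blast
  have "f ` ?C (f q) \<subseteq> ?C q"
  proof (rule connected_component_maximal)
    show "q \<in> f ` ?C (f q)" using fqT f(2) by (intro image_eqI[of _ _ "f q"]) auto
    show "connected (f ` ?C (f q))"
      by (intro connected_continuous_image continuous_on_subset[OF f(1)] connected_connected_component) simp
    show "f ` ?C (f q) \<subseteq> ?T" using f(3) connected_component_subset by blast
  qed
  hence "f ` f ` ?C (f q) \<subseteq> f ` ?C q" by (rule image_mono)
  hence sub: "?C (f q) \<subseteq> f ` ?C q" by (simp add: image_image f(2))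
  have "compact (closure (?C q))" using p Cq by (simp add: compact_closure)
  hence "bounded (f ` closure (?C q))"
    by (intro compact_imp_bounded compact_continuous_image continuous_on_subset[OF f(1)]) simp
  moreover have "?C (f q) \<subseteq> f ` closure (?C q)" using sub image_mono[OF closure_subset] by (rule subset_trans)
  ultimately have "bounded (?C (f q))" by (rule bounded_subset)
  hence "?C (f q) = ?C q" using bounded_component_unique[OF fqT _ qT] p Cq by simp
  moreover have "f q \<in> ?C (f q)" using fqT by simp
  ultimately show ?thesis using Cq by simp
qed

lemma invariant_under_bounded_component:
  assumes "bounded (rcomp a b c d p)"
  shows "invariant_under a b c (rcomp a b c d p)"
proof -
  have cont: "continuous_on UNIV (\<lambda>(x, y, z). (a - x - y * z, y, z))"
    "continuous_on UNIV (\<lambda>(x, y, z). (x, b - y - x * z, z))"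
    "continuous_on UNIV (\<lambda>(x, y, z). (x, y, c - z - x * y))"
    unfolding case_prod_beta by (intro continuous_intros)+
  have T: "(\<lambda>(x, y, z). (a - x - y * z, y, z)) ` rsmooth a b c d \<subseteq> rsmooth a b c d"
    "(\<lambda>(x, y, z). (x, b - y - x * z, z)) ` rsmooth a b c d \<subseteq> rsmooth a b c d"
    "(\<lambda>(x, y, z). (x, y, c - z - x * y)) ` rsmooth a b c d \<subseteq> rsmooth a b c d"
    using invariant_under_rsmooth[of a b c d] unfolding invariant_under_def by auto
  have I: "(\<lambda>(x, y, z). (a - x - y * z, y, z)) ((\<lambda>(x, y, z). (a - x - y * z, y, z)) q) = q"
    "(\<lambda>(x, y, z). (x, b - y - x * z, z)) ((\<lambda>(x, y, z). (x, b - y - x * z, z)) q) = q"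
    "(\<lambda>(x, y, z). (x, y, c - z - x * y)) ((\<lambda>(x, y, z). (x, y, c - z - x * y)) q) = q" for q
    by (cases q; simp)+
  show ?thesis unfolding invariant_under_def
  proof (intro allI impI conjI)
    fix x y z assume q: "(x, y, z) \<in> rcomp a b c d p"
    show "(a - x - y * z, y, z) \<in> rcomp a b c d p"
      using involution_preserves_bounded_component[OF cont(1) I(1) T(1) assms q] by (simp only: prod.case)
    show "(x, b - y - x * z, z) \<in> rcomp a b c d p"
      using involution_preserves_bounded_component[OF cont(2) I(2) T(2) assms q] by (simp only: prod.case)
    show "(x, y, c - z - x * y) \<in> rcomp a b c d p"
      using involution_preserves_bounded_component[OF cont(3) I(3) T(3) assms q] by (simp only: prod.case)
  qed
qed

lemma component_subset_interior:
  assumes G: "closed G" "bounded G" "invariant_under a b c G"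
    and p: "p \<in> rsmooth a b c d" "p \<in> interior_in (rsurf a b c d) G"
  shows "rcomp a b c d p \<subseteq> interior_in (rsurf a b c d) G"
proof -
  let ?C = "rcomp a b c d p" and ?U = "interior_in (rsurf a b c d) G"
  have CT: "?C \<subseteq> rsmooth a b c d" by (rule connected_component_subset)
  have TS: "rsmooth a b c d \<subseteq> rsurf a b c d" by (auto simp: rsmooth_def)
  have "\<exists>e>0. ball q e \<inter> ?C \<subseteq> ?C \<inter> ?U" if q: "q \<in> ?C \<inter> ?U" for q
  proof -
    obtain r where r: "r > 0" "ball q r \<inter> rsurf a b c d \<subseteq> G" using q by (auto simp: interior_in_def)
    have "q' \<in> ?U" if q': "q' \<in> ball q (r / 2)" "q' \<in> ?C" for q'
    proof -
      have "ball q' (r / 2) \<subseteq> ball q r"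
      proof
        fix w assume "w \<in> ball q' (r / 2)"
        thus "w \<in> ball q r" using q'(1) dist_triangle[of q w q'] by simp
      qed
      hence "ball q' (r / 2) \<inter> rsurf a b c d \<subseteq> G" using r(2) by blast
      thus ?thesis using r(1) q'(2) CT TS unfolding interior_in_def by (intro CollectI conjI exI[of _ "r / 2"]) auto
    qed
    thus ?thesis using r(1) by (intro exI[of _ "r / 2"]) auto
  qed
  hence op: "openin (top_of_set ?C) (?C \<inter> ?U)" unfolding openin_contains_ball by blast
  have "?C \<inter> ?U = ?C \<inter> closure ?U"
    using interior_closed_in_smooth[OF G] CT closure_subset[of ?U] by blast
  hence cl: "closedin (top_of_set ?C) (?C \<inter> ?U)" by (simp only: closedin_closed_Int closed_closure)
  have "p \<in> ?C \<inter> ?U" using p by simp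
  hence "?C \<inter> ?U = ?C" using op cl connected_connected_component[of "rsmooth a b c d" p] unfolding connected_clopen by blast
  thus ?thesis by blast
qed

theorem real_infinite_bounded_orbit:
  assumes Ob: "Ob \<subseteq> rsurf a b c d" "bounded Ob" "transitive_orbit a b c Ob" "infinite Ob"
    and irr: "\<not> noncentral_coordinates_in {x. cyclotomic (complex_of_real x)} a b c Ob"
  obtains p where "p \<in> rsmooth a b c d" "bounded (rcomp a b c d p)"
    "Ob \<subseteq> rcomp a b c d p"
    "rcomp a b c d p \<subseteq> closure Ob"
proof -
  note inv = Ob(3)[unfolded transitive_orbit_def, THEN conjunct1]
  have key: "(x, y, z) \<in> interior_in (rsurf a b c d) (closure Ob)"
    if Ob: "Ob \<subseteq> rsurf a b c d" "bounded Ob" "invariant_under a b c Ob"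
      and p: "(x, y, z) \<in> Ob" "\<not> centre b c (x, y, z)" "\<not> cyclotomic (complex_of_real x)" for a b c x y z Ob
  proof -
    note inv = invariant_under_closure[OF Ob(3)]
    have pG: "(x, y, z) \<in> closure Ob" using p(1) closure_subset by blast
    have S: "(x, y, z) \<in> rsurf a b c d" using p(1) Ob(1) by blast
    have x2: "\<bar>x\<bar> < 2" using real_bounded_invariant_coordinate[OF Ob(2,3) p(1,2)] .
    show ?thesis
      by (rule ellipse_thickens[OF closed_closure bounded_closure[OF Ob(2)] inv S p(2)])
        (rule conic_orbit_dense[OF closed_closure inv pG S _ x2 p(3)])
  qed
  have "\<exists>p\<in>Ob. p \<in> interior_in (rsurf a b c d) (closure Ob)"
  proof -
    from irr obtain x y z where p: "(x, y, z) \<in> Ob" and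
      "\<not> cyclotomic (complex_of_real x) \<and> \<not> centre b c (x, y, z) \<or>
       \<not> cyclotomic (complex_of_real y) \<and> \<not> centre c a (y, z, x) \<or>
       \<not> cyclotomic (complex_of_real z) \<and> \<not> centre a b (z, x, y)"
      unfolding noncentral_coordinates_in_def by blast
    then consider "\<not> cyclotomic (complex_of_real x)" "\<not> centre b c (x, y, z)"
      | "\<not> cyclotomic (complex_of_real y)" "\<not> centre c a (y, z, x)"
      | "\<not> cyclotomic (complex_of_real z)" "\<not> centre a b (z, x, y)" by blast
    hence "(x, y, z) \<in> interior_in (rsurf a b c d) (closure Ob)"
    proof cases
      case 1
      thus ?thesis using key[OF Ob(1,2) inv p] by blast
    next
      case 2
      have "(y, z, x) \<in> interior_in (rsurf b c a d) (closure (cyc ` Ob))"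
        using 2 p Ob(1) by (intro key bounded_cyc Ob(2) invariant_under_cyc inv)
          (auto simp flip: cyc_rsmooth simp: cyc_rsurf[of a b c d, symmetric] simp del: in_rsurf)
      hence "(y, z, x) \<in> cyc ` interior_in (rsurf a b c d) (closure Ob)"
        by (simp only: closure_cyc interior_in_cyc cyc_rsurf)
      thus ?thesis by simp
    next
      case 3
      have "cyc ` cyc ` Ob \<subseteq> rsurf c a b d"
        using image_mono[OF image_mono[OF Ob(1)], of cyc cyc] by (simp only: cyc_rsurf)
      hence "(z, x, y) \<in> interior_in (rsurf c a b d) (closure (cyc ` cyc ` Ob))"
        using 3 p by (intro key bounded_cyc Ob(2) invariant_under_cyc inv) auto
      hence "(z, x, y) \<in> cyc ` cyc ` interior_in (rsurf a b c d) (closure Ob)"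
        by (simp only: closure_cyc interior_in_cyc cyc_rsurf)
      thus ?thesis by simp
    qed
    thus ?thesis using p by blast
  qed
  then obtain p where p: "p \<in> Ob" "p \<in> interior_in (rsurf a b c d) (closure Ob)" by blast
  \<comment> \<open>A singular point is fixed by all three involutions and would be its own
    orbit.\<close>
  have pT: "p \<in> rsmooth a b c d"
  proof (rule ccontr)
    assume sing: "p \<notin> rsmooth a b c d"
    obtain x y z where xyz: "p = (x, y, z)" by (cases p) auto
    have "2 * x + y * z = a" "2 * y + x * z = b" "2 * z + x * y = c"
      using sing p(1) Ob(1) by (auto simp: xyz in_rsmooth)
    hence "invariant_under a b c {p}" unfolding invariant_under_def xyz by (auto simp: algebra_simps)
    hence "Ob \<subseteq> {p}" using Ob(3) p(1) unfolding transitive_orbit_def by blast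
    thus False using Ob(4) finite_subset by blast
  qed
  let ?C = "rcomp a b c d p"
  have "?C \<subseteq> interior_in (rsurf a b c d) (closure Ob)"
    using component_subset_interior[OF closed_closure bounded_closure[OF Ob(2)] invariant_under_closure[OF inv] pT p(2)] .
  moreover have "interior_in (rsurf a b c d) (closure Ob) \<subseteq> closure Ob" by (auto simp: interior_in_def)
  ultimately have C: "?C \<subseteq> closure Ob" by blast
  hence bdd: "bounded ?C" using bounded_closure[OF Ob(2)] bounded_subset by blast
  have "p \<in> ?C" using pT by simp
  hence "?C \<inter> Ob \<noteq> {}" using p(1) by blast
  hence "Ob \<subseteq> ?C"
    using invariant_under_bounded_component[OF bdd] Ob(3) unfolding transitive_orbit_def by blast
  with pT bdd C show thesis by (intro that)
qed

section \<open>Transfer to the complex surface and its orbits\<close>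

lemma cpoint_image_rsurf:
  "cpoint ` rsurf a b c d = real_surface (of_real a) (of_real b) (of_real c) (of_real d)"
proof -
  have *: "(complex_of_real x, complex_of_real y, complex_of_real z) \<in> surface (of_real a) (of_real b) (of_real c) (of_real d)
      \<longleftrightarrow> (x, y, z) \<in> rsurf a b c d" for x y z
  proof -
    have "(complex_of_real x)\<^sup>2 + (complex_of_real y)\<^sup>2 + (complex_of_real z)\<^sup>2 + of_real x * of_real y * of_real z =
        of_real (x\<^sup>2 + y\<^sup>2 + z\<^sup>2 + x * y * z)"
      "complex_of_real a * of_real x + of_real b * of_real y + of_real c * of_real z + of_real d =
        of_real (a * x + b * y + c * z + d)" by simp_all
    thus ?thesis unfolding surface_def by (simp only: mem_Collect_eq prod.case of_real_eq_iff in_rsurf)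
  qed
  show ?thesis
  proof (intro subset_antisym subsetI)
    fix p assume "p \<in> cpoint ` rsurf a b c d"
    then obtain x y z where "(x, y, z) \<in> rsurf a b c d" "p = cpoint (x, y, z)" by auto
    thus "p \<in> real_surface (of_real a) (of_real b) (of_real c) (of_real d)"
      unfolding real_surface_def using * by (simp del: in_rsurf)
  next
    fix p assume "p \<in> real_surface (of_real a) (of_real b) (of_real c) (of_real d)"
    then obtain x y z where p: "p = (of_real x, of_real y, of_real z)"
      "(complex_of_real x, complex_of_real y, complex_of_real z) \<in> surface (of_real a) (of_real b) (of_real c) (of_real d)"
      unfolding real_surface_def Reals_def by auto
    hence "(x, y, z) \<in> rsurf a b c d" using * by blast
    thus "p \<in> cpoint ` rsurf a b c d" using p(1) by (intro image_eqI[of _ _ "(x, y, z)"]) simp_all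
  qed
qed

lemma singular_points_iff:
  "(x, y, z) \<in> singular_points A B C D \<longleftrightarrow>
    (x, y, z) \<in> surface A B C D \<and> 2 * x + y * z = A \<and> 2 * y + x * z = B \<and> 2 * z + x * y = C"
proof -
  let ?f = "\<lambda>(x, y, z). x\<^sup>2 + y\<^sup>2 + z\<^sup>2 + x * y * z - A * x - B * y - C * z - D :: complex"
  let ?f' = "\<lambda>(h, k, l). (2 * x + y * z - A) * h + (2 * y + x * z - B) * k + (2 * z + x * y - C) * l"
  have deriv: "(?f has_derivative ?f') (at (x, y, z))"
    unfolding case_prod_beta power2_eq_square
    by (rule has_derivative_eq_rhs, (rule derivative_intros)+) (simp add: fun_eq_iff algebra_simps)
  have "(?f has_derivative (\<lambda>_. 0)) (at (x, y, z)) \<longleftrightarrow> ?f' = (\<lambda>_. 0)"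
  proof
    assume "(?f has_derivative (\<lambda>_. 0)) (at (x, y, z))"
    from has_derivative_unique[OF deriv this] show "?f' = (\<lambda>_. 0)" .
  next
    assume "?f' = (\<lambda>_. 0)"
    with deriv show "(?f has_derivative (\<lambda>_. 0)) (at (x, y, z))" by (simp only:)
  qed
  also have "\<dots> \<longleftrightarrow> 2 * x + y * z = A \<and> 2 * y + x * z = B \<and> 2 * z + x * y = C"
  proof
    assume eq: "?f' = (\<lambda>_. 0)"
    show "2 * x + y * z = A \<and> 2 * y + x * z = B \<and> 2 * z + x * y = C"
      using fun_cong[OF eq, of "(1, 0, 0)"] fun_cong[OF eq, of "(0, 1, 0)"] fun_cong[OF eq, of "(0, 0, 1)"] by simp
  qed auto
  finally show ?thesis unfolding singular_points_def by (simp only: mem_Collect_eq)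
qed

lemma cpoint_image_rsmooth:
  "cpoint ` rsmooth a b c d = smooth_real_surface (of_real a) (of_real b) (of_real c) (of_real d)"
proof -
  have "cpoint p \<in> singular_points (of_real a) (of_real b) (of_real c) (of_real d) \<longleftrightarrow> p \<notin> rsmooth a b c d"
    if S: "p \<in> rsurf a b c d" for p
  proof -
    obtain x y z where p: "p = (x, y, z)" by (cases p) auto
    have "cpoint p \<in> surface (of_real a) (of_real b) (of_real c) (of_real d)"
      using imageI[OF S, of cpoint] unfolding cpoint_image_rsurf real_surface_def by blast
    thus ?thesis using S unfolding p cpoint_simp singular_points_iff of_real_gradient_eq in_rsmooth by blast
  qed
  hence "cpoint ` rsurf a b c d - singular_points (of_real a) (of_real b) (of_real c) (of_real d) =
      cpoint ` {p \<in> rsurf a b c d. p \<in> rsmooth a b c d}" by blast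
  also have "{p \<in> rsurf a b c d. p \<in> rsmooth a b c d} = rsmooth a b c d" by (auto simp: rsmooth_def)
  finally show ?thesis unfolding smooth_real_surface_def cpoint_image_rsurf by simp
qed

lemma connected_component_cpoint:
  "connected_component_set (cpoint ` T) (cpoint p) = cpoint ` connected_component_set T p"
proof (cases "p \<in> T")
  case True
  show ?thesis
  proof (rule subset_antisym)
    show "cpoint ` connected_component_set T p \<subseteq> connected_component_set (cpoint ` T) (cpoint p)"
      using True by (intro connected_component_maximal connected_continuous_image continuous_on_cpoint
          connected_connected_component image_mono connected_component_subset imageI) simp
    have "rpoint ` connected_component_set (cpoint ` T) (cpoint p) \<subseteq> connected_component_set T p"
    proof (rule connected_component_maximal)
      show "p \<in> rpoint ` connected_component_set (cpoint ` T) (cpoint p)"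
        using True by (intro image_eqI[of _ _ "cpoint p"]) simp_all
      show "connected (rpoint ` connected_component_set (cpoint ` T) (cpoint p))"
        by (intro connected_continuous_image continuous_on_rpoint connected_connected_component)
      have "rpoint ` connected_component_set (cpoint ` T) (cpoint p) \<subseteq> rpoint ` cpoint ` T"
        by (intro image_mono connected_component_subset)
      thus "rpoint ` connected_component_set (cpoint ` T) (cpoint p) \<subseteq> T" by (simp add: image_image)
    qed
    hence "cpoint ` rpoint ` connected_component_set (cpoint ` T) (cpoint p) \<subseteq> cpoint ` connected_component_set T p"
      by (rule image_mono)
    moreover have id: "cpoint (rpoint q) = q" if "q \<in> connected_component_set (cpoint ` T) (cpoint p)" for q
    proof -
      have "q \<in> cpoint ` T" using that connected_component_subset by blast
      then obtain p' where "q = cpoint p'" by blast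
      thus ?thesis by (simp only: rpoint_cpoint)
    qed
    have "cpoint ` rpoint ` connected_component_set (cpoint ` T) (cpoint p) = (\<lambda>q. q) ` connected_component_set (cpoint ` T) (cpoint p)"
      unfolding image_image by (rule image_cong[OF refl id])
    ultimately show "connected_component_set (cpoint ` T) (cpoint p) \<subseteq> cpoint ` connected_component_set T p"
      by (simp only: image_ident)
  qed
next
  case False
  hence "cpoint p \<notin> cpoint ` T" using inj_image_mem_iff[OF inj_cpoint] by blast
  thus ?thesis using False by (metis connected_component_eq_empty image_empty)
qed

text \<open>Reversed words undo words, so an invariant set that meets the orbit contains the base
  point and with it the images under all words.\<close>

lemma surface_orbit_transitive:
  assumes "m \<in> surface A B C D"
  shows "transitive_orbit A B C (surface_orbit A B C D m)"
  unfolding transitive_orbit_def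
proof (intro conjI allI impI)
  let ?O = "surface_orbit A B C D m"
  note orb = surface_orbit_words[OF assms]
  have step: "refl_act A B C g p \<in> ?O" if p: "p \<in> ?O" for g p
  proof -
    obtain w where "p = word_act A B C w m" using p unfolding orb by blast
    hence "refl_act A B C g p = word_act A B C (g # w) m" by simp
    thus ?thesis unfolding orb by blast
  qed
  show "invariant_under A B C ?O" unfolding invariant_under_def
  proof (intro allI impI)
    fix x y z assume p: "(x, y, z) \<in> ?O"
    show "(A - x - y * z, y, z) \<in> ?O \<and> (x, B - y - x * z, z) \<in> ?O \<and> (x, y, C - z - x * y) \<in> ?O"
      using step[OF p, of RX] step[OF p, of RY] step[OF p, of RZ] by simp
  qed
  fix V assume V: "invariant_under A B C V" "V \<inter> ?O \<noteq> {}"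
  have stepV: "refl_act A B C g p \<in> V" if "p \<in> V" for g p
    using V(1) that unfolding invariant_under_def by (cases g; cases p) auto
  have words: "word_act A B C w p \<in> V" if "p \<in> V" for w p
    by (induction w) (use that stepV in auto)
  obtain w where "word_act A B C w m \<in> V" using V(2) unfolding orb by blast
  hence "m \<in> V" using words[of "word_act A B C w m" "rev w"] by (simp add: word_act_rev)
  thus "?O \<subseteq> V" using words unfolding orb by blast
qed

lemma surface_orbit_subset: "m \<in> surface A B C D \<Longrightarrow> surface_orbit A B C D m \<subseteq> surface A B C D"
  by (simp only: surface_orbit_words) (auto intro: word_act_surface)

lemma surface_orbit_base: "m \<in> surface A B C D \<Longrightarrow> m \<in> surface_orbit A B C D m"
  by (simp add: surface_orbit_words) (metis rangeI word_act.simps(1))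

lemma bounded_noncentral_real:
  fixes A B C :: complex
  assumes "bounded Ob" "invariant_under A B C Ob"
  shows "noncentral_coordinates_in \<real> A B C Ob"
  unfolding noncentral_coordinates_in_def
proof (intro allI impI conjI)
  fix x y z assume p: "(x, y, z) \<in> Ob"
  note Ob' = bounded_cyc[OF assms(1)] invariant_under_cyc[OF assms(2)]
  note Ob'' = bounded_cyc[OF Ob'(1)] invariant_under_cyc[OF Ob'(2)]
  show "x \<in> \<real> \<or> centre B C (x, y, z)" using bounded_invariant_coordinate[OF assms p] by blast
  have "(y, z, x) \<in> cyc ` Ob" "(z, x, y) \<in> cyc ` cyc ` Ob" using p by simp_all
  thus "y \<in> \<real> \<or> centre C A (y, z, x)" "z \<in> \<real> \<or> centre A B (z, x, y)"
    using bounded_invariant_coordinate[OF Ob'] bounded_invariant_coordinate[OF Ob''] by blast+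
qed

lemma finite_noncentral_cyclotomic:
  assumes "finite Ob" "invariant_under A B C Ob"
  shows "noncentral_coordinates_in {x. cyclotomic x} A B C Ob"
  unfolding noncentral_coordinates_in_def
proof (intro allI impI conjI)
  fix x y z assume p: "(x, y, z) \<in> Ob"
  note Ob' = finite_imageI[OF assms(1), of cyc] invariant_under_cyc[OF assms(2)]
  note Ob'' = finite_imageI[OF Ob'(1), of cyc] invariant_under_cyc[OF Ob'(2)]
  show "x \<in> {x. cyclotomic x} \<or> centre B C (x, y, z)" using finite_invariant_coordinate[OF assms p] by blast
  have "(y, z, x) \<in> cyc ` Ob" "(z, x, y) \<in> cyc ` cyc ` Ob" using p by simp_all
  thus "y \<in> {x. cyclotomic x} \<or> centre C A (y, z, x)" "z \<in> {x. cyclotomic x} \<or> centre A B (z, x, y)"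
    using finite_invariant_coordinate[OF Ob'] finite_invariant_coordinate[OF Ob''] by blast+
qed

lemma finite_orbit_number_field:
  assumes m: "m \<in> surface A B C D" and fin: "finite (surface_orbit A B C D m)" "card (surface_orbit A B C D m) > 4"
    and real: "{A, B, C, D} \<subseteq> \<real>" "surface_orbit A B C D m \<subseteq> \<real> \<times> \<real> \<times> \<real>"
  obtains K where "real_number_field K" "{A, B, C, D} \<subseteq> K" "surface_orbit A B C D m \<subseteq> K \<times> K \<times> K"
proof -
  let ?O = "surface_orbit A B C D m" and ?Q = "{x. (CC.algebraic over \<rat>) x}"
  note trans = surface_orbit_transitive[OF m]
  note inv = trans[unfolded transitive_orbit_def, THEN conjunct1]
  have "noncentral_coordinates_in ?Q A B C ?O"
    using finite_noncentral_cyclotomic[OF fin(1) inv] cyclotomic_algebraic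
    unfolding noncentral_coordinates_in_def by blast
  hence Q: "?O \<subseteq> ?Q \<times> ?Q \<times> ?Q"
    using trans fin by (intro orbit_in_subfield[of ?Q A B C]) (auto intro: algebraic_closed)
  have par: "{A, B, C, D} \<subseteq> ?Q"
    by (intro parameters_in_subfield[OF _ _ _ inv Q surface_orbit_base[OF m] m]) (auto intro: algebraic_closed)
  define S where "S = {A, B, C, D} \<union> fst ` ?O \<union> (fst \<circ> snd) ` ?O \<union> (snd \<circ> snd) ` ?O"
  have "finite S" using fin(1) by (simp add: S_def)
  have "S \<subseteq> ?Q \<inter> \<real>" unfolding S_def using par Q real by auto
  hence alg: "\<And>x. x \<in> S \<Longrightarrow> (CC.algebraic over \<rat>) x" and "S \<subseteq> \<real>" by auto
  from number_field_of_algebraic_numbers[OF \<open>finite S\<close> alg]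
  obtain K where K: "number_field K" "S \<subseteq> K" "K \<subseteq> \<real>" using \<open>S \<subseteq> \<real>\<close> by metis
  have "real_number_field K" using K(1,3) by (simp add: real_number_field_def number_field_def)
  moreover have "{A, B, C, D} \<subseteq> K" using K(2) by (simp add: S_def)
  moreover have "?O \<subseteq> K \<times> K \<times> K"
  proof
    fix p assume p: "p \<in> ?O"
    have "fst p \<in> S" "(fst \<circ> snd) p \<in> S" "(snd \<circ> snd) p \<in> S" unfolding S_def using p by blast+
    thus "p \<in> K \<times> K \<times> K" using K(2) by (cases p) auto
  qed
  ultimately show thesis by (rule that)
qed

lemma infinite_orbit_real_form:
  fixes a b c d :: real
  assumes m: "m \<in> surface (of_real a) (of_real b) (of_real c) (of_real d)"
    and Ob: "Ob = surface_orbit (of_real a) (of_real b) (of_real c) (of_real d) m"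
    and bdd: "bounded Ob" and inf: "infinite Ob" and real: "Ob \<subseteq> \<real> \<times> \<real> \<times> \<real>"
  obtains p where "p \<in> rsmooth a b c d" "bounded (rcomp a b c d p)"
    "Ob \<subseteq> cpoint ` rcomp a b c d p"
    "cpoint ` rcomp a b c d p \<subseteq> closure Ob"
proof -
  note trans = surface_orbit_transitive[OF m, folded Ob]
  note inv = trans[unfolded transitive_orbit_def, THEN conjunct1]
  define R where "R = {p. cpoint p \<in> Ob}"
  have OR: "Ob = cpoint ` R"
  proof (intro subset_antisym subsetI)
    fix p assume p: "p \<in> Ob"
    then obtain x y z where "p = cpoint (x, y, z)" using real unfolding Reals_def by force
    thus "p \<in> cpoint ` R" using p unfolding R_def by blast
  qed (auto simp: R_def)
  have sub: "R \<subseteq> rsurf a b c d"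
  proof
    fix p assume "p \<in> R"
    hence "cpoint p \<in> real_surface (of_real a) (of_real b) (of_real c) (of_real d)"
      using real surface_orbit_subset[OF m] unfolding R_def Ob real_surface_def by blast
    thus "p \<in> rsurf a b c d" unfolding cpoint_image_rsurf[symmetric] inj_image_mem_iff[OF inj_cpoint] .
  qed
  have tr: "transitive_orbit a b c R" unfolding transitive_orbit_def
  proof (intro conjI allI impI)
    show "invariant_under a b c R" using inv unfolding OR invariant_under_cpoint .
    fix V assume V: "invariant_under a b c V" "V \<inter> R \<noteq> {}"
    have "cpoint ` V \<inter> Ob \<noteq> {}" using V(2) unfolding OR by blast
    hence "Ob \<subseteq> cpoint ` V" using trans V(1) invariant_under_cpoint[of a b c V] unfolding transitive_orbit_def by blast
    thus "R \<subseteq> V" unfolding OR inj_image_subset_iff[OF inj_cpoint] .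
  qed
  have irr: "\<not> noncentral_coordinates_in {x. cyclotomic (complex_of_real x)} a b c R"
  proof
    assume cyc: "noncentral_coordinates_in {x. cyclotomic (complex_of_real x)} a b c R"
    have "noncentral_coordinates_in {x. cyclotomic x} (complex_of_real a) (of_real b) (of_real c) Ob"
      unfolding noncentral_coordinates_in_def
    proof (intro allI impI)
      fix u v w assume "(u, v, w) \<in> Ob"
      then obtain x y z where p: "(x, y, z) \<in> R" "u = of_real x" "v = of_real y" "w = of_real z"
        unfolding OR by auto
      show "(u \<in> {x. cyclotomic x} \<or> centre (of_real b) (of_real c) (u, v, w)) \<and>
        (v \<in> {x. cyclotomic x} \<or> centre (of_real c) (of_real a) (v, w, u)) \<and>
        (w \<in> {x. cyclotomic x} \<or> centre (of_real a) (of_real b) (w, u, v))"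
        unfolding p centre_of_real using cyc p(1) unfolding noncentral_coordinates_in_def by blast
    qed
    moreover have "m \<in> Ob" unfolding Ob by (rule surface_orbit_base[OF m])
    ultimately show False using infinite_orbit_non_cyclotomic[OF trans inf _ m] by blast
  qed
  have bddR: "bounded R" using bdd unfolding OR bounded_cpoint_iff .
  have infR: "infinite R" using inf unfolding OR by (simp add: finite_image_iff inj_on_subset[OF inj_cpoint])
  obtain p where p: "p \<in> rsmooth a b c d" "bounded (rcomp a b c d p)"
    "R \<subseteq> rcomp a b c d p" "rcomp a b c d p \<subseteq> closure R"
    using real_infinite_bounded_orbit[OF sub bddR tr infR irr] .
  have "cpoint ` closure R \<subseteq> closure Ob"
    unfolding OR by (intro image_closure_subset continuous_on_cpoint closed_closure closure_subset)
  hence "cpoint ` rcomp a b c d p \<subseteq> closure Ob"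
    using image_mono[OF p(4), of cpoint] by (rule subset_trans[rotated])
  moreover have "Ob \<subseteq> cpoint ` rcomp a b c d p"
    unfolding OR by (rule image_mono[OF p(3)])
  ultimately show thesis by (intro that[OF p(1,2)])
qed

theorem theoremC:
  fixes A B C D :: complex and m :: "complex \<times> complex \<times> complex"
  assumes "m \<in> surface A B C D"
    and "bounded (surface_orbit A B C D m)"
    and "infinite (surface_orbit A B C D m) \<or> card (surface_orbit A B C D m) > 4"
  shows "(A \<in> \<real> \<and> B \<in> \<real> \<and> C \<in> \<real> \<and> D \<in> \<real> \<and>
        surface_orbit A B C D m \<subseteq> real_surface A B C D) \<and>
      (finite (surface_orbit A B C D m) \<longrightarrow>
        (\<exists>K. real_number_field K \<and> {A, B, C, D} \<subseteq> K \<and>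
          surface_orbit A B C D m \<subseteq> K \<times> K \<times> K)) \<and>
      (infinite (surface_orbit A B C D m) \<longrightarrow>
        (\<exists>a b c d \<rho>. Pi_map (a, b, c, d) = (A, B, C, D) \<and>
          \<rho> \<in> hom pi1 SU2 \<and> chi \<rho> = (a, b, c, d, m)) \<and>
        (\<exists>K \<in> components (smooth_real_surface A B C D).
          bounded K \<and>
          (\<forall>L \<in> components (smooth_real_surface A B C D). bounded L \<longrightarrow> L = K) \<and>
          surface_orbit A B C D m \<subseteq> K \<and> K \<subseteq> closure (surface_orbit A B C D m)))"
proof -
  let ?O = "surface_orbit A B C D m"
  note trans = surface_orbit_transitive[OF assms(1)]
  note inv = trans[unfolded transitive_orbit_def, THEN conjunct1]
  have real: "?O \<subseteq> \<real> \<times> \<real> \<times> \<real>"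
    by (rule orbit_in_subfield[OF _ _ _ trans assms(3) bounded_noncentral_real[OF assms(2) inv]]) auto
  have par: "{A, B, C, D} \<subseteq> \<real>"
    by (rule parameters_in_subfield[OF _ _ _ inv real surface_orbit_base[OF assms(1)] assms(1)]) auto
  have 1: "A \<in> \<real> \<and> B \<in> \<real> \<and> C \<in> \<real> \<and> D \<in> \<real> \<and> ?O \<subseteq> real_surface A B C D"
    using par real surface_orbit_subset[OF assms(1)] unfolding real_surface_def by blast
  have 2: "\<exists>K. real_number_field K \<and> {A, B, C, D} \<subseteq> K \<and> ?O \<subseteq> K \<times> K \<times> K" if fin: "finite ?O"
  proof -
    have card: "card ?O > 4" using assms(3) fin by blast
    obtain K where "real_number_field K" "{A, B, C, D} \<subseteq> K" "?O \<subseteq> K \<times> K \<times> K"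
      using finite_orbit_number_field[OF assms(1) fin card par real] .
    thus ?thesis by (intro exI conjI)
  qed
  have 3: "(\<exists>a b c d \<rho>. Pi_map (a, b, c, d) = (A, B, C, D) \<and> \<rho> \<in> hom pi1 SU2 \<and> chi \<rho> = (a, b, c, d, m)) \<and>
      (\<exists>K \<in> components (smooth_real_surface A B C D). bounded K \<and>
        (\<forall>L \<in> components (smooth_real_surface A B C D). bounded L \<longrightarrow> L = K) \<and> ?O \<subseteq> K \<and> K \<subseteq> closure ?O)"
    if inf: "infinite ?O"
  proof
    obtain a b c d where abcd: "A = complex_of_real a" "B = complex_of_real b" "C = complex_of_real c" "D = complex_of_real d"
      using par unfolding Reals_def by auto
    let ?T = "rsmooth a b c d"
    obtain p where p: "p \<in> ?T" "bounded (connected_component_set ?T p)"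
      "?O \<subseteq> cpoint ` connected_component_set ?T p" "cpoint ` connected_component_set ?T p \<subseteq> closure ?O"
      using infinite_orbit_real_form[OF assms(1)[unfolded abcd] refl assms(2)[unfolded abcd] inf[unfolded abcd] real[unfolded abcd]]
      unfolding abcd .
    have T: "smooth_real_surface A B C D = cpoint ` ?T" unfolding abcd cpoint_image_rsmooth ..
    show "\<exists>K \<in> components (smooth_real_surface A B C D). bounded K \<and>
        (\<forall>L \<in> components (smooth_real_surface A B C D). bounded L \<longrightarrow> L = K) \<and> ?O \<subseteq> K \<and> K \<subseteq> closure ?O"
    proof (intro bexI conjI ballI impI)
      let ?K = "cpoint ` connected_component_set ?T p"
      show "?K \<in> components (smooth_real_surface A B C D)"
        unfolding T components_iff connected_component_cpoint[symmetric] using p(1) by blast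
      show "bounded ?K" using p(2) unfolding bounded_cpoint_iff .
      show "?O \<subseteq> ?K" "?K \<subseteq> closure ?O" by (fact p)+
      fix L assume L: "L \<in> components (smooth_real_surface A B C D)" "bounded L"
      then obtain q where q: "q \<in> ?T" "L = cpoint ` connected_component_set ?T q"
        unfolding T components_iff by (auto simp: connected_component_cpoint simp del: cpoint_simp)
      hence "bounded (connected_component_set ?T q)" using L(2) bounded_cpoint_iff by simp
      thus "L = ?K" using bounded_component_unique[OF q(1) _ p(1,2)] q(2) by simp
    qed
    obtain x y z where xyz: "m = cpoint (x, y, z)" "(x, y, z) \<in> connected_component_set ?T p"
      using p(3) surface_orbit_base[OF assms(1)] by auto
    have eq: "connected_component_set ?T (x, y, z) = connected_component_set ?T p"
      using connected_component_eq[OF xyz(2)] by simp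
    have "(x, y, z) \<in> ?T" using xyz(2) connected_component_subset by blast
    moreover have "bounded (connected_component_set ?T (x, y, z))" unfolding eq by (fact p(2))
    ultimately have "su2_realised a b c d x y z" by (rule su2_realised_bounded_component)
    then obtain a' b' c' d' P Q R where par: "a = a' * b' + c' * d'" "b = b' * c' + a' * d'" "c = a' * c' + b' * d'"
      "d = 4 - a'\<^sup>2 - b'\<^sup>2 - c'\<^sup>2 - d'\<^sup>2 - a' * b' * c' * d'"
      and PQR: "P \<in> carrier SU2" "Q \<in> carrier SU2" "R \<in> carrier SU2"
      and tr: "trace P = of_real a'" "trace Q = of_real b'" "trace R = of_real c'" "trace (P ** Q ** R) = of_real d'"
        "trace (P ** Q) = of_real x" "trace (Q ** R) = of_real y" "trace (R ** P) = of_real z"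
      unfolding su2_realised_def by (elim exE conjE)
    obtain \<rho> where \<rho>: "\<rho> \<in> hom pi1 SU2"
      "chi \<rho> = (trace P, trace Q, trace R, trace (P ** Q ** R), trace (P ** Q), trace (Q ** R), trace (R ** P))"
      using representation_of_triple[OF PQR] .
    have "Pi_map (of_real a', of_real b', of_real c', of_real d') = (A, B, C, D)"
      unfolding abcd par by (simp add: Pi_map_def)
    moreover have "chi \<rho> = (of_real a', of_real b', of_real c', of_real d', m)"
      unfolding \<rho>(2) tr xyz(1) by simp
    ultimately show "\<exists>a b c d \<rho>. Pi_map (a, b, c, d) = (A, B, C, D) \<and> \<rho> \<in> hom pi1 SU2 \<and> chi \<rho> = (a, b, c, d, m)"
      using \<rho>(1) by blast
  qed
  from 1 2 3 show ?thesis by blast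
qed

end
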